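(* Let $P$ be either of the two parameter spaces $P^{ST}$, $P^{Q}$ and, for $n\in\mathbb{N}$, let $P_n$ be the associated cell complex ($P_n=P^{ST}_n$ or $P_n=P^{Q}_n$ respectively). For any $\epsilon>0$ there exists $n\in\mathbb{N}$ such that, if $p$ and $p'$ belong to the same closed cell of $P_n$, then the topological entropies of the corresponding maps satisfy $|h_p-h_{p'}|<\epsilon$.
   Context: For $v\in[0,1]$ let $q_v(x)=4vx(1-x)$, and let $st_v:[0,1]\to[0,1]$ be the stunted tent map: $st_v(x)=2x$ if $x\le \frac v2$, $st_v(x)=v$ if $\frac v2\le x\le 1-\frac v2$, $st_v(x)=2-2x$ if $x\ge 1-\frac v2$. The parameter spaces $P^{Q}=[0,1]^2$ and $P^{ST}=[0,1]^2$ parametrize the pairs $(q_v,q_w)$ and $(st_v,st_w)$ respectively. In both cases a pair $(h_1,h_2)$ is viewed as $h_1:I_1\to I_2$, $h_2:I_2\to I_1$, where $I_1,I_2$ are disjoint copies of $[0,1]$, with critical points $\gamma_1=\frac12\in I_1$ and $\gamma_2=\frac12\in I_2$ (by convention, for stunted tent maps). For $p=(v,w)$, $h_p$ is the topological entropy of $q_w\circ q_v$ (if $p\in P^{Q}$) or of $st_w\circ st_v$ (if $p\in P^{ST}$). Orbits under a pair $(h_1,h_2)$ are obtained by applying $h_1$ and $h_2$ alternately. A point $x\in I_1$ (resp. $y\in I_2$) is periodic of period $2n$ if $n$ is the least positive integer with $(h_2\circ h_1)^{\circ n}(x)=x$ (resp. $(h_1\circ h_2)^{\circ n}(y)=y$).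 Such an orbit has $n$ points $x_1<\dots<x_n$ in $I_1$ and $n$ points $y_1<\dots<y_n$ in $I_2$; its order-data is the pair $(\sigma,\tau)\in S_n^2$ with $h_1(x_i)=y_{\sigma(i)}$, $h_2(y_j)=x_{\tau(j)}$. The order-data is admissible if realized by a periodic orbit of some pair of boundary anchored $(+,-)$ unimodal maps (maps $h:[0,1]\to[0,1]$ with $h(0)=h(1)=0$, increasing on $(0,\gamma)$, decreasing on $(\gamma,1)$ for some $\gamma\in(0,1)$). For admissible $(\sigma,\tau)\in S_n^2$, the left (resp. right) bone of order-data $(\sigma,\tau)$ and period $2n$ in either parameter space is the set of parameters for which $\gamma_1$ (resp. $\gamma_2$) is periodic of period $2n$ with order-data $(\sigma,\tau)$. The $n$-skeleton in either parameter space is the union of all left and right bones of period $2k\le 2n$ together with the boundary of the parameter space. Its vertices are the end-points of its bones (the points of its bones on the boundary of the parameter space) and the intersection points of its bones. The cell complex $P_n$ has as 0-cells the vertices of the $n$-skeleton, as 1-cells the connected components of the $n$-skeleton with the vertices deleted, and as 2-cells the connected components of the complement of the $n$-skeleton in the parameter space. A closed cell is the closure of a cell. *)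

theory Defs
  imports "HOL-Analysis.Analysis"
begin

section \<open>Topological entropy\<close>

text \<open>
  Bowen's definition for a map \<open>f\<close> of a compact metric space \<open>X\<close> into itself:
  the supremum over \<open>e > 0\<close> is the limit as \<open>e\<close> tends to \<open>0\<close>, and the inner supremum is
  \<open>1/n\<close> times the logarithm of the largest cardinality of an \<open>(n, e)\<close>-separated set.
  The value lives in the extended reals, where \<open>\<infinity> - \<infinity> = \<infinity>\<close>, so a bound
  \<open>\<bar>h - h'\<bar> < ereal e\<close> entails that both entropies are finite.
\<close>

definition separated_sets ::
    "('a::metric_space \<Rightarrow> 'a) \<Rightarrow> 'a set \<Rightarrow> nat \<Rightarrow> real \<Rightarrow> 'a set set" where
  "separated_sets f X n e =
     {E. E \<subseteq> X \<and> finite E \<and>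
         (\<forall>x\<in>E. \<forall>y\<in>E. x \<noteq> y \<longrightarrow> (\<exists>i<n. e < dist ((f ^^ i) x) ((f ^^ i) y)))}"

definition topological_entropy :: "('a::metric_space \<Rightarrow> 'a) \<Rightarrow> 'a set \<Rightarrow> ereal" where
  "topological_entropy f X =
     (SUP e\<in>{0<..}. limsup (\<lambda>n. SUP E\<in>separated_sets f X n e. ereal (ln (real (card E)) / real n)))"

section \<open>The two families of interval maps\<close>

text \<open>
  Self-maps of \<open>[0,1]\<close> are represented by functions on the reals; only their values on
  \<open>{0..1}\<close> matter.
\<close>

definition quadratic :: "real \<Rightarrow> real \<Rightarrow> real" where
  "quadratic v x = 4 * v * x * (1 - x)"

definition stunted_tent :: "real \<Rightarrow> real \<Rightarrow> real" where
  "stunted_tent v x =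
     (if x \<le> v / 2 then 2 * x else if x \<le> 1 - v / 2 then v else 2 - 2 * x)"

definition param_space :: "(real \<times> real) set" where
  "param_space = {0..1} \<times> {0..1}"

text \<open>
  Throughout, \<open>fam\<close> is one of \<^const>\<open>quadratic\<close> and \<^const>\<open>stunted_tent\<close>, and the parameter
  \<open>(v, w)\<close> stands for the pair \<open>fam v : I\<^sub>1 \<rightarrow> I\<^sub>2\<close>, \<open>fam w : I\<^sub>2 \<rightarrow> I\<^sub>1\<close>.
\<close>

definition pair_entropy :: "(real \<Rightarrow> real \<Rightarrow> real) \<Rightarrow> real \<times> real \<Rightarrow> ereal" where
  "pair_entropy fam p = topological_entropy (fam (snd p) \<circ> fam (fst p)) {0..1}"

section \<open>Periodic orbits of pairs and their order-data\<close>

definition has_period :: "('a \<Rightarrow> 'a) \<Rightarrow> nat \<Rightarrow> 'a \<Rightarrow> bool" where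
  "has_period f n x \<longleftrightarrow>
     0 < n \<and> (f ^^ n) x = x \<and> (\<forall>m. 0 < m \<and> m < n \<longrightarrow> (f ^^ m) x \<noteq> x)"

definition forward_orbit :: "('a \<Rightarrow> 'a) \<Rightarrow> 'a \<Rightarrow> 'a set" where
  "forward_orbit f x = range (\<lambda>k. (f ^^ k) x)"

text \<open>
  \<open>X\<close> and \<open>Y\<close> are the parts of the orbit in \<open>I\<^sub>1\<close> and \<open>I\<^sub>2\<close>; \<open>x 1 < \<dots> < x n\<close> and
  \<open>y 1 < \<dots> < y n\<close> enumerate them.
\<close>

definition order_data ::
    "(real \<Rightarrow> real) \<Rightarrow> (real \<Rightarrow> real) \<Rightarrow> real set \<Rightarrow> real set \<Rightarrow> nat \<Rightarrow>
     (nat \<Rightarrow> nat) \<Rightarrow> (nat \<Rightarrow> nat) \<Rightarrow> bool" where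
  "order_data h1 h2 X Y n \<sigma> \<tau> \<longleftrightarrow>
     \<sigma> permutes {1..n} \<and> \<tau> permutes {1..n} \<and>
     (\<exists>x y. strict_mono_on {1..n} x \<and> x ` {1..n} = X \<and>
            strict_mono_on {1..n} y \<and> y ` {1..n} = Y \<and>
            (\<forall>i\<in>{1..n}. h1 (x i) = y (\<sigma> i)) \<and>
            (\<forall>j\<in>{1..n}. h2 (y j) = x (\<tau> j)))"

text \<open>
  The argument \<open>n\<close> below means period \<open>2n\<close> for the alternating iteration of the pair,
  i.e. period \<open>n\<close> for the composition. The first predicate is for a point of \<open>I\<^sub>1\<close>, the
  second for a point of \<open>I\<^sub>2\<close>.
\<close>

definition periodic_left ::
    "(real \<Rightarrow> real) \<Rightarrow> (real \<Rightarrow> real) \<Rightarrow> nat \<Rightarrow> (nat \<Rightarrow> nat) \<Rightarrow> (nat \<Rightarrow> nat) \<Rightarrow> real \<Rightarrow> bool" where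
  "periodic_left h1 h2 n \<sigma> \<tau> x \<longleftrightarrow>
     has_period (h2 \<circ> h1) n x \<and>
     order_data h1 h2 (forward_orbit (h2 \<circ> h1) x) (h1 ` forward_orbit (h2 \<circ> h1) x) n \<sigma> \<tau>"

definition periodic_right ::
    "(real \<Rightarrow> real) \<Rightarrow> (real \<Rightarrow> real) \<Rightarrow> nat \<Rightarrow> (nat \<Rightarrow> nat) \<Rightarrow> (nat \<Rightarrow> nat) \<Rightarrow> real \<Rightarrow> bool" where
  "periodic_right h1 h2 n \<sigma> \<tau> y \<longleftrightarrow>
     has_period (h1 \<circ> h2) n y \<and>
     order_data h1 h2 (h2 ` forward_orbit (h1 \<circ> h2) y) (forward_orbit (h1 \<circ> h2) y) n \<sigma> \<tau>"

definition unimodal :: "(real \<Rightarrow> real) \<Rightarrow> bool" where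
  "unimodal h \<longleftrightarrow>
     continuous_on {0..1} h \<and> h ` {0..1} \<subseteq> {0..1} \<and> h 0 = 0 \<and> h 1 = 0 \<and>
     (\<exists>\<gamma>. 0 < \<gamma> \<and> \<gamma> < 1 \<and> strict_mono_on {0<..<\<gamma>} h \<and> strict_antimono_on {\<gamma><..<1} h)"

text \<open>
  Every periodic orbit of a pair meets \<open>I\<^sub>1\<close>, so it is enough to look at orbits of points
  of \<open>I\<^sub>1\<close>.
\<close>

definition admissible :: "nat \<Rightarrow> (nat \<Rightarrow> nat) \<Rightarrow> (nat \<Rightarrow> nat) \<Rightarrow> bool" where
  "admissible n \<sigma> \<tau> \<longleftrightarrow>
     (\<exists>h1 h2 x. unimodal h1 \<and> unimodal h2 \<and> x \<in> {0..1} \<and> periodic_left h1 h2 n \<sigma> \<tau> x)"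

section \<open>Bones, skeleton and cell complex\<close>

definition left_bone ::
    "(real \<Rightarrow> real \<Rightarrow> real) \<Rightarrow> nat \<Rightarrow> (nat \<Rightarrow> nat) \<Rightarrow> (nat \<Rightarrow> nat) \<Rightarrow> (real \<times> real) set" where
  "left_bone fam n \<sigma> \<tau> =
     {p \<in> param_space. periodic_left (fam (fst p)) (fam (snd p)) n \<sigma> \<tau> (1/2)}"

definition right_bone ::
    "(real \<Rightarrow> real \<Rightarrow> real) \<Rightarrow> nat \<Rightarrow> (nat \<Rightarrow> nat) \<Rightarrow> (nat \<Rightarrow> nat) \<Rightarrow> (real \<times> real) set" where
  "right_bone fam n \<sigma> \<tau> =
     {p \<in> param_space. periodic_right (fam (fst p)) (fam (snd p)) n \<sigma> \<tau> (1/2)}"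

definition bones :: "(real \<Rightarrow> real \<Rightarrow> real) \<Rightarrow> nat \<Rightarrow> (real \<times> real) set set" where
  "bones fam n =
     {left_bone fam k \<sigma> \<tau> | k \<sigma> \<tau>. 1 \<le> k \<and> k \<le> n \<and> admissible k \<sigma> \<tau>} \<union>
     {right_bone fam k \<sigma> \<tau> | k \<sigma> \<tau>. 1 \<le> k \<and> k \<le> n \<and> admissible k \<sigma> \<tau>}"

definition skeleton :: "(real \<Rightarrow> real \<Rightarrow> real) \<Rightarrow> nat \<Rightarrow> (real \<times> real) set" where
  "skeleton fam n = \<Union> (bones fam n) \<union> frontier param_space"

definition vertices :: "(real \<Rightarrow> real \<Rightarrow> real) \<Rightarrow> nat \<Rightarrow> (real \<times> real) set" where
  "vertices fam n =
     (\<Union> (bones fam n) \<inter> frontier param_space) \<union>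
     {p. \<exists>B\<in>bones fam n. \<exists>B'\<in>bones fam n. B \<noteq> B' \<and> p \<in> B \<inter> B'}"

definition cells0 :: "(real \<Rightarrow> real \<Rightarrow> real) \<Rightarrow> nat \<Rightarrow> (real \<times> real) set set" where
  "cells0 fam n = (\<lambda>p. {p}) ` vertices fam n"

definition cells1 :: "(real \<Rightarrow> real \<Rightarrow> real) \<Rightarrow> nat \<Rightarrow> (real \<times> real) set set" where
  "cells1 fam n = components (skeleton fam n - vertices fam n)"

definition cells2 :: "(real \<Rightarrow> real \<Rightarrow> real) \<Rightarrow> nat \<Rightarrow> (real \<times> real) set set" where
  "cells2 fam n = components (param_space - skeleton fam n)"

definition cells :: "(real \<Rightarrow> real \<Rightarrow> real) \<Rightarrow> nat \<Rightarrow> (real \<times> real) set set" where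
  "cells fam n = cells0 fam n \<union> cells1 fam n \<union> cells2 fam n"

end

theory Submission
  imports Defs "HOL-Real_Asymp.Real_Asymp"
begin

text \<open>
  A cell may be large, so closeness of the entropies on it cannot come from continuity alone. What
  is constant on a cell of \<open>P\<^sub>n\<close> are the sets \<open>neg_words\<close> of itineraries, of periods up to \<open>2n\<close>, of
  those periodic points at which the iterate reverses order. Such a point is a transverse
  crossing of the diagonal, so it persists under perturbation until its orbit meets a turning point;
  then this turning point is periodic and the parameter lies on a bone. A bone meeting a cell contains
  it, and along a bone the periodic turning point is an isolated periodic point, which no other periodic
  orbit can run into (\<open>neg_words_constant_on_cell\<close>).

  These itineraries know the entropy. To each parameter \<open>p\<close> belongs a number, \<open>growth\<close>, the
  exponential growth rate of itineraries that are followed only until they enter a neighbourhood of a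
  turning point in which orbits stay together; every periodic turning point has such a neighbourhood.
  This number has two properties.

  \<^item> The entropies at parameters near \<open>p\<close> are close to it (\<open>near_entropy_upper\<close>, \<open>near_entropy_lower\<close>). The
    upper estimate counts separated orbits by their itineraries, and the number of itineraries of given
    length cannot jump up. The lower estimate is Misiurewicz's argument: exponential growth of
    itineraries forces a horseshoe (\<open>exists_many_loops\<close>, \<open>many_full_words\<close>), which persists under
    perturbation (\<open>robust_horseshoe\<close>).

  \<^item> It is the growth rate of the number of negative words at \<open>p\<close>, and it can be read off at nearby
    parameters: the negative words of \<open>p\<close> persist there, while the total number of negative words of
    period \<open>2k\<close> exceeds that of itineraries at \<open>p\<close> by at most \<open>4k\<close> (\<open>card_neg_words_le\<close>). That a
    horseshoe contains enough order-reversing branches follows from the symmetry of the maps about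
    \<open>1/2\<close> (\<open>exists_reversing_full\<close>).

  Were the theorem false, there would be cells \<open>c\<^sub>n\<close> of \<open>P\<^sub>n\<close> and parameters in their closures with entropies at least
  \<open>\<epsilon>\<close> apart. Along a subsequence these converge to parameters \<open>p\<close> and \<open>p'\<close>. The negative words of every
  fixed period agree eventually on \<open>c\<^sub>n\<close>, so \<open>p\<close> and \<open>p'\<close> have the same growth, and by the first property the
  entropies come together: a contradiction.
\<close>

section \<open>Loops in systems of covering words\<close>

lemma summable_dominated:
  fixes f g :: "nat \<Rightarrow> real"
  assumes "summable g" "\<And>n. n \<ge> 1 \<Longrightarrow> f n \<le> g n" "\<And>n. 0 \<le> f n"
  shows "summable f"
proof (rule summable_comparison_test[OF _ assms(1)], intro exI[of _ 1] allI impI)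
  fix n :: nat assume "1 \<le> n"
  then show "norm (f n) \<le> g n" using assms(2)[of n] assms(3)[of n] by simp
qed

text \<open>
  Abel-type bookkeeping: summing the recursion against \<open>z ^ n\<close> bounds each partial sum by \<open>C * z < 1\<close>
  times itself plus a constant.
\<close>

lemma summable_of_recursive_bound:
  fixes a g :: "nat \<Rightarrow> real"
  assumes a0: "\<And>n. a n \<ge> 0" and rec: "\<And>n. n \<ge> 1 \<Longrightarrow> a (Suc n) \<le> C * a n + g n"
    and z: "0 < z" "C * z < 1" and C: "0 \<le> C"
    and g: "summable (\<lambda>n. g n * z ^ n)" and g0: "\<And>n. g n \<ge> 0"
  shows "summable (\<lambda>n. a n * z ^ n)"
proof -
  define G where "G = (\<Sum>n. g n * z ^ n)"
  define S where "S N = (\<Sum>n\<le>N. a n * z ^ n)" for N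
  have Gb: "(\<Sum>n\<in>{1..N}. g n * z ^ n) \<le> G" for N
    unfolding G_def using z g0 by (intro sum_le_suminf g) auto
  have S0: "S N \<ge> 0" for N unfolding S_def using a0 z by (intro sum_nonneg) auto
  have step: "S (Suc N) \<le> a 0 + a 1 * z + C * z * S N + z * G" for N
  proof -
    have "S (Suc N) = a 0 + (\<Sum>n\<le>N. a (Suc n) * z ^ Suc n)"
      unfolding S_def by (subst sum.atMost_Suc_shift) simp
    also have "(\<Sum>n\<le>N. a (Suc n) * z ^ Suc n) = a 1 * z + (\<Sum>n\<in>{1..N}. a (Suc n) * z ^ Suc n)"
      by (simp add: atMost_atLeast0 sum.atLeast_Suc_atMost)
    also have "(\<Sum>n\<in>{1..N}. a (Suc n) * z ^ Suc n)
        \<le> (\<Sum>n\<in>{1..N}. C * z * (a n * z ^ n) + z * (g n * z ^ n))"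
    proof (rule sum_mono)
      fix n assume "n \<in> {1..N}"
      then have "a (Suc n) * z ^ Suc n \<le> (C * a n + g n) * z ^ Suc n"
        using rec z by (intro mult_right_mono) auto
      then show "a (Suc n) * z ^ Suc n \<le> C * z * (a n * z ^ n) + z * (g n * z ^ n)"
        by (simp add: algebra_simps)
    qed
    also have "\<dots> = C * z * (\<Sum>n\<in>{1..N}. a n * z ^ n) + z * (\<Sum>n\<in>{1..N}. g n * z ^ n)"
      by (simp only: sum.distrib sum_distrib_left)
    also have "\<dots> \<le> C * z * S N + z * G"
    proof -
      have "(\<Sum>n\<in>{1..N}. a n * z ^ n) \<le> S N"
        unfolding S_def using a0 z by (intro sum_mono2) auto
      then show ?thesis using Gb[of N] z C by (intro add_mono mult_left_mono) auto
    qed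
    finally show ?thesis by simp
  qed
  have G0: "G \<ge> 0" using Gb[of 0] by simp
  define B where "B = (a 0 + a 1 * z + z * G) / (1 - C * z)"
  have "S N \<le> S (Suc N)" for N unfolding S_def using a0 z by simp
  then have "S N \<le> B" for N
  proof -
    have "S N \<le> a 0 + a 1 * z + C * z * S N + z * G" using step[of N] \<open>S N \<le> S (Suc N)\<close> by linarith
    then have "S N * (1 - C * z) \<le> a 0 + a 1 * z + z * G" by (simp add: algebra_simps)
    then show ?thesis unfolding B_def using z by (simp add: pos_le_divide_eq)
  qed
  then have "(\<Sum>n<N. a n * z ^ n) \<le> B" for N
  proof -
    have "(\<Sum>n<N. a n * z ^ n) \<le> S N" unfolding S_def using a0 z by (intro sum_mono2) auto
    then show ?thesis using \<open>S N \<le> B\<close> by linarith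
  qed
  then show ?thesis using a0 z by (intro summableI_nonneg_bounded[where x = B]) auto
qed

text \<open>
  The combinatorial core of Misiurewicz's construction of horseshoes. Letters are thought of as
  intervals, \<open>cov w a\<close> says that the image of the cylinder of \<open>w\<close> contains the interval \<open>a\<close>, and a legal word
  is one that some orbit follows. The image of a cylinder is an interval, so it meets only boundedly many
  letters without covering them: this is \<open>few_uncovered\<close>.
\<close>

locale covering_words =
  fixes A :: "'a set" and legal :: "'a list \<Rightarrow> bool" and cov :: "'a list \<Rightarrow> 'a \<Rightarrow> bool" and C :: nat
  assumes finite_A: "finite A"
    and legal_set: "legal w \<Longrightarrow> set w \<subseteq> A"
    and legal_prefix: "legal (u @ v) \<Longrightarrow> legal u"
    and legal_suffix: "legal (u @ v) \<Longrightarrow> legal v"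
    and few_uncovered: "legal w \<Longrightarrow> w \<noteq> [] \<Longrightarrow> card {a \<in> A. legal (w @ [a]) \<and> \<not> cov w a} \<le> C"
    and cov_append: "cov u (hd v) \<Longrightarrow> v \<noteq> [] \<Longrightarrow> cov v c \<Longrightarrow> cov (u @ v) c"
begin

definition loops :: "'a \<Rightarrow> 'a \<Rightarrow> nat \<Rightarrow> 'a list set" where
  "loops D E n = {w. length w = n \<and> w \<noteq> [] \<and> set w \<subseteq> A \<and> hd w = D \<and> cov w E}"

definition starting :: "'a set \<Rightarrow> 'a \<Rightarrow> nat \<Rightarrow> 'a list set" where
  "starting S D n = {w. legal w \<and> length w = n \<and> w \<noteq> [] \<and> set w \<subseteq> S \<and> hd w = D}"

lemma finite_words: "finite {w. set w \<subseteq> A \<and> length w = n}"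
  using finite_A by (rule finite_lists_length_eq)

lemma finite_loops [simp]: "finite (loops D E n)"
  by (rule finite_subset[OF _ finite_words[of n]]) (auto simp: loops_def)

lemma finite_starting [simp]: "finite (starting S D n)"
  by (rule finite_subset[OF _ finite_words[of n]]) (use legal_set in \<open>auto simp: starting_def\<close>)

lemma starting_recursion:
  assumes "n \<ge> 1" "S \<subseteq> A"
  shows "card (starting S D (Suc n)) \<le> C * card (starting S D n) + (\<Sum>E\<in>S. card (loops D E n))"
proof -
  have fS: "finite S" using assms finite_A finite_subset by blast
  let ?U = "\<lambda>w. {a \<in> A. legal (w @ [a]) \<and> \<not> cov w a}"
  have "starting S D (Suc n) \<subseteq>
      (\<lambda>(w, a). w @ [a]) ` (Sigma (starting S D n) ?U) \<union>
      (\<Union>E\<in>S. (\<lambda>w. w @ [E]) ` loops D E n)"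
  proof
    fix u assume u: "u \<in> starting S D (Suc n)"
    then obtain w a where wa: "u = w @ [a]" "length w = n"
      by (auto simp: starting_def length_Suc_conv_rev)
    have w: "w \<noteq> []" using wa assms by auto
    have lw: "legal w" using u wa legal_prefix by (auto simp: starting_def)
    have win: "w \<in> starting S D n" using u wa w lw by (auto simp: starting_def)
    have aS: "a \<in> S" using u wa by (auto simp: starting_def)
    show "u \<in> (\<lambda>(w, a). w @ [a]) ` (Sigma (starting S D n) ?U) \<union>
      (\<Union>E\<in>S. (\<lambda>w. w @ [E]) ` loops D E n)"
    proof (cases "cov w a")
      case True
      then have "w \<in> loops D a n" using win legal_set[OF lw] by (auto simp: starting_def loops_def)
      then show ?thesis using wa aS by auto
    next
      case False
      then have "(w, a) \<in> Sigma (starting S D n) ?U" using win u wa aS assms by (auto simp: starting_def)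
      then show ?thesis using wa by force
    qed
  qed
  then have "card (starting S D (Suc n)) \<le> card ((\<lambda>(w, a). w @ [a]) ` (Sigma (starting S D n) ?U) \<union>
      (\<Union>E\<in>S. (\<lambda>w. w @ [E]) ` loops D E n))"
    using fS finite_A by (intro card_mono) auto
  also have "\<dots> \<le> card (Sigma (starting S D n) ?U) + (\<Sum>E\<in>S. card (loops D E n))"
  proof (rule order_trans[OF card_Un_le add_mono])
    show "card ((\<lambda>(w, a). w @ [a]) ` Sigma (starting S D n) ?U) \<le> card (Sigma (starting S D n) ?U)"
      using finite_A by (intro card_image_le) auto
    show "card (\<Union>E\<in>S. (\<lambda>w. w @ [E]) ` loops D E n) \<le> (\<Sum>E\<in>S. card (loops D E n))"
      by (rule order_trans[OF card_UN_le[OF fS]]) (intro sum_mono card_image_le, simp)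
  qed
  also have "card (Sigma (starting S D n) ?U) = (\<Sum>w\<in>starting S D n. card (?U w))"
    using finite_A by (intro card_SigmaI) auto
  also have "\<dots> \<le> (\<Sum>w\<in>starting S D n. C)"
    by (intro sum_mono few_uncovered) (auto simp: starting_def)
  finally show ?thesis by (simp add: mult.commute)
qed

text \<open>
  Cutting a word where it first leaves \<open>S\<close> bounds the count by a convolution. If no letter outside
  \<open>S\<close> starts words of large growth, the growth must therefore come from words that stay in \<open>S\<close>.
\<close>

lemma starting_split:
  "card (starting A D n) \<le> (\<Sum>j\<le>n. card (starting S D j) *
      (if n - j = 0 then 1 else \<Sum>E\<in>A - S. card (starting A E (n - j))))" if "D \<in> S"
proof -
  let ?R = "\<lambda>i. if i = 0 then {[]} else (\<Union>E\<in>A - S. starting A E i)"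
  have "starting A D n \<subseteq> (\<Union>j\<in>{..n}. (\<lambda>(u, v). u @ v) ` (starting S D j \<times> ?R (n - j)))"
  proof
    fix w assume w: "w \<in> starting A D n"
    let ?u = "takeWhile (\<lambda>a. a \<in> S) w" and ?v = "dropWhile (\<lambda>a. a \<in> S) w"
    have uv: "w = ?u @ ?v" by simp
    have "w \<noteq> []" "hd w = D" using w by (auto simp: starting_def)
    then have une: "?u \<noteq> []" and hdu: "hd ?u = D" using that by (cases w; auto)+
    have lu: "legal ?u" "legal ?v" using w legal_prefix[of ?u ?v] legal_suffix[of ?u ?v] by (auto simp: starting_def)
    have u: "?u \<in> starting S D (length ?u)" using lu une hdu by (auto simp: starting_def dest: set_takeWhileD)
    have len: "length ?u \<le> n" using w by (auto simp: starting_def length_takeWhile_le)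
    have lenv: "length ?v = n - length ?u"
      using w uv by (metis (mono_tags, lifting) add_diff_cancel_left' starting_def length_append mem_Collect_eq)
    have v: "?v \<in> ?R (n - length ?u)"
    proof (cases "?v = []")
      case True
      then have "n - length ?u = 0" using lenv by (metis list.size(3))
      then show ?thesis using True by simp
    next
      case False
      then have "n - length ?u \<noteq> 0" using lenv by auto
      moreover have "hd ?v \<notin> S" using False by (rule hd_dropWhile)
      moreover have vA: "set ?v \<subseteq> A" using legal_set lu by blast
      moreover have "hd ?v \<in> A" using vA hd_in_set[OF False] by blast
      ultimately show ?thesis using False lu lenv by (auto simp: starting_def)
    qed
    show "w \<in> (\<Union>j\<in>{..n}. (\<lambda>(u, v). u @ v) ` (starting S D j \<times> ?R (n - j)))"
      by (rule UN_I[of "length ?u"], use len in simp, rule image_eqI[of _ _ "(?u, ?v)"])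
        (use u v uv in auto)
  qed
  moreover have fR: "finite (?R i)" for i using finite_A by auto
  ultimately have "card (starting A D n) \<le> card (\<Union>j\<in>{..n}. (\<lambda>(u, v). u @ v) ` (starting S D j \<times> ?R (n - j)))"
    by (intro card_mono finite_UN_I finite_imageI finite_cartesian_product fR) auto
  also have "\<dots> \<le> (\<Sum>j\<le>n. card ((\<lambda>(u, v). u @ v) ` (starting S D j \<times> ?R (n - j))))"
    by (rule card_UN_le) simp
  also have "\<dots> \<le> (\<Sum>j\<le>n. card (starting S D j) * card (?R (n - j)))"
    unfolding card_cartesian_product[symmetric]
    by (intro sum_mono card_image_le finite_cartesian_product fR) simp
  also have "\<dots> \<le> (\<Sum>j\<le>n. card (starting S D j) *
      (if n - j = 0 then 1 else \<Sum>E\<in>A - S. card (starting A E (n - j))))"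
    using card_UN_le[of "A - S"] finite_A by (intro sum_mono mult_left_mono) auto
  finally show ?thesis .
qed

lemma loops_compose:
  "card (loops D E n) * card (loops E F m) \<le> card (loops D F (n + m))"
proof -
  have "card (loops D E n) * card (loops E F m) = card (loops D E n \<times> loops E F m)"
    by (simp add: card_cartesian_product)
  also have "\<dots> = card ((\<lambda>(u, v). u @ v) ` (loops D E n \<times> loops E F m))"
    by (rule card_image[symmetric]) (auto simp: inj_on_def loops_def)
  also have "\<dots> \<le> card (loops D F (n + m))"
  proof (rule card_mono, simp, safe)
    fix u v assume "u \<in> loops D E n" "v \<in> loops E F m"
    then show "u @ v \<in> loops D F (n + m)"
      unfolding loops_def by (auto intro!: cov_append)
  qed
  finally show ?thesis .
qed

text \<open>
  Let \<open>S\<close> be the letters whose words grow at rate at least \<open>1 / z\<close>. The words that stay inside \<open>S\<close> then do so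
  too, and since uncovered continuations only contribute the rate
  \<open>C < 1 / z\<close>, each letter of \<open>S\<close> covers some letter of \<open>S\<close> at that rate. Following these choices in the
  finite set \<open>S\<close> eventually returns to a letter already met, and composing along the cycle gives loops.
\<close>

theorem exists_many_loops:
  fixes z z' :: real
  assumes z: "0 < z" "z < z'" "real C * z < 1"
    and div: "\<not> summable (\<lambda>n. real (card {w. legal w \<and> length w = n}) * z ^ n)"
  shows "\<exists>D\<in>A. \<exists>n\<ge>N. n \<ge> 1 \<and> (1 / z') ^ n \<le> real (card (loops D D n))"
proof -
  \<comment> \<open>growth at rate at least \<open>1 / z\<close>, measured by divergence of the generating series\<close>
  define big where "big a \<longleftrightarrow> \<not> summable (\<lambda>n. real (a n) * z ^ n)" for a :: "nat \<Rightarrow> nat"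
  define S where "S = {D \<in> A. big (\<lambda>n. card (starting A D n))}"
  have SA: "S \<subseteq> A" by (auto simp: S_def)
  have fS: "finite S" using SA finite_A finite_subset by blast
  have Sne: "S \<noteq> {}"
  proof
    assume "S = {}"
    then have "summable (\<lambda>n. real (card (starting A D n)) * z ^ n)" if "D \<in> A" for D
      using that by (auto simp: S_def big_def)
    then have "summable (\<lambda>n. \<Sum>D\<in>A. real (card (starting A D n)) * z ^ n)" by (intro summable_sum) auto
    moreover have "real (card {w. legal w \<and> length w = n}) * z ^ n \<le> (\<Sum>D\<in>A. real (card (starting A D n)) * z ^ n)"
      if "n \<ge> 1" for n
    proof -
      have "{w. legal w \<and> length w = n} \<subseteq> (\<Union>D\<in>A. starting A D n)"
      proof
        fix w assume "w \<in> {w. legal w \<and> length w = n}"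
        moreover then have "w \<noteq> []" using that by auto
        moreover then have "hd w \<in> A" using legal_set calculation hd_in_set by blast
        ultimately show "w \<in> (\<Union>D\<in>A. starting A D n)" using legal_set by (auto simp: starting_def)
      qed
      then have "card {w. legal w \<and> length w = n} \<le> (\<Sum>D\<in>A. card (starting A D n))"
        using finite_A by (intro order_trans[OF card_mono card_UN_le]) auto
      then have "real (card {w. legal w \<and> length w = n}) * z ^ n \<le> real (\<Sum>D\<in>A. card (starting A D n)) * z ^ n"
        using z by (intro mult_right_mono of_nat_mono) auto
      then show ?thesis by (simp add: sum_distrib_right)
    qed
    ultimately have "summable (\<lambda>n. real (card {w. legal w \<and> length w = n}) * z ^ n)"
      by (rule summable_dominated) (use z in simp_all)
    then show False using div by simp
  qed
  have restricted: "big (\<lambda>n. card (starting S D n))" if D: "D \<in> S" for D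
  proof (rule ccontr)
    assume "\<not> big (\<lambda>n. card (starting S D n))"
    then have s1: "summable (\<lambda>n. real (card (starting S D n)) * z ^ n)" by (simp add: big_def)
    define r where "r i = (if i = 0 then 1 else \<Sum>E\<in>A - S. card (starting A E i))" for i
    have "summable (\<lambda>n. real (card (starting A E n)) * z ^ n)" if "E \<in> A - S" for E
      using that by (auto simp: S_def big_def)
    then have "summable (\<lambda>n. \<Sum>E\<in>A - S. real (card (starting A E n)) * z ^ n)" by (intro summable_sum) auto
    then have s2: "summable (\<lambda>n. real (r n) * z ^ n)"
      by (rule summable_dominated) (use z in \<open>simp_all add: r_def sum_distrib_right\<close>)
    have "summable (\<lambda>n. \<Sum>j\<le>n. (real (card (starting S D j)) * z ^ j) * (real (r (n - j)) * z ^ (n - j)))"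
      using s1 s2 z by (intro summable_Cauchy_product) (auto simp: abs_mult)
    moreover have "real (card (starting A D n)) * z ^ n
      \<le> (\<Sum>j\<le>n. (real (card (starting S D j)) * z ^ j) * (real (r (n - j)) * z ^ (n - j)))" for n
    proof -
      have "card (starting A D n) \<le> (\<Sum>j\<le>n. card (starting S D j) * r (n - j))"
        using starting_split[OF D, of n] unfolding r_def .
      then have "real (card (starting A D n)) \<le> real (\<Sum>j\<le>n. card (starting S D j) * r (n - j))"
        by (rule of_nat_mono)
      then have "real (card (starting A D n)) * z ^ n \<le> (\<Sum>j\<le>n. real (card (starting S D j)) * real (r (n - j))) * z ^ n"
        using z by (intro mult_right_mono) auto
      also have "\<dots> = (\<Sum>j\<le>n. (real (card (starting S D j)) * z ^ j) * (real (r (n - j)) * z ^ (n - j)))"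
        unfolding sum_distrib_right
      proof (rule sum.cong[OF refl])
        fix j assume "j \<in> {..n}"
        then have "z ^ n = z ^ j * z ^ (n - j)" by (simp add: power_add[symmetric])
        then show "real (card (starting S D j)) * real (r (n - j)) * z ^ n =
          (real (card (starting S D j)) * z ^ j) * (real (r (n - j)) * z ^ (n - j))" by simp
      qed
      finally show ?thesis .
    qed
    ultimately have "summable (\<lambda>n. real (card (starting A D n)) * z ^ n)"
      by (rule summable_dominated) (use z in simp_all)
    then show False using D by (auto simp: S_def big_def)
  qed
  have "\<exists>E\<in>S. big (\<lambda>n. card (loops D E n))" if D: "D \<in> S" for D
  proof (rule ccontr)
    assume "\<not> (\<exists>E\<in>S. big (\<lambda>n. card (loops D E n)))"
    then have "summable (\<lambda>n. \<Sum>E\<in>S. real (card (loops D E n)) * z ^ n)"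
      by (intro summable_sum) (auto simp: big_def)
    then have g: "summable (\<lambda>n. real (\<Sum>E\<in>S. card (loops D E n)) * z ^ n)"
      by (simp add: sum_distrib_right)
    have "summable (\<lambda>n. real (card (starting S D n)) * z ^ n)"
    proof (rule summable_of_recursive_bound[OF _ _ z(1,3) _ g])
      fix n :: nat assume "n \<ge> 1"
      from of_nat_mono[OF starting_recursion[OF this SA, of D], where 'a = real]
      show "real (card (starting S D (Suc n))) \<le> real C * real (card (starting S D n)) + real (\<Sum>E\<in>S. card (loops D E n))"
        by simp
    qed (auto intro: sum_nonneg)
    then show False using restricted[OF D] by (simp add: big_def)
  qed
  then obtain \<phi> where \<phi>: "\<And>D. D \<in> S \<Longrightarrow> \<phi> D \<in> S \<and> big (\<lambda>n. card (loops D (\<phi> D) n))" by metis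
  have large: "\<exists>n\<ge>M. n \<ge> 1 \<and> (1 / z') ^ n \<le> real (card (loops D (\<phi> D) n))" if D: "D \<in> S" for D M
  proof (rule ccontr)
    assume neg: "\<not> ?thesis"
    have geo: "summable (\<lambda>n. (z / z') ^ n)" using z by (intro summable_geometric) auto
    have le: "norm (real (card (loops D (\<phi> D) n)) * z ^ n) \<le> (z / z') ^ n" if "n \<ge> max 1 M" for n
    proof -
      have "real (card (loops D (\<phi> D) n)) \<le> (1 / z') ^ n" using neg that by force
      then have "real (card (loops D (\<phi> D) n)) * z ^ n \<le> (1 / z') ^ n * z ^ n"
        using z by (intro mult_right_mono) auto
      then show ?thesis using z by (simp add: power_mult_distrib[symmetric])
    qed
    have "summable (\<lambda>n. real (card (loops D (\<phi> D) n)) * z ^ n)"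
      by (rule summable_comparison_test[OF _ geo]) (intro exI[of _ "max 1 M"] allI impI le)
    then show False using \<phi>[OF D] by (simp add: big_def)
  qed
  have inS: "(\<phi> ^^ r) D \<in> S" if "D \<in> S" for D r using that \<phi> by (induction r) auto
  have iter: "\<exists>n\<ge>M. n \<ge> 1 \<and> (1 / z') ^ n \<le> real (card (loops D ((\<phi> ^^ Suc r) D) n))" if D: "D \<in> S" for D r M
  proof (induction r)
    case 0
    then show ?case using large[OF D] by simp
  next
    case (Suc r)
    then obtain n where n: "n \<ge> M" "n \<ge> 1" "(1 / z') ^ n \<le> real (card (loops D ((\<phi> ^^ Suc r) D) n))" by blast
    obtain m where m: "m \<ge> 1" "(1 / z') ^ m \<le> real (card (loops ((\<phi> ^^ Suc r) D) (\<phi> ((\<phi> ^^ Suc r) D)) m))"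
      using large[OF inS[OF D]] by blast
    have "(1 / z') ^ (n + m) \<le> real (card (loops D ((\<phi> ^^ Suc r) D) n)) * real (card (loops ((\<phi> ^^ Suc r) D) (\<phi> ((\<phi> ^^ Suc r) D)) m))"
      unfolding power_add using n m z by (intro mult_mono) auto
    also have "\<dots> \<le> real (card (loops D (\<phi> ((\<phi> ^^ Suc r) D)) (n + m)))"
      using loops_compose by (metis of_nat_le_iff of_nat_mult)
    finally show ?case using n by (intro exI[of _ "n + m"]) simp
  qed
  obtain D0 where D0: "D0 \<in> S" using Sne by blast
  have "\<not> inj (\<lambda>r. (\<phi> ^^ r) D0)"
  proof
    assume "inj (\<lambda>r. (\<phi> ^^ r) D0)"
    then have "infinite (range (\<lambda>r. (\<phi> ^^ r) D0))" by (rule range_inj_infinite)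
    moreover have "range (\<lambda>r. (\<phi> ^^ r) D0) \<subseteq> S" using inS[OF D0] by auto
    ultimately show False using fS finite_subset by blast
  qed
  then obtain r s where "r < s" "(\<phi> ^^ r) D0 = (\<phi> ^^ s) D0"
    unfolding inj_def by (metis linorder_neqE_nat)
  then have "(\<phi> ^^ Suc (s - r - 1)) ((\<phi> ^^ r) D0) = (\<phi> ^^ r) D0"
  proof -
    have "(\<phi> ^^ Suc (s - r - 1)) ((\<phi> ^^ r) D0) = (\<phi> ^^ (Suc (s - r - 1) + r)) D0"
      by (simp only: funpow_add o_apply)
    also have "Suc (s - r - 1) + r = s" using \<open>r < s\<close> by simp
    finally show ?thesis using \<open>(\<phi> ^^ r) D0 = (\<phi> ^^ s) D0\<close> by simp
  qed
  then show ?thesis using iter[OF inS[OF D0, of r], of N "s - r - 1"] inS[OF D0, of r] SA by auto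
qed

end

section \<open>Alternating orbits and their itineraries\<close>

text \<open>
  A pair is a family indexed by \<^typ>\<open>bool\<close>: the map out of \<open>I\<^sub>1\<close> is \<open>h False\<close>, the map out of \<open>I\<^sub>2\<close> is \<open>h True\<close>,
  and \<open>b\<close> records in which copy the orbit starts. All statements are thereby symmetric in the two maps.
\<close>

fun orb :: "(bool \<Rightarrow> real \<Rightarrow> real) \<Rightarrow> bool \<Rightarrow> nat \<Rightarrow> real \<Rightarrow> real" where
  "orb h b 0 x = x"
| "orb h b (Suc i) x = orb h (\<not> b) i (h b x)"

text \<open>
  \<open>S b a\<close> is the piece of the copy \<open>b\<close> on the left (\<open>a = False\<close>) or right (\<open>a = True\<close>) of the turning point that an
  orbit may visit. Keeping \<open>S\<close> a parameter lets the same lemmas serve closed laps and strict sides.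
\<close>

fun cyl :: "(bool \<Rightarrow> real \<Rightarrow> real) \<Rightarrow> (bool \<Rightarrow> bool \<Rightarrow> real set) \<Rightarrow> bool \<Rightarrow> bool list \<Rightarrow> real set" where
  "cyl h S b [] = {0..1}"
| "cyl h S b (a # w) = {x \<in> S b a. h b x \<in> cyl h S (\<not> b) w}"

text \<open>
  The parity of the number of right laps, i.e. whether the iterate along the itinerary reverses order.
\<close>

fun reversing :: "bool list \<Rightarrow> bool" where
  "reversing [] = False"
| "reversing (a # w) = (a \<noteq> reversing w)"

text \<open>
  Laps omit the points closer than \<open>d b\<close> to the turning point. For stunted tent maps this removes the
  plateau; for quadratic maps it removes, when needed, a neighbourhood of a periodic critical point.
\<close>

definition lap :: "(bool \<Rightarrow> real) \<Rightarrow> bool \<Rightarrow> bool \<Rightarrow> real set" where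
  "lap d b a = (if a then {1/2 + d b..1} else {0..1/2 - d b})"

definition side :: "bool \<Rightarrow> bool \<Rightarrow> real set" where
  "side b a = (if a then {1/2<..1} else {0..<1/2})"

definition half_laps :: "(bool \<Rightarrow> bool \<Rightarrow> real set) \<Rightarrow> bool" where
  "half_laps S \<longleftrightarrow> (\<forall>b. S b False \<subseteq> {0..1/2} \<and> S b True \<subseteq> {1/2..1} \<and> (\<forall>a. convex (S b a)))"

lemma half_lapsD:
  assumes "half_laps S" "x \<in> S b a"
  shows "if a then 1/2 \<le> x \<and> x \<le> 1 else 0 \<le> x \<and> x \<le> 1/2"
proof (cases a)
  case True
  have "S b True \<subseteq> {1/2..1}" using assms(1) unfolding half_laps_def by blast
  then show ?thesis using True assms(2) by auto
next
  case False
  have "S b False \<subseteq> {0..1/2}" using assms(1) unfolding half_laps_def by blast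
  then show ?thesis using False assms(2) by auto
qed

lemma half_laps_unit: "half_laps S \<Longrightarrow> S b a \<subseteq> {0..1}"
  using half_lapsD[of S _ b a] by (force split: if_splits)

lemma half_laps_lap: "(\<And>b. 0 \<le> d b) \<Longrightarrow> half_laps (lap d)"
  by (auto simp: half_laps_def lap_def add_increasing2)

lemma half_laps_side: "half_laps side"
  by (auto simp: half_laps_def side_def)

lemma reversing_append: "reversing (u @ v) = (reversing u \<noteq> reversing v)"
  by (induction u) auto

lemma orb_add: "orb h b (i + j) x = orb h (b \<noteq> odd i) j (orb h b i x)"
proof (induction i arbitrary: b x)
  case (Suc i)
  have "((\<not> b) \<noteq> odd i) = (b \<noteq> odd (Suc i))" by auto
  then show ?case using Suc[of "\<not> b" "h b x"] by (simp only: add_Suc orb.simps)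
qed simp

lemma orb_even_add: "even i \<Longrightarrow> orb h b (i + j) x = orb h b j (orb h b i x)"
  by (simp add: orb_add)

lemma orb_Suc_right: "orb h b (Suc i) x = h (b \<noteq> odd i) (orb h b i x)"
  using orb_add[of h b i 1 x] by simp

lemma orb_mult: "even k \<Longrightarrow> orb h b (k * n) x = (orb h b k ^^ n) x"
proof (induction n arbitrary: x)
  case (Suc n)
  have "orb h b (k * Suc n) x = orb h b (k * n) (orb h b k x)"
    using orb_even_add[OF Suc.prems, of h b "k * n" x] by (simp add: algebra_simps)
  then show ?case using Suc by (simp add: funpow_swap1)
qed simp

lemma orb_fixed_mult:
  assumes "even k" "orb h b k x = x"
  shows "orb h b (k * n) x = x"
proof -
  have "(orb h b k ^^ n) x = x" using assms(2) by (induction n) auto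
  then show ?thesis using orb_mult[OF assms(1)] by simp
qed

lemma cyl_subset: "half_laps S \<Longrightarrow> cyl h S b w \<subseteq> {0..1}"
proof (cases w)
  case (Cons a v)
  assume "half_laps S"
  then have "S b a \<subseteq> {0..1}" by (rule half_laps_unit)
  then show ?thesis using Cons by auto
qed simp

lemma cyl_append:
  assumes "half_laps S"
  shows "x \<in> cyl h S b (u @ v) \<longleftrightarrow> x \<in> cyl h S b u \<and> orb h b (length u) x \<in> cyl h S (b \<noteq> odd (length u)) v"
proof (induction u arbitrary: b x)
  case Nil
  then show ?case using cyl_subset[OF assms, of h b v] by auto
next
  case (Cons a u)
  have "((\<not> b) \<noteq> odd (length u)) = (b \<noteq> odd (length (a # u)))" by auto
  then show ?case using Cons[of "h b x" "\<not> b"] by (simp only: append_Cons cyl.simps list.size orb.simps mem_Collect_eq add_Suc_right add_0_right) blast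
qed

lemma cyl_append_even:
  assumes "half_laps S" "even (length u)"
  shows "x \<in> cyl h S b (u @ v) \<longleftrightarrow> x \<in> cyl h S b u \<and> orb h b (length u) x \<in> cyl h S b v"
  using assms by (simp add: cyl_append)

lemma cyl_nth:
  assumes "half_laps S" "x \<in> cyl h S b w" "i < length w"
  shows "orb h b i x \<in> S (b \<noteq> odd i) (w ! i)"
proof -
  have "x \<in> cyl h S b (take i w @ (w ! i) # drop (Suc i) w)" using assms by (simp add: id_take_nth_drop[symmetric])
  then show ?thesis using assms by (subst (asm) cyl_append[OF assms(1)]) simp
qed

lemma cyl_take:
  assumes "half_laps S" "x \<in> cyl h S b w"
  shows "x \<in> cyl h S b (take i w)"
proof -
  have "x \<in> cyl h S b (take i w @ drop i w)" using assms by simp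
  then show ?thesis using assms(1) by (subst (asm) cyl_append) auto
qed

lemma cyl_iff:
  assumes "half_laps S"
  shows "x \<in> cyl h S b w \<longleftrightarrow> x \<in> {0..1} \<and> (\<forall>i<length w. orb h b i x \<in> S (b \<noteq> odd i) (w ! i)) \<and> orb h b (length w) x \<in> {0..1}"
proof (induction w arbitrary: b x)
  case (Cons a w)
  have *: "((\<not> b) \<noteq> odd i) = (b \<noteq> odd (Suc i))" for i by auto
  have S01: "S b a \<subseteq> {0..1}" by (rule half_laps_unit) (rule assms)
  have "x \<in> cyl h S b (a # w) \<longleftrightarrow> x \<in> S b a \<and> h b x \<in> {0..1} \<and>
      (\<forall>i<length w. orb h b (Suc i) x \<in> S (b \<noteq> odd (Suc i)) ((a # w) ! Suc i)) \<and> orb h b (length (a # w)) x \<in> {0..1}"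
    using Cons[of "h b x" "\<not> b"] by (simp only: cyl.simps mem_Collect_eq * orb.simps nth_Cons_Suc list.size add_Suc_right add_0_right)
  also have "\<dots> \<longleftrightarrow> x \<in> {0..1} \<and> h b x \<in> {0..1} \<and> (\<forall>i<length (a # w). orb h b i x \<in> S (b \<noteq> odd i) ((a # w) ! i)) \<and> orb h b (length (a # w)) x \<in> {0..1}"
    using S01 unfolding list.size add_Suc_right add_0_right All_less_Suc2 nth_Cons_0 orb.simps(1) by auto
  also have "\<dots> \<longleftrightarrow> x \<in> {0..1} \<and> (\<forall>i<length (a # w). orb h b i x \<in> S (b \<noteq> odd i) ((a # w) ! i)) \<and> orb h b (length (a # w)) x \<in> {0..1}"
  proof -
    have "orb h b 1 x = h b x" by simp
    moreover have "S c e \<subseteq> {0..1}" for c e by (rule half_laps_unit) (rule assms)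
    ultimately have "h b x \<in> {0..1}" if "\<forall>i<length (a # w). orb h b i x \<in> S (b \<noteq> odd i) ((a # w) ! i)" "orb h b (length (a # w)) x \<in> {0..1}"
    proof (cases w)
      case (Cons e v)
      then have "orb h b 1 x \<in> S (b \<noteq> odd 1) ((a # w) ! 1)" using that(1) by (auto simp del: orb.simps)
      then show ?thesis using \<open>\<And>c e. S c e \<subseteq> {0..1}\<close> by (simp add: subset_iff)
    qed (use that in simp)
    then show ?thesis by blast
  qed
  finally show ?case .
qed simp

locale symmetric_pair =
  fixes h :: "bool \<Rightarrow> real \<Rightarrow> real"
  assumes h_range: "x \<in> {0..1} \<Longrightarrow> h b x \<in> {0..1}"
    and h_cont: "continuous_on {0..1} (h b)"
    and h_sym: "x \<in> {0..1} \<Longrightarrow> h b (1 - x) = h b x"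
    and h_mono: "0 \<le> x \<Longrightarrow> x \<le> y \<Longrightarrow> y \<le> 1/2 \<Longrightarrow> h b x \<le> h b y"
    and h_zero: "h b 0 = 0"
begin

lemma h_one: "h b 1 = 0"
  using h_sym[of 0 b] h_zero by simp

lemma h_anti: "1/2 \<le> x \<Longrightarrow> x \<le> y \<Longrightarrow> y \<le> 1 \<Longrightarrow> h b y \<le> h b x"
  using h_mono[of "1 - y" "1 - x" b] h_sym[of x b] h_sym[of y b] by simp

lemma orb_range: "x \<in> {0..1} \<Longrightarrow> orb h b i x \<in> {0..1}"
  by (induction i arbitrary: b x) (auto simp del: atLeastAtMost_iff intro: h_range)

lemma orb_cont: "continuous_on {0..1} (orb h b i)"
proof (induction i arbitrary: b)
  case (Suc i)
  have "continuous_on {0..1} (orb h (\<not> b) i \<circ> h b)"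
    using h_range by (intro continuous_on_compose h_cont continuous_on_subset[OF Suc]) auto
  then show ?case by (simp add: o_def)
qed (simp add: continuous_on_id)

lemma h_lap_mono:
  assumes "half_laps S" "x \<in> S b a" "y \<in> S b a" "x \<le> y"
  shows "if a then h b y \<le> h b x else h b x \<le> h b y"
  using half_lapsD[OF assms(1,2)] half_lapsD[OF assms(1,3)] assms(4) h_mono[of x y b] h_anti[of x y b]
  by (cases a) auto

lemma cyl_between:
  assumes "half_laps S" "x \<in> cyl h S b w" "z \<in> cyl h S b w" "x \<le> y" "y \<le> z"
  shows "y \<in> cyl h S b w"
  using assms(2-)
proof (induction w arbitrary: b x y z)
  case (Cons a w)
  have "is_interval (S b a)" using assms(1) unfolding half_laps_def is_interval_convex_1 by blast
  then have y: "y \<in> S b a" using Cons.prems mem_is_interval_1_I[of "S b a" x z y] by auto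
  have m: "if a then h b y \<le> h b x \<and> h b z \<le> h b y else h b x \<le> h b y \<and> h b y \<le> h b z"
    using h_lap_mono[OF assms(1), of x b a y] h_lap_mono[OF assms(1), of y b a z] y Cons.prems by auto
  have "h b y \<in> cyl h S (\<not> b) w"
  proof (cases a)
    case True
    then show ?thesis using m Cons.prems Cons.IH[of "h b z" "\<not> b" "h b x" "h b y"] by simp
  next
    case False
    then show ?thesis using m Cons.prems Cons.IH[of "h b x" "\<not> b" "h b z" "h b y"] by simp
  qed
  then show ?case using y by simp
qed auto

lemma cyl_orb_mono:
  assumes "half_laps S" "x \<in> cyl h S b w" "y \<in> cyl h S b w" "x \<le> y"
  shows "if reversing w then orb h b (length w) y \<le> orb h b (length w) x
    else orb h b (length w) x \<le> orb h b (length w) y"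
  using assms(2-)
proof (induction w arbitrary: b x y)
  case (Cons a w)
  have m: "if a then h b y \<le> h b x else h b x \<le> h b y"
    using h_lap_mono[OF assms(1), of x b a y] Cons.prems by auto
  show ?case
  proof (cases a)
    case True
    then show ?thesis using m Cons.prems Cons.IH[of "h b y" "\<not> b" "h b x"] by auto
  next
    case False
    then show ?thesis using m Cons.prems Cons.IH[of "h b x" "\<not> b" "h b y"] by auto
  qed
qed auto

lemma cyl_compact:
  assumes "half_laps S" "\<And>b a. closed (S b a)"
  shows "compact (cyl h S b w)"
proof (induction w arbitrary: b)
  case (Cons a w)
  have S01: "S b a \<subseteq> {0..1}" by (rule half_laps_unit) (rule assms)
  have "compact (S b a)" using S01 assms(2)
    by (meson bounded_closed_interval bounded_subset compact_eq_bounded_closed)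
  moreover have "closed (S b a \<inter> h b -` cyl h S (\<not> b) w)"
    by (rule continuous_closed_preimage[OF continuous_on_subset[OF h_cont S01] assms(2) compact_imp_closed[OF Cons]])
  moreover have "cyl h S b (a # w) = S b a \<inter> (S b a \<inter> h b -` cyl h S (\<not> b) w)" by auto
  ultimately show ?case by (simp only: compact_Int_closed)
qed simp

lemma orb_cyl_interval:
  assumes "half_laps S" "\<And>b a. closed (S b a)" "cyl h S b w \<noteq> {}"
  obtains l r where "l \<le> r" "orb h b (length w) ` cyl h S b w = {l..r}"
proof -
  have cont: "continuous_on (cyl h S b w) (orb h b (length w))"
    by (rule continuous_on_subset[OF orb_cont cyl_subset[OF assms(1)]])
  have "is_interval (cyl h S b w)" unfolding is_interval_1 using cyl_between[OF assms(1)] by blast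
  then have "connected (orb h b (length w) ` cyl h S b w)"
    by (intro connected_continuous_image cont is_interval_connected)
  moreover have "compact (orb h b (length w) ` cyl h S b w)"
    by (intro compact_continuous_image cont cyl_compact assms)
  ultimately obtain l r where "orb h b (length w) ` cyl h S b w = {l..r}"
    using connected_compact_interval_1 by metis
  moreover have "l \<le> r" using calculation assms(3) by (metis atLeastatMost_empty_iff2 image_is_empty)
  ultimately show ?thesis using that by blast
qed

end

locale folded_pair = symmetric_pair +
  fixes d :: "bool \<Rightarrow> real"
  assumes d_nonneg: "0 \<le> d b"
    and h_strict: "0 \<le> x \<Longrightarrow> x < y \<Longrightarrow> y \<le> 1/2 - d b \<Longrightarrow> h b x < h b y"
begin

abbreviation J :: "bool \<Rightarrow> bool list \<Rightarrow> real set" where "J \<equiv> cyl h (lap d)"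

lemma half_lap: "half_laps (lap d)"
  using d_nonneg by (rule half_laps_lap)

lemma closed_lap: "closed (lap d b a)"
  by (auto simp: lap_def)

lemma h_lap_strict:
  assumes "x \<in> lap d b a" "y \<in> lap d b a" "x < y"
  shows "if a then h b y < h b x else h b x < h b y"
proof (cases a)
  case True
  then have "1 / 2 + d b \<le> x" "y \<le> 1" "1/2 \<le> x" using assms d_nonneg[of b] by (auto simp: lap_def)
  then have "h b (1 - y) < h b (1 - x)" using assms(3) by (intro h_strict) auto
  then show ?thesis using True h_sym[of x b] h_sym[of y b] \<open>1/2 \<le> x\<close> \<open>y \<le> 1\<close> assms(3) by auto
next
  case False
  then show ?thesis using assms h_strict[of x y b] by (auto simp: lap_def)
qed

lemma J_orb_strict:
  assumes "x \<in> J b w" "y \<in> J b w" "x < y"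
  shows "if reversing w then orb h b (length w) y < orb h b (length w) x
    else orb h b (length w) x < orb h b (length w) y"
  using assms
proof (induction w arbitrary: b x y)
  case (Cons a w)
  have m: "if a then h b y < h b x else h b x < h b y"
    using h_lap_strict[of x b a y] Cons.prems by auto
  show ?case
  proof (cases a)
    case True
    then show ?thesis using m Cons.prems Cons.IH[of "h b y" "\<not> b" "h b x"] by auto
  next
    case False
    then show ?thesis using m Cons.prems Cons.IH[of "h b x" "\<not> b" "h b y"] by auto
  qed
qed auto

lemma J_overlap:
  assumes "length u = length w" "u \<noteq> w" "x \<in> J b u" "y \<in> J b u" "x \<in> J b w" "y \<in> J b w"
  shows "x = y"
  using assms
proof (induction u w arbitrary: b x y rule: list_induct2)
  case (Cons a u a' w)
  show ?case
  proof (cases "a = a'")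
    case True
    then have eq: "h b x = h b y" using Cons.prems Cons.IH[of "h b x" "\<not> b" "h b y"] by auto
    have "x \<in> lap d b a" "y \<in> lap d b a" using Cons.prems by auto
    then show ?thesis using eq h_lap_strict[of x b a y] h_lap_strict[of y b a x]
      by (cases x y rule: linorder_cases) (auto split: if_splits)
  next
    case False
    have "z = 1/2" if "z \<in> lap d b a" "z \<in> lap d b a'" for z
      using that False d_nonneg[of b] by (auto simp: lap_def split: if_splits)
    then have "x = 1/2" "y = 1/2" using Cons.prems by auto
    then show ?thesis by simp
  qed
qed simp

end

section \<open>Bounds for the topological entropy\<close>

lemma orb_two: "orb h b 2 = h (\<not> b) \<circ> h b"
  by (simp add: fun_eq_iff numeral_2_eq_2)

lemma orb_funpow: "orb h b (2 * n) x = ((h (\<not> b) \<circ> h b) ^^ n) x"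
  using orb_mult[of 2 h b n x] by (simp add: orb_two)

lemma topological_entropy_nonneg:
  assumes "X \<noteq> {}"
  shows "0 \<le> topological_entropy f X"
proof -
  obtain x where x: "x \<in> X" using assms by blast
  have "0 \<le> (SUP E\<in>separated_sets f X n 1. ereal (ln (real (card E)) / real n))" for n
    by (rule SUP_upper2[of "{x}"]) (use x in \<open>auto simp: separated_sets_def\<close>)
  then have "0 \<le> limsup (\<lambda>n. SUP E\<in>separated_sets f X n 1. ereal (ln (real (card E)) / real n))"
    by (intro le_Limsup) auto
  then show ?thesis unfolding topological_entropy_def by (intro SUP_upper2[of 1]) auto
qed

text \<open>
  Points of an interval of length \<open>u - l\<close> at mutual distance at least \<open>s\<close>: rounding down to multiples of \<open>s\<close> is
  injective.
\<close>

lemma card_le_of_separated_values: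
  fixes \<Phi> :: "'a \<Rightarrow> real"
  assumes "finite X" "0 < s" "\<And>x. x \<in> X \<Longrightarrow> l \<le> \<Phi> x \<and> \<Phi> x \<le> u" "l \<le> u"
    and sep: "\<And>x y. x \<in> X \<Longrightarrow> y \<in> X \<Longrightarrow> x \<noteq> y \<Longrightarrow> s \<le> \<bar>\<Phi> x - \<Phi> y\<bar>"
  shows "real (card X) \<le> (u - l) / s + 1"
proof -
  let ?g = "\<lambda>x. nat \<lfloor>(\<Phi> x - l) / s\<rfloor>"
  have "inj_on ?g X"
  proof (rule inj_onI, rule ccontr)
    fix x y assume xy: "x \<in> X" "y \<in> X" "?g x = ?g y" "x \<noteq> y"
    have "0 \<le> (\<Phi> x - l) / s" "0 \<le> (\<Phi> y - l) / s" using assms(2,3) xy by auto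
    then have "\<lfloor>(\<Phi> x - l) / s\<rfloor> = \<lfloor>(\<Phi> y - l) / s\<rfloor>" using xy by (simp add: nat_eq_iff)
    then have "\<bar>(\<Phi> x - l) / s - (\<Phi> y - l) / s\<bar> < 1" by linarith
    then have "\<bar>(\<Phi> x - \<Phi> y) / s\<bar> < 1" by (simp add: diff_divide_distrib[symmetric])
    then show False using sep[of x y] xy assms(2) by (simp add: abs_divide)
  qed
  moreover have "?g ` X \<subseteq> {..nat \<lfloor>(u - l) / s\<rfloor>}"
    using assms(2,3) by (auto intro!: nat_mono floor_mono divide_right_mono)
  ultimately have "card X \<le> nat \<lfloor>(u - l) / s\<rfloor> + 1"
    using card_inj_on_le[of ?g X "{..nat \<lfloor>(u - l) / s\<rfloor>}"] by simp
  moreover have "0 \<le> (u - l) / s" using assms by simp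
  ultimately show ?thesis by linarith
qed

text \<open>
  The images of the intervals cross all of them, so every finite itinerary is realised; distinct
  itineraries are separated by the smallest gap between the intervals. Only crossing at the end-points
  is required, a condition that survives small perturbations.
\<close>

lemma entropy_ge_of_horseshoe:
  fixes f :: "real \<Rightarrow> real"
  assumes cont: "continuous_on {0..1} f" and range: "f ` {0..1} \<subseteq> {0..1}"
    and k: "1 \<le> k" and I: "finite I" "I \<noteq> {}" and ab: "0 \<le> a" "a \<le> b" "b \<le> 1"
    and lr: "\<And>i. i \<in> I \<Longrightarrow> a \<le> l i \<and> l i \<le> r i \<and> r i \<le> b"
    and disj: "\<And>i j. i \<in> I \<Longrightarrow> j \<in> I \<Longrightarrow> i \<noteq> j \<Longrightarrow> r i < l j \<or> r j < l i"
    and cover: "\<And>i. i \<in> I \<Longrightarrow> ((f ^^ k) (l i) \<le> a \<and> b \<le> (f ^^ k) (r i)) \<or> (b \<le> (f ^^ k) (l i) \<and> (f ^^ k) (r i) \<le> a)"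
  shows "ereal (ln (real (card I)) / real k) \<le> topological_entropy f {0..1}"
proof -
  define F where "F = f ^^ k"
  have Fr: "(f ^^ j) x \<in> {0..1}" if "x \<in> {0..1}" for j x
    using that range by (induction j) (auto simp del: atLeastAtMost_iff)
  have "continuous_on {0..1} (f ^^ j)" for j
  proof (induction j)
    case (Suc j)
    have "continuous_on {0..1} (f \<circ> (f ^^ j))"
      using Fr by (intro continuous_on_compose Suc continuous_on_subset[OF cont]) auto
    then show ?case by simp
  qed (simp add: id_def continuous_on_id)
  then have contF: "continuous_on {0..1} F" by (simp add: F_def)
  \<comment> \<open>the gaps between the intervals; the number \<open>1\<close> covers the case of a single interval\<close>
  define G where "G = insert 1 ((\<lambda>(i, j). max (l j - r i) (l i - r j)) ` {(i, j) \<in> I \<times> I. i \<noteq> j})"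
  have finG: "finite G" unfolding G_def using I by (intro finite.insertI finite_imageI finite_subset[OF _ finite_cartesian_product[of I I]]) auto
  define s where "s = Min G / 2"
  have "\<forall>g\<in>G. 0 < g" unfolding G_def using disj by (fastforce simp: less_max_iff_disj)
  then have s: "0 < s" using finG by (simp add: s_def G_def)
  have gap: "s < \<bar>x - y\<bar>" if "i \<in> I" "j \<in> I" "i \<noteq> j" "l i \<le> x" "x \<le> r i" "l j \<le> y" "y \<le> r j" for i j x y
  proof -
    have "max (l j - r i) (l i - r j) \<in> G" unfolding G_def using that by (intro insertI2 image_eqI[of _ _ "(i, j)"]) auto
    then have "Min G \<le> max (l j - r i) (l i - r j)" using finG by simp
    then show ?thesis using that s unfolding s_def by linarith
  qed
  have pts: "\<exists>x\<in>{a..b}. \<forall>m<length u. (F ^^ m) x \<in> {l (u ! m)..r (u ! m)}" if "set u \<subseteq> I" for u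
    using that
  proof (induction u)
    case (Cons i u)
    then obtain y where y: "y \<in> {a..b}" "\<forall>m<length u. (F ^^ m) y \<in> {l (u ! m)..r (u ! m)}" by auto
    have i: "i \<in> I" using Cons by simp
    have c: "continuous_on {l i..r i} F" using lr[OF i] ab by (intro continuous_on_subset[OF contF]) auto
    have "\<exists>x. l i \<le> x \<and> x \<le> r i \<and> F x = y"
      using cover[OF i] IVT'[of F "l i" y "r i", OF _ _ _ c] IVT2'[of F "r i" y "l i", OF _ _ _ c] y lr[OF i]
      by (auto simp: F_def)
    then obtain x where x: "l i \<le> x" "x \<le> r i" "F x = y" by blast
    have "(F ^^ m) x \<in> {l ((i # u) ! m)..r ((i # u) ! m)}" if "m < length (i # u)" for m
      using that x y by (cases m) (auto simp: funpow_Suc_right simp del: funpow.simps)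
    then show ?case using x lr[OF i] by (intro bexI[of _ x]) auto
  qed (use ab in auto)
  have large: "ereal (ln (real (card I)) / real k) \<le> (SUP E\<in>separated_sets f {0..1} (k * Suc M) s. ereal (ln (real (card E)) / real (k * Suc M)))" for M
  proof -
    let ?U = "{u. set u \<subseteq> I \<and> length u = Suc M}"
    have "\<forall>u\<in>?U. \<exists>x. x \<in> {a..b} \<and> (\<forall>m<Suc M. (F ^^ m) x \<in> {l (u ! m)..r (u ! m)})"
    proof
      fix u assume "u \<in> ?U"
      then show "\<exists>x. x \<in> {a..b} \<and> (\<forall>m<Suc M. (F ^^ m) x \<in> {l (u ! m)..r (u ! m)})"
        using pts[of u] by auto
    qed
    then obtain \<xi> where \<xi>: "\<And>u. u \<in> ?U \<Longrightarrow> \<xi> u \<in> {a..b} \<and> (\<forall>m<Suc M. (F ^^ m) (\<xi> u) \<in> {l (u ! m)..r (u ! m)})"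
      by (elim bchoice[THEN exE]) blast
    have sepd: "\<exists>j<k * Suc M. s < dist ((f ^^ j) (\<xi> u)) ((f ^^ j) (\<xi> v))" if uv: "u \<in> ?U" "v \<in> ?U" "u \<noteq> v" for u v
    proof -
      obtain m where m: "m < Suc M" "u ! m \<noteq> v ! m" using uv by (auto simp: list_eq_iff_nth_eq)
      have "u ! m \<in> I" "v ! m \<in> I" using uv m by (auto simp: subset_iff)
      then have "s < \<bar>(F ^^ m) (\<xi> u) - (F ^^ m) (\<xi> v)\<bar>"
        using \<xi>[OF uv(1)] \<xi>[OF uv(2)] m by (intro gap[of "u ! m" "v ! m"]) auto
      moreover have "F ^^ m = f ^^ (k * m)" by (simp add: F_def funpow_mult)
      moreover have "k * m < k * Suc M" using m k by (intro mult_strict_left_mono) auto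
      ultimately show ?thesis by (intro exI[of _ "k * m"]) (auto simp: dist_real_def)
    qed
    have inj: "inj_on \<xi> ?U"
    proof (rule inj_onI, rule ccontr)
      fix u v assume "u \<in> ?U" "v \<in> ?U" "\<xi> u = \<xi> v" "u \<noteq> v"
      then show False using sepd[of u v] s by auto
    qed
    have "\<xi> ` ?U \<in> separated_sets f {0..1} (k * Suc M) s"
      unfolding separated_sets_def mem_Collect_eq
    proof (intro conjI ballI impI)
      show "\<xi> ` ?U \<subseteq> {0..1}" using \<xi> ab by fastforce
      show "finite (\<xi> ` ?U)" using finite_lists_length_eq[OF I(1)] by simp
    next
      fix x y assume "x \<in> \<xi> ` ?U" "y \<in> \<xi> ` ?U" "x \<noteq> y"
      then show "\<exists>j<k * Suc M. s < dist ((f ^^ j) x) ((f ^^ j) y)" using sepd by blast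
    qed
    moreover have "card (\<xi> ` ?U) = card I ^ Suc M"
      using card_image[OF inj] card_lists_length_eq[OF I(1)] by simp
    moreover have "ln (real (card I ^ Suc M)) / real (k * Suc M) = ln (real (card I)) / real k"
    proof -
      have "0 < card I" using I by (simp add: card_gt_0_iff)
      then have "ln (real (card I ^ Suc M)) = real (Suc M) * ln (real (card I))" by (simp only: of_nat_power ln_realpow of_nat_0_less_iff)
      then show ?thesis by (simp only: of_nat_mult) simp
    qed
    ultimately show ?thesis by (intro SUP_upper2[of "\<xi> ` ?U"]) auto
  qed
  let ?X = "\<lambda>n. SUP E\<in>separated_sets f {0..1} n s. ereal (ln (real (card E)) / real n)"
  have "ereal (ln (real (card I)) / real k) \<le> limsup (?X \<circ> (\<lambda>M. k * Suc M))"
    using large by (intro le_Limsup) (auto simp: o_def)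
  also have "\<dots> \<le> limsup ?X"
    using k by (intro limsup_subseq_mono) (auto simp: strict_mono_def)
  also have "\<dots> \<le> topological_entropy f {0..1}"
    unfolding topological_entropy_def using s by (intro SUP_upper) auto
  finally show ?thesis .
qed

text \<open>
  Polynomial factors in \<open>n\<close> do not affect the exponential growth rate.
\<close>

lemma entropy_le_of_separated_bound:
  fixes f :: "real \<Rightarrow> real"
  assumes bound: "\<And>n e E. 1 \<le> n \<Longrightarrow> 0 < e \<Longrightarrow> E \<in> separated_sets f X n e \<Longrightarrow>
      real (card E) \<le> real (2 * n + 1) * (A * M ^ (n div k)) * (2 * real (2 * n + 1) * (C / e) + 1)"
    and A: "1 \<le> A" and M: "1 \<le> M" and k: "1 \<le> k" and C: "0 < C"
  shows "topological_entropy f X \<le> ereal (ln M / real k)"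
  unfolding topological_entropy_def
proof (rule SUP_least)
  fix e :: real assume "e \<in> {0<..}"
  then have e: "0 < e" by simp
  define D where "D = C / e"
  have D: "0 < D" using e C by (simp add: D_def)
  define B where "B n = (ln (real (2 * n + 1)) + ln A + ln (2 * real (2 * n + 1) * D + 1)) / real n + ln M / real k" for n
  have "(SUP E\<in>separated_sets f X n e. ereal (ln (real (card E)) / real n)) \<le> ereal (B n)" if n: "1 \<le> n" for n
  proof (rule SUP_least)
    fix E assume E: "E \<in> separated_sets f X n e"
    let ?R = "2 * real (2 * n + 1) * D + 1"
    have R: "1 \<le> ?R" using D by simp
    have lnR: "0 \<le> ln (real (2 * n + 1))" "0 \<le> ln ?R" "0 \<le> ln A" "0 \<le> ln M" using R A M by (simp_all add: ln_ge_zero)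
    have "real (n div k) * real k \<le> real n"
      unfolding of_nat_mult[symmetric] of_nat_le_iff by (rule div_times_less_eq_dividend)
    then have "real (n div k) \<le> real n / real k" using k by (simp add: pos_le_divide_eq)
    then have dk: "real (n div k) * ln M \<le> real n / real k * ln M"
      using lnR by (intro mult_right_mono)
    have "ln (real (card E)) \<le> ln (real (2 * n + 1)) + ln A + real n / real k * ln M + ln ?R"
    proof (cases "card E = 0")
      case True
      then show ?thesis using lnR k by simp
    next
      case False
      have pos: "0 < real (2 * n + 1)" "0 < A" "0 < M ^ (n div k)" "0 < ?R" using A M R by auto
      have "ln (real (card E)) \<le> ln (real (2 * n + 1) * (A * M ^ (n div k)) * ?R)"
        using bound[OF n e E] False unfolding D_def by (intro ln_mono) auto
      also have "\<dots> = ln (real (2 * n + 1)) + (ln A + real (n div k) * ln M) + ln ?R"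
        using pos M by (simp only: ln_mult mult_pos_pos ln_realpow mult_eq_0_iff) (simp add: ln_mult ln_realpow)
      finally show ?thesis using dk by linarith
    qed
    then have "ln (real (card E)) / real n \<le> (ln (real (2 * n + 1)) + ln A + real n / real k * ln M + ln ?R) / real n"
      by (intro divide_right_mono) auto
    also have "\<dots> = B n" using n k unfolding B_def by (simp add: field_simps)
    finally show "ereal (ln (real (card E)) / real n) \<le> ereal (B n)" by simp
  qed
  then have "limsup (\<lambda>n. SUP E\<in>separated_sets f X n e. ereal (ln (real (card E)) / real n)) \<le> limsup (\<lambda>n. ereal (B n))"
    by (intro Limsup_mono eventually_sequentiallyI[of 1]) auto
  also have "(\<lambda>n. (ln (real (2 * n + 1)) + ln A + ln (2 * real (2 * n + 1) * D + 1)) / real n + ln M / real k) \<longlonglongrightarrow> ln M / real k"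
    using D by real_asymp
  then have "limsup (\<lambda>n. ereal (B n)) = ereal (ln M / real k)"
    unfolding B_def by (intro lim_imp_Limsup) auto
  finally show "limsup (\<lambda>n. SUP E\<in>separated_sets f X n e. ereal (ln (real (card E)) / real n)) \<le> ereal (ln M / real k)" .
qed

section \<open>Counting itineraries\<close>

context folded_pair
begin

definition words :: "nat \<Rightarrow> bool list set" where
  "words n = {w. length w = n \<and> J False w \<noteq> {}}"

lemma finite_words_length: "finite {w :: bool list. length w = n}"
  using finite_lists_length_eq[of "UNIV :: bool set" n] by simp

lemma finite_words [simp]: "finite (words n)"
  by (rule finite_subset[OF _ finite_words_length[of n]]) (auto simp: words_def)

lemma card_words_le: "card (words n) \<le> 2 ^ n"
proof -
  have "card (words n) \<le> card {w :: bool list. length w = n}"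
    by (intro card_mono finite_words_length) (auto simp: words_def)
  then show ?thesis using card_lists_length_eq[of "UNIV :: bool set" n] by simp
qed

lemma words_even_append:
  assumes "u @ v \<in> words n" "even (length u)"
  shows "u \<in> words (length u)" "v \<in> words (length v)"
proof -
  obtain x where "x \<in> J False (u @ v)" using assms by (auto simp: words_def)
  then have "x \<in> J False u" "orb h False (length u) x \<in> J False v"
    using cyl_append_even[OF half_lap assms(2)] by auto
  then show "u \<in> words (length u)" "v \<in> words (length v)" by (auto simp: words_def)
qed

lemma card_words_submult: "card (words (2 * k + s)) \<le> card (words (2 * k)) * card (words s)"
proof -
  have "words (2 * k + s) \<subseteq> (\<lambda>(u, v). u @ v) ` (words (2 * k) \<times> words s)"
  proof
    fix w assume w: "w \<in> words (2 * k + s)"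
    let ?u = "take (2 * k) w" and ?v = "drop (2 * k) w"
    have len: "length ?u = 2 * k" "length ?v = s" using w by (auto simp: words_def)
    have "?u @ ?v \<in> words (2 * k + s)" using w by simp
    then have "?u \<in> words (2 * k)" "?v \<in> words s"
      using words_even_append[of ?u ?v "2 * k + s"] unfolding len by simp_all
    then show "w \<in> (\<lambda>(u, v). u @ v) ` (words (2 * k) \<times> words s)"
      by (intro image_eqI[of _ _ "(?u, ?v)"]) auto
  qed
  then have "card (words (2 * k + s)) \<le> card ((\<lambda>(u, v). u @ v) ` (words (2 * k) \<times> words s))"
    by (intro card_mono finite_imageI finite_cartesian_product finite_words)
  also have "\<dots> \<le> card (words (2 * k) \<times> words s)"
    by (intro card_image_le finite_cartesian_product finite_words)
  finally show ?thesis by (simp add: card_cartesian_product)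
qed

lemma card_words_bound:
  assumes k: "1 \<le> k" and M: "M = max 1 (card (words (2 * k)))"
  shows "card (words t) \<le> 4 ^ k * M ^ (t div (2 * k))"
proof (induction t rule: less_induct)
  case (less t)
  show ?case
  proof (cases "t < 2 * k")
    case True
    have "card (words t) \<le> 2 ^ t" by (rule card_words_le)
    also have "\<dots> \<le> 2 ^ (2 * k)" using True by (intro power_increasing) auto
    also have "\<dots> = 4 ^ k" by (simp add: power_mult)
    finally show ?thesis using True by simp
  next
    case False
    have "card (words (2 * k + (t - 2 * k))) \<le> card (words (2 * k)) * card (words (t - 2 * k))"
      by (rule card_words_submult)
    also have "\<dots> \<le> M * (4 ^ k * M ^ ((t - 2 * k) div (2 * k)))"
      using less[of "t - 2 * k"] False k M by (intro mult_le_mono) auto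
    also have "\<dots> = 4 ^ k * M ^ (t div (2 * k))"
      using False k by (subst (2) le_div_geq) (auto simp: mult_ac)
    finally show ?thesis using False by simp
  qed
qed

end

text \<open>
  Around such a turning point orbits stay together for ever, so the points that have come this close
  create neither entropy nor more than one periodic orbit.
\<close>

definition contracts :: "(bool \<Rightarrow> real \<Rightarrow> real) \<Rightarrow> bool \<Rightarrow> real \<Rightarrow> bool" where
  "contracts h b r \<longleftrightarrow> (\<exists>C. \<forall>x\<in>{0..1}. \<forall>y\<in>{0..1}. \<bar>x - 1/2\<bar> < r \<longrightarrow> \<bar>y - 1/2\<bar> < r \<longrightarrow>
     (\<forall>j. \<bar>orb h b j x - orb h b j y\<bar> \<le> C * \<bar>x - y\<bar>) \<and> (\<lambda>j. orb h b j x - orb h b j y) \<longlonglongrightarrow> 0)"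

locale trapping_pair = folded_pair +
  assumes contracting: "contracts h b (d b)"
begin

lemma trap_contracts:
  assumes "x \<in> {0..1}" "y \<in> {0..1}" "\<bar>x - 1/2\<bar> < d b" "\<bar>y - 1/2\<bar> < d b"
  shows "(\<lambda>j. orb h b j x - orb h b j y) \<longlonglongrightarrow> 0"
  using contracting[of b] assms unfolding contracts_def by blast

lemma trap_lipschitz:
  obtains C where "1 \<le> C" "\<And>b x y j. x \<in> {0..1} \<Longrightarrow> y \<in> {0..1} \<Longrightarrow> \<bar>x - 1/2\<bar> < d b \<Longrightarrow> \<bar>y - 1/2\<bar> < d b \<Longrightarrow>
      \<bar>orb h b j x - orb h b j y\<bar> \<le> C * \<bar>x - y\<bar>"
proof -
  have "\<forall>b. \<exists>C. \<forall>x\<in>{0..1}. \<forall>y\<in>{0..1}. \<bar>x - 1/2\<bar> < d b \<longrightarrow> \<bar>y - 1/2\<bar> < d b \<longrightarrow>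
      (\<forall>j. \<bar>orb h b j x - orb h b j y\<bar> \<le> C * \<bar>x - y\<bar>)"
    using contracting unfolding contracts_def by meson
  from choice[OF this] obtain C where C: "\<And>b x y j. x \<in> {0..1} \<Longrightarrow> y \<in> {0..1} \<Longrightarrow> \<bar>x - 1/2\<bar> < d b \<Longrightarrow> \<bar>y - 1/2\<bar> < d b \<Longrightarrow>
      \<bar>orb h b j x - orb h b j y\<bar> \<le> C b * \<bar>x - y\<bar>" by blast
  show thesis
  proof (rule that[of "max 1 (max (C False) (C True))"])
    fix b j and x y :: real
    assume xy: "x \<in> {0..1}" "y \<in> {0..1}" "\<bar>x - 1/2\<bar> < d b" "\<bar>y - 1/2\<bar> < d b"
    have "C b * \<bar>x - y\<bar> \<le> max 1 (max (C False) (C True)) * \<bar>x - y\<bar>" by (intro mult_right_mono) (cases b; simp)+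
    then show "\<bar>orb h b j x - orb h b j y\<bar> \<le> max 1 (max (C False) (C True)) * \<bar>x - y\<bar>" using C[OF xy, of j] by simp
  qed simp
qed

definition trapped :: "real \<Rightarrow> nat \<Rightarrow> bool" where
  "trapped x i \<longleftrightarrow> \<bar>orb h False i x - 1/2\<bar> < d (odd i)"

definition trap_time :: "nat \<Rightarrow> real \<Rightarrow> nat" where
  "trap_time N x = (if \<exists>i<N. trapped x i then LEAST i. trapped x i else N)"

text \<open>
  The itinerary up to the first visit to a contracted neighbourhood.
\<close>

definition name :: "nat \<Rightarrow> real \<Rightarrow> bool list" where
  "name N x = map (\<lambda>i. 1/2 < orb h False i x) [0..<trap_time N x]"

lemma trap_time_le: "trap_time N x \<le> N"
  unfolding trap_time_def by (auto intro: Least_le order_trans less_imp_le)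

lemma not_trapped_before: "i < trap_time N x \<Longrightarrow> \<not> trapped x i"
  unfolding trap_time_def by (auto split: if_splits dest: not_less_Least)

lemma trapped_at: "trap_time N x < N \<Longrightarrow> trapped x (trap_time N x)"
  unfolding trap_time_def by (auto split: if_splits intro: LeastI)

lemma untrapped_lap: "\<not> trapped x i \<Longrightarrow> x \<in> {0..1} \<Longrightarrow> orb h False i x \<in> lap d (odd i) (1/2 < orb h False i x)"
  using orb_range[of x False i] by (auto simp: trapped_def lap_def)

lemma in_name: "x \<in> {0..1} \<Longrightarrow> x \<in> J False (name N x)"
  using not_trapped_before[of _ N x] untrapped_lap[of x] orb_range[of x False]
  unfolding cyl_iff[OF half_lap] by (simp add: name_def)

text \<open>
  On points of equal name all iterates up to the trapping time \<open>t\<close> are monotone, and afterwards distances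
  grow at most by the factor \<open>C\<close>. Hence two separated points are already at distance \<open>e / C\<close> at a time
  \<open>i \<le> t\<close>. Adding up the iterates with the signs that make all of them increasing gives one function \<open>\<Phi>\<close> on
  which the separated points are \<open>e / C\<close> apart.
\<close>

lemma card_same_name:
  assumes E: "E \<in> separated_sets (h True \<circ> h False) {0..1} n e" and e: "0 < e"
    and C: "1 \<le> C" "\<And>b x y j. x \<in> {0..1} \<Longrightarrow> y \<in> {0..1} \<Longrightarrow> \<bar>x - 1/2\<bar> < d b \<Longrightarrow> \<bar>y - 1/2\<bar> < d b \<Longrightarrow>
      \<bar>orb h b j x - orb h b j y\<bar> \<le> C * \<bar>x - y\<bar>"
    and w: "length w = t" "t \<le> 2 * n"
  shows "real (card {x \<in> E. name (2 * n) x = w}) \<le> 2 * real (2 * n + 1) * (C / e) + 1"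
proof -
  let ?X = "{x \<in> E. name (2 * n) x = w}"
  let ?f = "h True \<circ> h False"
  define \<Phi> where "\<Phi> x = (\<Sum>i\<le>t. (if reversing (take i w) then -1 else 1) * orb h False i x)" for x
  have E01: "x \<in> {0..1}" if "x \<in> E" for x using E that by (auto simp: separated_sets_def)
  have finE: "finite E" using E by (auto simp: separated_sets_def)
  have inJ: "x \<in> J False w" if "x \<in> ?X" for x using in_name[OF E01, of x "2 * n"] that by auto
  have tt: "trap_time (2 * n) x = t" if "x \<in> ?X" for x
    using that w unfolding name_def by auto
  have bound: "- real (t + 1) \<le> \<Phi> x \<and> \<Phi> x \<le> real (t + 1)" if "x \<in> ?X" for x
  proof -
    have "\<bar>\<Phi> x\<bar> \<le> (\<Sum>i\<le>t. \<bar>(if reversing (take i w) then -1 else 1) * orb h False i x\<bar>)"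
      unfolding \<Phi>_def by (rule sum_abs)
    also have "\<dots> \<le> (\<Sum>i\<le>t. 1)"
      using orb_range[OF E01, of x] that by (intro sum_mono) (auto simp: abs_mult)
    finally show ?thesis by auto
  qed
  have sep: "e / C \<le> \<Phi> y - \<Phi> x" if xy: "x \<in> ?X" "y \<in> ?X" "x < y" for x y
  proof -
    have summand: "(if reversing (take i w) then -1 else 1) * orb h False i y - (if reversing (take i w) then -1 else 1) * orb h False i x
        = \<bar>orb h False i y - orb h False i x\<bar>" if "i \<le> t" for i
    proof -
      have "x \<in> J False (take i w)" "y \<in> J False (take i w)"
        using inJ xy cyl_take[OF half_lap] by blast+
      from cyl_orb_mono[OF half_lap this less_imp_le[OF xy(3)]] show ?thesis
        using that w by (auto simp: min_def split: if_splits)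
    qed
    have diff: "\<Phi> y - \<Phi> x = (\<Sum>i\<le>t. \<bar>orb h False i y - orb h False i x\<bar>)"
      unfolding \<Phi>_def sum_subtractf[symmetric] by (rule sum.cong) (use summand in auto)
    have single: "\<bar>orb h False i y - orb h False i x\<bar> \<le> \<Phi> y - \<Phi> x" if "i \<le> t" for i
      unfolding diff using that by (intro member_le_sum) auto
    obtain j where j: "j < n" "e < dist ((?f ^^ j) x) ((?f ^^ j) y)"
    proof -
      have "x \<in> E" "y \<in> E" "x \<noteq> y" using xy by auto
      then show thesis using E that unfolding separated_sets_def by blast
    qed
    then have je: "e < \<bar>orb h False (2 * j) y - orb h False (2 * j) x\<bar>"
      using orb_funpow[of h False j] by (simp add: dist_real_def abs_minus_commute)
    have eC: "e / C \<le> e" using e C by (simp add: divide_le_eq mult_le_cancel_left1)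
    show ?thesis
    proof (cases "2 * j \<le> t")
      case True
      then show ?thesis using single[OF True] je eC by linarith
    next
      case False
      have "trap_time (2 * n) x < 2 * n" "trap_time (2 * n) y < 2 * n" using False j tt xy by auto
      then have tr: "trapped x t" "trapped y t" using trapped_at[of "2 * n" x] trapped_at[of "2 * n" y] tt xy by auto
      have split: "orb h False (2 * j) z = orb h (odd t) (2 * j - t) (orb h False t z)" for z
        using orb_add[of h False t "2 * j - t" z] False by simp
      have "e < C * \<bar>orb h False t y - orb h False t x\<bar>"
        using C(2)[of "orb h False t y" "orb h False t x" "odd t" "2 * j - t"] je tr orb_range E01 xy
        unfolding split trapped_def by (auto simp del: atLeastAtMost_iff)
      then have "e / C \<le> \<bar>orb h False t y - orb h False t x\<bar>"
        using C by (simp add: divide_le_eq mult.commute)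
      then show ?thesis using single[of t] by simp
    qed
  qed
  have "real (card ?X) \<le> (real (t + 1) - (- real (t + 1))) / (e / C) + 1"
  proof (rule card_le_of_separated_values)
    fix x y assume "x \<in> ?X" "y \<in> ?X" "x \<noteq> y"
    then show "e / C \<le> \<bar>\<Phi> x - \<Phi> y\<bar>" using sep[of x y] sep[of y x] by (cases "x < y") auto
  qed (use finE e C bound in auto)
  also have "\<dots> = 2 * real (t + 1) * (C / e) + 1" by (simp add: field_simps)
  also have "\<dots> \<le> 2 * real (2 * n + 1) * (C / e) + 1"
    using w e C by (intro add_right_mono mult_right_mono) auto
  finally show ?thesis .
qed

text \<open>
  The upper bound of Misiurewicz and Szlenk, with itineraries followed only until they are trapped.
  Counting complete itineraries would also bound the entropy, but by a quantity that can jump up at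
  parameters with a periodic critical point; the count used here depends upper semicontinuously on
  the pair.
\<close>

theorem entropy_le_words:
  assumes k: "1 \<le> k"
  shows "topological_entropy (h True \<circ> h False) {0..1} \<le> ereal (ln (max 1 (real (card (words (2 * k))))) / real k)"
proof -
  obtain C where C: "1 \<le> C" "\<And>b x y j. x \<in> {0..1} \<Longrightarrow> y \<in> {0..1} \<Longrightarrow> \<bar>x - 1/2\<bar> < d b \<Longrightarrow> \<bar>y - 1/2\<bar> < d b \<Longrightarrow>
      \<bar>orb h b j x - orb h b j y\<bar> \<le> C * \<bar>x - y\<bar>" by (rule trap_lipschitz) (rule that, assumption, blast)
  define M where "M = max 1 (card (words (2 * k)))"
  have "topological_entropy (h True \<circ> h False) {0..1} \<le> ereal (ln (real M) / real k)"
  proof (rule entropy_le_of_separated_bound[where A = "4 ^ k" and C = C])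
    fix n E and e :: real
    assume n: "1 \<le> n" and e: "0 < e" and E: "E \<in> separated_sets (h True \<circ> h False) {0..1} n e"
    define R where "R = 2 * real (2 * n + 1) * (C / e) + 1"
    have E01: "E \<subseteq> {0..1}" "finite E" using E by (auto simp: separated_sets_def)
    have "E = (\<Union>t\<in>{..2 * n}. \<Union>w\<in>words t. {x \<in> E. name (2 * n) x = w})"
    proof (intro equalityI subsetI)
      fix x assume x: "x \<in> E"
      then have "name (2 * n) x \<in> words (trap_time (2 * n) x)"
        using in_name[of x "2 * n"] E01 by (auto simp: words_def name_def)
      then show "x \<in> (\<Union>t\<in>{..2 * n}. \<Union>w\<in>words t. {x \<in> E. name (2 * n) x = w})"
        using trap_time_le[of "2 * n" x] x by auto
    qed auto
    then have "card E \<le> (\<Sum>t\<le>2 * n. card (\<Union>w\<in>words t. {x \<in> E. name (2 * n) x = w}))"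
      using card_UN_le[of "{..2 * n}" "\<lambda>t. \<Union>w\<in>words t. {x \<in> E. name (2 * n) x = w}"] by simp
    also have "\<dots> \<le> (\<Sum>t\<le>2 * n. \<Sum>w\<in>words t. card {x \<in> E. name (2 * n) x = w})"
      by (intro sum_mono card_UN_le) simp
    finally have "real (card E) \<le> (\<Sum>t\<le>2 * n. \<Sum>w\<in>words t. real (card {x \<in> E. name (2 * n) x = w}))"
      by (simp only: of_nat_sum[symmetric] of_nat_le_iff)
    also have "\<dots> \<le> (\<Sum>t\<le>2 * n. \<Sum>w\<in>words t. R)"
      unfolding R_def using E e C by (intro sum_mono card_same_name) (auto simp: words_def)
    also have "\<dots> = (\<Sum>t\<le>2 * n. real (card (words t)) * R)" by simp
    also have "\<dots> \<le> (\<Sum>t\<le>2 * n. (4 ^ k * real M ^ (n div k)) * R)"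
    proof (intro sum_mono mult_right_mono)
      fix t assume t: "t \<in> {..2 * n}"
      have "card (words t) \<le> 4 ^ k * M ^ (t div (2 * k))" by (rule card_words_bound[OF k M_def])
      also have "\<dots> \<le> 4 ^ k * M ^ ((2 * n) div (2 * k))"
        using t by (intro mult_left_mono power_increasing div_le_mono) (auto simp: M_def)
      also have "(2 * n) div (2 * k) = n div k" by simp
      finally have "real (card (words t)) \<le> real (4 ^ k * M ^ (n div k))" by (rule of_nat_mono)
      then show "real (card (words t)) \<le> 4 ^ k * real M ^ (n div k)" by simp
    qed (use C e in \<open>simp add: R_def\<close>)
    also have "\<dots> = real (2 * n + 1) * (4 ^ k * real M ^ (n div k)) * R" by simp
    finally show "real (card E) \<le> real (2 * n + 1) * (4 ^ k * real M ^ (n div k)) * (2 * real (2 * n + 1) * (C / e) + 1)"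
      unfolding R_def .
  qed (use k C in \<open>auto simp: M_def\<close>)
  then show ?thesis unfolding M_def by (simp add: of_nat_max)
qed

end

section \<open>Full words and horseshoes\<close>

text \<open>
  Itineraries of periodic points at which the iterate reverses order. Such a periodic point is
  unique for its itinerary, and the graph of the iterate crosses the diagonal there from above to
  below; hence it persists under perturbation until its orbit meets a turning point.
\<close>

definition neg_words :: "(bool \<Rightarrow> real \<Rightarrow> real) \<Rightarrow> nat \<Rightarrow> bool list set" where
  "neg_words h k = {w. length w = 2 * k \<and> reversing w \<and> (\<exists>x\<in>cyl h side False w. orb h False (2 * k) x = x)}"

lemma neg_words_length: "w \<in> neg_words h k \<Longrightarrow> length w = 2 * k"
  by (simp add: neg_words_def)

lemma finite_neg_words [simp]: "finite (neg_words h k)"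
  using finite_lists_length_eq[of "UNIV :: bool set" "2 * k"]
  by (rule rev_finite_subset) (auto simp: neg_words_def)

context folded_pair
begin

lemma J_compact: "compact (J b w)"
  by (rule cyl_compact[OF half_lap closed_lap])

lemma J_interval:
  assumes "J b w \<noteq> {}"
  obtains l r where "l \<le> r" "J b w = {l..r}"
proof -
  have "is_interval (J b w)" unfolding is_interval_1 using cyl_between[OF half_lap] by blast
  then obtain l r where "J b w = {l..r}"
    using J_compact[of b w] is_interval_connected connected_compact_interval_1 by metis
  moreover then have "l \<le> r" using assms by (metis atLeastatMost_empty_iff2)
  ultimately show ?thesis using that by blast
qed

lemma J_unit: "J b w \<subseteq> {0..1}"
  by (rule cyl_subset[OF half_lap])

text \<open>
  The words through \<open>D\<close> whose cylinder is stretched over the whole cylinder of \<open>D\<close>.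
\<close>

definition full :: "bool list \<Rightarrow> nat \<Rightarrow> bool list set" where
  "full D k = {w. length w = 2 * k \<and> take (length D) w = D \<and> J False D \<subseteq> orb h False (2 * k) ` J False w}"

lemma finite_full [simp]: "finite (full D k)"
  by (rule finite_subset[OF _ finite_words_length[of "2 * k"]]) (auto simp: full_def)

lemma full_subset: "w \<in> full D k \<Longrightarrow> J False w \<subseteq> J False D"
  using cyl_take[OF half_lap, of _ h False w "length D"] by (auto simp: full_def)

lemma full_append:
  assumes "u \<in> full D k" "v \<in> full D m"
  shows "u @ v \<in> full D (k + m)"
proof -
  have len: "length u = 2 * k" "length v = 2 * m" using assms by (auto simp: full_def)
  have "length D \<le> length u" using assms(1) by (auto simp: full_def) (metis length_take min.cobounded1 min_def)
  then have "take (length D) (u @ v) = D" using assms(1) by (auto simp: full_def)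
  moreover have "J False D \<subseteq> orb h False (2 * (k + m)) ` J False (u @ v)"
  proof
    fix y assume "y \<in> J False D"
    then obtain x' where x': "x' \<in> J False v" "orb h False (2 * m) x' = y" using assms(2) by (auto simp: full_def)
    then have "x' \<in> J False D" using full_subset[OF assms(2)] by blast
    then obtain x where x: "x \<in> J False u" "orb h False (2 * k) x = x'" using assms(1) by (auto simp: full_def)
    have "x \<in> J False (u @ v)" using x x' len by (simp add: cyl_append_even[OF half_lap])
    moreover have "orb h False (2 * (k + m)) x = y"
      using x x' orb_even_add[of "2 * k" h False "2 * m" x] by (simp add: algebra_simps)
    ultimately show "y \<in> orb h False (2 * (k + m)) ` J False (u @ v)" by blast
  qed
  ultimately show ?thesis using len by (simp add: full_def)
qed

lemma full_concat:
  assumes "us \<noteq> []" "set us \<subseteq> full D k"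
  shows "concat us \<in> full D (k * length us)"
  using assms
proof (induction us)
  case (Cons u us)
  show ?case
  proof (cases "us = []")
    case False
    then have "u @ concat us \<in> full D (k + k * length us)" using Cons by (intro full_append) auto
    then show ?thesis by simp
  qed (use Cons in auto)
qed simp

text \<open>
  Both maps are symmetric about \<open>1/2\<close>. Replacing the point of the orbit at time \<open>length u\<close> by its mirror image
  changes one letter but nothing afterwards. The assumption makes the mirror images attained along \<open>u\<close>,
  by the intermediate value theorem.
\<close>

lemma full_flip:
  assumes w: "u @ e # v \<in> full D k" and D: "length D \<le> length u" and x1: "x1 \<in> J False u"
    and far: "\<And>y. y \<in> J False (u @ e # v) \<Longrightarrow>
      (if e then orb h False (length u) x1 \<le> 1 - orb h False (length u) y
       else 1 - orb h False (length u) y \<le> orb h False (length u) x1)"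
  shows "u @ (\<not> e) # v \<in> full D k"
proof -
  let ?o = "orb h False (length u)"
  have "J False D \<subseteq> orb h False (2 * k) ` J False (u @ (\<not> e) # v)"
  proof
    fix z assume "z \<in> J False D"
    then obtain y where y: "y \<in> J False (u @ e # v)" "orb h False (2 * k) y = z" using w by (auto simp: full_def)
    have yu: "y \<in> J False u" and yv: "?o y \<in> J (odd (length u)) (e # v)"
      using y(1) by (auto simp: cyl_append[OF half_lap])
    then have lap: "?o y \<in> lap d (odd (length u)) e" "h (odd (length u)) (?o y) \<in> J (\<not> odd (length u)) v" by auto
    have o01: "?o y \<in> {0..1}" using half_laps_unit[OF half_lap] lap by blast
    have yh: "if e then 1/2 \<le> ?o y else ?o y \<le> 1/2" using half_lapsD[OF half_lap lap(1)] by auto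
    have "x1 \<in> {0..1}" "y \<in> {0..1}" using x1 yu J_unit by blast+
    then have "{min x1 y..max x1 y} \<subseteq> {0..1}" by auto
    then have c: "continuous_on {min x1 y..max x1 y} ?o" by (rule continuous_on_subset[OF orb_cont])
    have "\<exists>x. min x1 y \<le> x \<and> x \<le> max x1 y \<and> ?o x = 1 - ?o y"
    proof (cases "(x1 \<le> y) = e")
      case True
      then show ?thesis
        using IVT'[of ?o "min x1 y" "1 - ?o y" "max x1 y"] c far[OF y(1)] yh by (cases e) (auto simp: min_def max_def)
    next
      case False
      then show ?thesis
        using IVT2'[of ?o "max x1 y" "1 - ?o y" "min x1 y"] c far[OF y(1)] yh by (cases e) (auto simp: min_def max_def)
    qed
    then obtain x where x: "min x1 y \<le> x" "x \<le> max x1 y" "?o x = 1 - ?o y" by blast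
    have "x \<in> J False u"
      using cyl_between[OF half_lap, of "min x1 y" False u "max x1 y" x] x x1 yu by (auto simp: min_def max_def split: if_splits)
    moreover have "?o x \<in> lap d (odd (length u)) (\<not> e)" using lap(1) x(3) by (auto simp: lap_def split: if_splits)
    moreover have hx: "h (odd (length u)) (?o x) = h (odd (length u)) (?o y)" using h_sym[OF o01] x(3) by simp
    ultimately have "x \<in> J False (u @ (\<not> e) # v)" using lap(2) by (simp add: cyl_append[OF half_lap])
    moreover have "orb h False (2 * k) x = z"
    proof -
      have lk: "2 * k = length u + Suc (length v)" using w by (simp add: full_def)
      have "orb h False (2 * k) t = orb h (\<not> odd (length u)) (length v) (h (odd (length u)) (?o t))" for t
        unfolding lk orb_add by simp
      then show ?thesis using hx y(2) by simp
    qed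
    ultimately show "z \<in> orb h False (2 * k) ` J False (u @ (\<not> e) # v)" by blast
  qed
  then show ?thesis using w D by (simp add: full_def)
qed

text \<open>
  Take two order-preserving full words and the first time at which they differ. There their cylinders
  lie on opposite sides of the turning point; the one that reaches less far has its mirror image inside
  the interval spanned by both, so flipping that letter yields a full word of opposite orientation.
\<close>

lemma exists_reversing_full:
  assumes "w1 \<in> full D k" "w2 \<in> full D k" "w1 \<noteq> w2" "J False D \<noteq> {}"
  shows "\<exists>w\<in>full D k. reversing w"
proof -
  have main: "\<exists>w\<in>full D k. reversing w"
    if w1: "u @ False # v1 \<in> full D k" and w2: "u @ True # v2 \<in> full D k" for u v1 v2
  proof (cases "reversing (u @ False # v1) \<or> reversing (u @ True # v2)")
    case True
    then show ?thesis using w1 w2 by blast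
  next
    case False
    let ?o = "orb h False (length u)"
    have D: "length D \<le> length u"
    proof (rule ccontr)
      assume "\<not> length D \<le> length u"
      moreover have "take (length D) (u @ False # v1) = take (length D) (u @ True # v2)" using w1 w2 by (simp add: full_def)
      ultimately show False by (auto simp: take_Cons split: nat.splits)
    qed
    have ne: "J False (u @ False # v1) \<noteq> {}" "J False (u @ True # v2) \<noteq> {}" using w1 w2 assms(4) by (auto simp: full_def)
    have c: "continuous_on (J False w) ?o" for w by (rule continuous_on_subset[OF orb_cont J_unit])
    obtain x1 where x1: "x1 \<in> J False (u @ False # v1)" "\<And>y. y \<in> J False (u @ False # v1) \<Longrightarrow> ?o x1 \<le> ?o y"
      using continuous_attains_inf[OF J_compact ne(1) c] by blast
    obtain x2 where x2: "x2 \<in> J False (u @ True # v2)" "\<And>y. y \<in> J False (u @ True # v2) \<Longrightarrow> ?o y \<le> ?o x2"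
      using continuous_attains_sup[OF J_compact ne(2) c] by blast
    have xu: "x1 \<in> J False u" "x2 \<in> J False u" using x1 x2 by (auto simp: cyl_append[OF half_lap])
    show ?thesis
    proof (cases "?o x1 \<le> 1 - ?o x2")
      case True
      have "u @ (\<not> True) # v2 \<in> full D k"
        by (rule full_flip[OF w2 D xu(1)]) (use x2(2) True in fastforce)
      moreover have "reversing (u @ (\<not> True) # v2)" using False by (auto simp: reversing_append)
      ultimately show ?thesis by blast
    next
      case F: False
      have "u @ (\<not> False) # v1 \<in> full D k"
        by (rule full_flip[OF w1 D xu(2)]) (use x1(2) F in fastforce)
      moreover have "reversing (u @ (\<not> False) # v1)" using False by (auto simp: reversing_append)
      ultimately show ?thesis by blast
    qed
  qed
  have "length w1 = length w2" using assms by (simp add: full_def)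
  then obtain u a b v1 v2 where uv: "w1 = u @ a # v1" "w2 = u @ b # v2" "a \<noteq> b"
    using same_length_different[OF assms(3)] by (metis append_Cons append_Nil)
  show ?thesis
  proof (cases a)
    case True
    then show ?thesis using main[of u v2 v1] uv assms by simp
  next
    case False
    then show ?thesis using main[of u v1 v2] uv assms by simp
  qed
qed

text \<open>
  A decreasing branch over an interval containing its own domain has a fixed point. It lies in the
  interior of the cylinder, where strict monotonicity keeps all iterates off the turning points.
\<close>

lemma full_reversing_neg:
  assumes w: "w \<in> full D k" "reversing w" and D: "J False D = {a..b}" "a < b"
  shows "w \<in> neg_words h k"
proof -
  let ?o = "orb h False (2 * k)"
  have len: "length w = 2 * k" using w by (simp add: full_def)
  have "{a..b} \<subseteq> ?o ` J False w" using w(1) D(1) by (simp add: full_def)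
  moreover have "a \<in> {a..b}" "b \<in> {a..b}" using D by auto
  ultimately have "a \<in> ?o ` J False w" "b \<in> ?o ` J False w" by blast+
  then obtain \<alpha> \<beta> where ab: "\<alpha> \<in> J False w" "?o \<alpha> = a" "\<beta> \<in> J False w" "?o \<beta> = b" by blast
  have in_D: "\<alpha> \<in> {a..b}" "\<beta> \<in> {a..b}" using ab full_subset[OF w(1)] D by auto
  have lt: "\<beta> < \<alpha>"
    using J_orb_strict[of \<alpha> False w \<beta>] ab w(2) D(2) len by (cases \<alpha> \<beta> rule: linorder_cases) auto
  have "\<alpha> \<in> {0..1}" "\<beta> \<in> {0..1}" using ab J_unit by blast+
  then have "{\<beta>..\<alpha>} \<subseteq> {0..1}" by auto
  then have "continuous_on {\<beta>..\<alpha>} (\<lambda>x. ?o x - x)"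
    by (intro continuous_intros continuous_on_subset[OF orb_cont])
  then obtain x where x: "\<beta> \<le> x" "x \<le> \<alpha>" "?o x = x"
    using IVT2'[of "\<lambda>x. ?o x - x" \<alpha> 0 \<beta>] ab in_D lt by auto
  have strict: "\<beta> < x" "x < \<alpha>"
    using x ab in_D lt by (cases "x = \<beta>"; cases "x = \<alpha>"; auto)+
  have xJ: "x \<in> J False w" using cyl_between[OF half_lap ab(3,1)] x by auto
  have "orb h False i x \<in> side (odd i) (w ! i)" if i: "i < length w" for i
  proof -
    have "orb h False i x \<noteq> 1/2"
    proof
      assume half: "orb h False i x = 1/2"
      have "y \<in> J False (take i w)" if "y \<in> J False w" for y using cyl_take[OF half_lap that] .
      note t = this[OF ab(1)] this[OF ab(3)] this[OF xJ]
      have li: "length (take i w) = i" using i by simp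
      have "\<not> (orb h False i \<alpha> \<le> 1/2 \<and> orb h False i \<beta> \<le> 1/2)" "\<not> (1/2 \<le> orb h False i \<alpha> \<and> 1/2 \<le> orb h False i \<beta>)"
        using J_orb_strict[OF t(2,3) strict(1)] J_orb_strict[OF t(3,1) strict(2)] half unfolding li
        by (auto split: if_splits)
      moreover have "orb h False i \<alpha> \<in> lap d (odd i) (w ! i)" "orb h False i \<beta> \<in> lap d (odd i) (w ! i)"
        using cyl_nth[OF half_lap ab(1) i] cyl_nth[OF half_lap ab(3) i] by auto
      ultimately show False
        using half_lapsD[OF half_lap, of "orb h False i \<alpha>" "odd i" "w ! i"] half_lapsD[OF half_lap, of "orb h False i \<beta>" "odd i" "w ! i"]
        by (cases "w ! i") auto
    qed
    moreover have "orb h False i x \<in> lap d (odd i) (w ! i)" using cyl_nth[OF half_lap xJ i] by auto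
    ultimately show ?thesis using half_lapsD[OF half_lap, of "orb h False i x" "odd i" "w ! i"]
      by (auto simp: side_def split: if_splits)
  qed
  then have "x \<in> cyl h side False w"
    unfolding cyl_iff[OF half_laps_side] using subsetD[OF J_unit xJ] orb_range[of x False "length w"] by auto
  then show ?thesis using x w(2) len by (auto simp: neg_words_def)
qed

text \<open>
  A concatenation of \<open>n\<close> full words either reverses order or does so after appending one reversing full
  word \<open>r\<close>.
\<close>

lemma many_neg_words:
  assumes D: "J False D = {a..b}" "a < b" and two: "2 \<le> card (full D k)" and n: "1 \<le> n"
  shows "card (full D k) ^ n \<le> card (neg_words h (k * n)) + card (neg_words h (k * Suc n))"
proof -
  let ?F = "full D k"
  obtain w1 w2 where "w1 \<in> ?F" "w2 \<in> ?F" "w1 \<noteq> w2"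
    using two by (metis (no_types, lifting) card_le_Suc0_iff_eq finite_full not_less_eq_eq numeral_2_eq_2)
  then obtain r where r: "r \<in> ?F" "reversing r" using exists_reversing_full D by (metis atLeastatMost_empty_iff2 less_imp_le)
  let ?U = "{us. set us \<subseteq> ?F \<and> length us = n}"
  have fin: "finite ?U" by (rule finite_lists_length_eq) simp
  have inj: "inj_on concat ?U"
  proof (rule inj_onI)
    fix us vs assume us: "us \<in> ?U" and vs: "vs \<in> ?U" and "concat us = concat vs"
    moreover have "\<forall>(x, y)\<in>set (zip us vs). length x = length y"
    proof clarify
      fix x y assume "(x, y) \<in> set (zip us vs)"
      then have "x \<in> ?F" "y \<in> ?F" using us vs by (auto dest: set_zip_leftD set_zip_rightD)
      then show "length x = length y" by (simp add: full_def)
    qed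
    ultimately show "us = vs" by (intro concat_injective) auto
  qed
  let ?P = "concat ` ?U"
  have P: "w \<in> full D (k * n)" if w: "w \<in> ?P" for w
  proof -
    obtain us where us: "us \<in> ?U" "w = concat us" using w by blast
    then have "us \<noteq> []" using n by auto
    then show ?thesis using full_concat[of us D k] us by simp
  qed
  have "card ?F ^ n = card ?P" using card_image[OF inj] card_lists_length_eq[of ?F n] by simp
  also have "\<dots> = card ({w \<in> ?P. reversing w} \<union> {w \<in> ?P. \<not> reversing w})" by (rule arg_cong[of _ _ card]) auto
  also have "\<dots> \<le> card {w \<in> ?P. reversing w} + card {w \<in> ?P. \<not> reversing w}" by (rule card_Un_le)
  also have "card {w \<in> ?P. reversing w} \<le> card (neg_words h (k * n))"
    using full_reversing_neg[OF P _ D] by (intro card_mono) auto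
  also have "card {w \<in> ?P. \<not> reversing w} = card ((\<lambda>w. w @ r) ` {w \<in> ?P. \<not> reversing w})"
    by (intro card_image[symmetric]) (auto simp: inj_on_def)
  also have "\<dots> \<le> card (neg_words h (k * Suc n))"
  proof (intro card_mono finite_neg_words subsetI)
    fix v assume "v \<in> (\<lambda>w. w @ r) ` {w \<in> ?P. \<not> reversing w}"
    then obtain w where w: "v = w @ r" "w \<in> ?P" "\<not> reversing w" by blast
    have "w @ r \<in> full D (k * n + k)" by (rule full_append[OF P[OF w(2)] r(1)])
    moreover have "reversing (w @ r)" using w r by (simp add: reversing_append)
    ultimately show "v \<in> neg_words h (k * Suc n)"
      using full_reversing_neg[OF _ _ D, of "w @ r"] w(1) by (simp add: algebra_simps)
  qed
  finally show ?thesis by simp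
qed

end

text \<open>
  A turning point may stay in its laps only if it is not periodic; then an orbit hits it at most once,
  and this is the only source of ambiguity in itineraries.
\<close>

locale aperiodic_pair = folded_pair +
  assumes aperiodic: "d b = 0 \<Longrightarrow> 0 < i \<Longrightarrow> orb h b (2 * i) (1/2) \<noteq> 1/2"
begin

text \<open>
  Two itineraries of \<open>x\<close> can differ only at the at most one time in each copy at which the orbit of \<open>x\<close> hits
  the turning point.
\<close>

lemma card_words_through: "card {w. length w = n \<and> x \<in> J b w} \<le> 4"
proof -
  let ?W = "{w. length w = n \<and> x \<in> J b w}"
  \<comment> \<open>the only time of a hit in copy \<open>c\<close>; an arbitrary index if there is none\<close>
  define hit where "hit c = (LEAST i. orb h b i x = 1/2 \<and> (b \<noteq> odd i) = c)" for c
  have uniq: "i = j" if "u \<in> ?W" "i < n" "orb h b i x = 1/2" "orb h b j x = 1/2" "odd i = odd j" "i \<le> j" for u i j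
  proof (rule ccontr)
    assume "i \<noteq> j"
    then have "i < j" using that by simp
    have "orb h b i x \<in> lap d (b \<noteq> odd i) (u ! i)" using that cyl_nth[OF half_lap, of x h b u i] by auto
    then have d0: "d (b \<noteq> odd i) = 0" using that(3) d_nonneg[of "b \<noteq> odd i"] by (auto simp: lap_def split: if_splits)
    have "even (j - i)" using that(5) \<open>i < j\<close> by auto
    obtain m where m: "j = i + 2 * m" "0 < m"
    proof -
      obtain m where "j - i = 2 * m" using \<open>even (j - i)\<close> by (elim evenE)
      then show thesis using that[of m] \<open>i < j\<close> by auto
    qed
    have "orb h (b \<noteq> odd i) (2 * m) (1/2) = 1/2" using that(3,4) orb_add[of h b i "2 * m" x] unfolding m by metis
    then show False using aperiodic[OF d0 m(2)] by simp
  qed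
  have hit: "hit (b \<noteq> odd i) = i" if "u \<in> ?W" "i < n" "orb h b i x = 1/2" for u i
  proof -
    let ?j = "hit (b \<noteq> odd i)"
    have "orb h b ?j x = 1/2 \<and> (b \<noteq> odd ?j) = (b \<noteq> odd i)" unfolding hit_def by (rule LeastI[of _ i]) (use that in simp)
    moreover have "?j \<le> i" unfolding hit_def by (rule Least_le) (use that in simp)
    ultimately show ?thesis using uniq[OF that(1), of ?j i] that by auto
  qed
  have "inj_on (\<lambda>w. (w ! hit False, w ! hit True)) ?W"
  proof (rule inj_onI)
    fix u v assume u: "u \<in> ?W" and v: "v \<in> ?W" and eq: "(u ! hit False, u ! hit True) = (v ! hit False, v ! hit True)"
    show "u = v"
    proof (rule nth_equalityI)
      show "length u = length v" using u v by simp
      fix i assume i: "i < length u"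
      show "u ! i = v ! i"
      proof (cases "orb h b i x = 1/2")
        case True
        then have "hit (b \<noteq> odd i) = i" using hit[OF u, of i] i u by simp
        then show ?thesis using eq by (cases "b \<noteq> odd i") auto
      next
        case False
        have "orb h b i x \<in> lap d (b \<noteq> odd i) (u ! i)" "orb h b i x \<in> lap d (b \<noteq> odd i) (v ! i)"
          using u v i cyl_nth[OF half_lap, of x h b u i] cyl_nth[OF half_lap, of x h b v i] by auto
        then show ?thesis
          using False half_lapsD[OF half_lap, of "orb h b i x" "b \<noteq> odd i" "u ! i"] half_lapsD[OF half_lap, of "orb h b i x" "b \<noteq> odd i" "v ! i"]
          by (cases "u ! i"; cases "v ! i") auto
      qed
    qed
  qed
  then have "card ?W \<le> card (UNIV :: (bool \<times> bool) set)" by (rule card_inj_on_le) auto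
  then show ?thesis by (simp add: card_prod flip: UNIV_Times_UNIV)
qed

lemma finite_words_through: "finite {w. length w = n \<and> x \<in> J b w}"
  by (rule finite_subset[OF _ finite_words_length[of n]]) auto

definition legal :: "nat \<Rightarrow> bool list list \<Rightarrow> bool" where
  "legal m us \<longleftrightarrow> (\<forall>u\<in>set us. length u = 2 * m) \<and> J False (concat us) \<noteq> {}"

definition cov :: "nat \<Rightarrow> bool list list \<Rightarrow> bool list \<Rightarrow> bool" where
  "cov m us a \<longleftrightarrow> (\<forall>u\<in>set us. length u = 2 * m) \<and>
     J False a \<subseteq> orb h False (2 * m * length us) ` J False (concat us)"

lemma length_concat_blocks: "\<forall>u\<in>set us. length u = L \<Longrightarrow> length (concat us) = L * length us"
  by (induction us) auto

text \<open>
  The letters are now itineraries of length \<open>2 * m\<close>. A cylinder that meets an interval without being contained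
  in it contains one of its two end-points, and at most four cylinders pass through each of these: this
  is the constant 8, which does not depend on \<open>m\<close>.
\<close>

lemma covering_words_blocks: "covering_words (words (2 * m)) (legal m) (cov m) 8"
proof
  show "finite (words (2 * m))" by simp
next
  fix us assume "legal m us"
  show "set us \<subseteq> words (2 * m)"
  proof
    fix u assume u: "u \<in> set us"
    obtain vs ws where us: "us = vs @ u # ws" using split_list[OF u] by blast
    have blocks: "\<forall>u\<in>set vs. length u = 2 * m" "length u = 2 * m" using \<open>legal m us\<close> by (auto simp: legal_def us)
    obtain x where "x \<in> J False (concat vs @ u @ concat ws)" using \<open>legal m us\<close> by (auto simp: legal_def us)
    moreover have "even (length (concat vs))" using length_concat_blocks[OF blocks(1)] by simp
    ultimately have "orb h False (length (concat vs)) x \<in> J False u"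
      using blocks(2) by (simp add: cyl_append_even[OF half_lap])
    then show "u \<in> words (2 * m)" using blocks(2) by (auto simp: words_def)
  qed
next
  fix u v assume "legal m (u @ v)"
  then show "legal m u" by (auto simp: legal_def cyl_append[OF half_lap])
next
  fix u v assume l: "legal m (u @ v)"
  then have "even (length (concat u))" using length_concat_blocks[of u "2 * m"] by (simp add: legal_def)
  then show "legal m v" using l by (auto simp: legal_def cyl_append_even[OF half_lap])
next
  fix w assume w: "legal m w" "w \<noteq> []"
  have lenw: "length (concat w) = 2 * m * length w" using w length_concat_blocks[of w "2 * m"] by (simp add: legal_def)
  have "J False (concat w) \<noteq> {}" using w by (simp add: legal_def)
  then obtain l r where lr: "l \<le> r" "orb h False (2 * m * length w) ` J False (concat w) = {l..r}"
    using orb_cyl_interval[OF half_lap closed_lap, of False "concat w"] unfolding lenw by blast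
  let ?T = "\<lambda>x. {a. length a = 2 * m \<and> x \<in> J False a}"
  have "{a \<in> words (2 * m). legal m (w @ [a]) \<and> \<not> cov m w a} \<subseteq> ?T l \<union> ?T r"
  proof
    fix a assume "a \<in> {a \<in> words (2 * m). legal m (w @ [a]) \<and> \<not> cov m w a}"
    then have a: "length a = 2 * m" "legal m (w @ [a])" "\<not> cov m w a" by (auto simp: words_def)
    then obtain x where x: "x \<in> J False (concat w @ a)" by (auto simp: legal_def)
    have "even (length (concat w))" using lenw by simp
    then have "x \<in> J False (concat w)" "orb h False (2 * m * length w) x \<in> J False a"
      using x cyl_append_even[OF half_lap, of "concat w" x h False a] unfolding lenw by auto
    then obtain y where y: "y \<in> {l..r}" "y \<in> J False a" using lr by blast
    have "\<forall>u\<in>set w. length u = 2 * m" using w by (simp add: legal_def)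
    then obtain z where z: "z \<in> J False a" "z \<notin> {l..r}" using a(3) unfolding cov_def lr(2) by blast
    show "a \<in> ?T l \<union> ?T r"
      using cyl_between[OF half_lap z(1) y(2), of l] cyl_between[OF half_lap y(2) z(1), of r] y z a(1) by auto
  qed
  then have "card {a \<in> words (2 * m). legal m (w @ [a]) \<and> \<not> cov m w a} \<le> card (?T l \<union> ?T r)"
    by (intro card_mono) (simp_all add: finite_words_through)
  also have "\<dots> \<le> card (?T l) + card (?T r)" by (rule card_Un_le)
  also have "\<dots> \<le> 8" using card_words_through[of "2 * m" l False] card_words_through[of "2 * m" r False] by linarith
  finally show "card {a \<in> words (2 * m). legal m (w @ [a]) \<and> \<not> cov m w a} \<le> 8" .
next
  fix u v c assume u: "cov m u (hd v)" and v: "v \<noteq> []" "cov m v c"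
  have len: "length (concat u) = 2 * m * length u" "even (length (concat u))"
    using u length_concat_blocks[of u "2 * m"] by (auto simp: cov_def)
  have "J False c \<subseteq> orb h False (2 * m * length (u @ v)) ` J False (concat (u @ v))"
  proof
    fix y assume "y \<in> J False c"
    then obtain x' where x': "x' \<in> J False (concat v)" "orb h False (2 * m * length v) x' = y" using v by (auto simp: cov_def)
    have "concat v = hd v @ concat (tl v)" using v(1) by (cases v) auto
    then have "x' \<in> J False (hd v)" using x'(1) cyl_append[OF half_lap] by auto
    then obtain x where x: "x \<in> J False (concat u)" "orb h False (2 * m * length u) x = x'" using u by (auto simp: cov_def)
    have "x \<in> J False (concat (u @ v))" using x x' len by (simp add: cyl_append_even[OF half_lap])
    moreover have "orb h False (2 * m * length (u @ v)) x = y"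
      using x x' orb_even_add[of "2 * m * length u" h False "2 * m * length v" x] by (simp add: algebra_simps)
    ultimately show "y \<in> orb h False (2 * m * length (u @ v)) ` J False (concat (u @ v))" by blast
  qed
  then show "cov m (u @ v) c" using u v by (auto simp: cov_def)
qed

lemma split_blocks:
  assumes "length w = L * n"
  obtains us where "concat us = w" "length us = n" "\<forall>u\<in>set us. length u = L"
  using assms
proof (induction n arbitrary: w thesis)
  case (Suc n)
  have "length (drop L w) = L * n" using Suc.prems by simp
  then obtain us where "concat us = drop L w" "length us = n" "\<forall>u\<in>set us. length u = L" using Suc.IH by blast
  then show ?case using Suc.prems by (intro Suc.prems(1)[of "take L w # us"]) auto
qed auto

text \<open>
  For blocks so long that \<open>exp (\<beta> * real m) > 8\<close>, the words not accounted for by coverings grow more slowly than all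
  words, so almost the whole growth is carried by full words.
\<close>

theorem many_full_words:
  assumes growth: "\<And>n. exp (\<beta> * real n) \<le> real (card (words (2 * n)))" and \<beta>: "0 < \<beta>" "\<beta>' < \<beta>"
  shows "\<exists>k\<ge>K. \<exists>D. J False D \<noteq> {} \<and> exp (\<beta>' * real k) \<le> real (card (full D k))"
proof -
  \<comment> \<open>block length for which the rate \<open>8\<close> of uncovered continuations is negligible\<close>
  obtain m :: nat where m: "ln 8 / \<beta> < real m" using reals_Archimedean2 by blast
  have "0 < ln 8 / \<beta>" using \<beta> by simp
  then have m0: "0 < m" using m by (cases m) auto
  have "ln 8 < \<beta> * real m" using m \<beta> by (simp add: divide_less_eq mult.commute)
  then have e8: "8 < exp (\<beta> * real m)" by (metis exp_less_mono exp_ln zero_less_numeral)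
  interpret covering_words "words (2 * m)" "legal m" "cov m" 8 by (rule covering_words_blocks)
  define z where "z = exp (- (\<beta> * real m))"
  define z' where "z' = exp (- (\<beta>' * real m))"
  have z: "0 < z" "z < z'" using \<beta> m0 by (simp_all add: z_def z'_def)
  have z8: "real 8 * z < 1" using e8 by (simp add: z_def exp_minus divide_simps)
  have "\<not> summable (\<lambda>n. real (card {us. legal m us \<and> length us = n}) * z ^ n)"
  proof
    assume "summable (\<lambda>n. real (card {us. legal m us \<and> length us = n}) * z ^ n)"
    then have "(\<lambda>n. real (card {us. legal m us \<and> length us = n}) * z ^ n) \<longlonglongrightarrow> 0" by (rule summable_LIMSEQ_zero)
    moreover have "1 \<le> real (card {us. legal m us \<and> length us = n}) * z ^ n" for n
    proof -
      have fin: "finite {us. legal m us \<and> length us = n}"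
        by (rule finite_subset[OF _ finite_words[of n]]) (use legal_set in auto)
      have "words (2 * (m * n)) \<subseteq> concat ` {us. legal m us \<and> length us = n}"
      proof
        fix w assume w: "w \<in> words (2 * (m * n))"
        then have "length w = 2 * m * n" by (simp add: words_def)
        then obtain us where "concat us = w" "length us = n" "\<forall>u\<in>set us. length u = 2 * m" by (rule split_blocks)
        then show "w \<in> concat ` {us. legal m us \<and> length us = n}"
          using w by (intro image_eqI[of _ _ us]) (auto simp: legal_def words_def)
      qed
      then have "card (words (2 * (m * n))) \<le> card {us. legal m us \<and> length us = n}"
        using fin by (meson card_image_le card_mono finite_imageI le_trans)
      then have "exp (\<beta> * real (m * n)) \<le> real (card {us. legal m us \<and> length us = n})"
        using growth[of "m * n"] by linarith
      then have "exp (\<beta> * real (m * n)) * z ^ n \<le> real (card {us. legal m us \<and> length us = n}) * z ^ n"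
        using z by (intro mult_right_mono) auto
      moreover have "exp (\<beta> * real (m * n)) * z ^ n = 1"
        by (simp add: z_def exp_of_nat_mult[symmetric] exp_add[symmetric] algebra_simps)
      ultimately show ?thesis by simp
    qed
    ultimately have "(1::real) \<le> 0" by (intro LIMSEQ_le_const) auto
    then show False by simp
  qed
  from exists_many_loops[OF z z8 this, of K]
  obtain D n where D: "D \<in> words (2 * m)" "K \<le> n" "1 \<le> n" "(1 / z') ^ n \<le> real (card (loops D D n))" by blast
  have inj: "inj_on concat (loops D D n)"
  proof (rule inj_onI)
    fix us vs assume us: "us \<in> loops D D n" and vs: "vs \<in> loops D D n" and "concat us = concat vs"
    moreover have "\<forall>(x, y)\<in>set (zip us vs). length x = length y"
    proof clarify
      fix x y assume "(x, y) \<in> set (zip us vs)"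
      then have "x \<in> words (2 * m)" "y \<in> words (2 * m)"
        using us vs by (auto simp: loops_def dest: set_zip_leftD set_zip_rightD)
      then show "length x = length y" by (simp add: words_def)
    qed
    ultimately show "us = vs" by (intro concat_injective) (auto simp: loops_def)
  qed
  have "concat ` loops D D n \<subseteq> full D (m * n)"
  proof
    fix w assume "w \<in> concat ` loops D D n"
    then obtain us where us: "us \<in> loops D D n" "w = concat us" by blast
    then have "us \<noteq> []" "hd us = D" "cov m us D" "length us = n" by (auto simp: loops_def)
    moreover then have "w = D @ concat (tl us)" using us by (cases us) auto
    moreover have "length w = 2 * m * n" using us calculation length_concat_blocks[of us "2 * m"] by (simp add: cov_def)
    ultimately show "w \<in> full D (m * n)" using us(2) by (simp add: full_def cov_def mult.assoc)
  qed
  then have "card (loops D D n) \<le> card (full D (m * n))"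
    using card_image[OF inj] card_mono[OF finite_full] by metis
  moreover have "1 / z' = exp (\<beta>' * real m)" by (simp add: z'_def exp_minus inverse_eq_divide)
  then have "(1 / z') ^ n = exp (\<beta>' * real (m * n))"
    by (simp add: exp_of_nat_mult[symmetric] algebra_simps)
  ultimately have "exp (\<beta>' * real (m * n)) \<le> real (card (full D (m * n)))" using D(4) by linarith
  moreover have "K \<le> m * n" using D m0 by (metis One_nat_def Suc_leI le_trans mult.commute mult_le_mono2 nat_mult_1_right)
  moreover have "J False D \<noteq> {}" using D by (simp add: words_def)
  ultimately show ?thesis by blast
qed

lemma full_nondegenerate:
  assumes "J False D \<noteq> {}" "5 \<le> card (full D k)"
  obtains a b where "J False D = {a..b}" "a < b"
proof -
  obtain a b where ab: "a \<le> b" "J False D = {a..b}" using J_interval[OF assms(1)] by blast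
  have "a \<noteq> b"
  proof
    assume "a = b"
    then have "full D k \<subseteq> {w. length w = 2 * k \<and> a \<in> J False w}"
      using full_subset[of _ D k] ab assms(1) by (force simp: full_def)
    then have "card (full D k) \<le> card {w. length w = 2 * k \<and> a \<in> J False w}" by (intro card_mono finite_words_through)
    then show False using card_words_through[of "2 * k" a False] assms(2) by linarith
  qed
  then show ?thesis using ab that by auto
qed

text \<open>
  Discarding the at most eight full words whose cylinder touches an end-point of the cylinder of \<open>D\<close>, and shrinking the
  remaining cylinders slightly, makes all inclusions strict.
\<close>

lemma robust_horseshoe:
  assumes D: "J False D = {A..B}" "A < B"
  obtains F l r a b where "finite F" "card (full D k) \<le> card F + 8"
    "0 \<le> a" "a \<le> b" "b \<le> 1" "\<And>w. w \<in> F \<Longrightarrow> a \<le> l w \<and> l w \<le> r w \<and> r w \<le> b"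
    "\<And>u w. u \<in> F \<Longrightarrow> w \<in> F \<Longrightarrow> u \<noteq> w \<Longrightarrow> r u < l w \<or> r w < (l u :: real)"
    "\<And>w. w \<in> (F :: bool list set) \<Longrightarrow> (orb h False (2 * k) (l w) < a \<and> b < orb h False (2 * k) (r w)) \<or>
        (b < orb h False (2 * k) (l w) \<and> orb h False (2 * k) (r w) < a)"
proof -
  let ?o = "orb h False (2 * k)"
  define F where "F = {w \<in> full D k. A \<notin> J False w \<and> B \<notin> J False w}"
  have finF: "finite F" by (simp add: F_def)
  have "full D k \<subseteq> F \<union> ({w. length w = 2 * k \<and> A \<in> J False w} \<union> {w. length w = 2 * k \<and> B \<in> J False w})"
    by (auto simp: F_def full_def)
  then have "card (full D k) \<le> card (F \<union> ({w. length w = 2 * k \<and> A \<in> J False w} \<union> {w. length w = 2 * k \<and> B \<in> J False w}))"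
    by (intro card_mono) (simp_all add: finF finite_words_through)
  also have "\<dots> \<le> card F + (card {w. length w = 2 * k \<and> A \<in> J False w} + card {w. length w = 2 * k \<and> B \<in> J False w})"
    by (intro order_trans[OF card_Un_le] add_left_mono card_Un_le)
  finally have card: "card (full D k) \<le> card F + 8"
    using card_words_through[of "2 * k" A False] card_words_through[of "2 * k" B False] by linarith
  have ne: "J False w \<noteq> {}" if "w \<in> F" for w using that D by (auto simp: F_def full_def)
  define p where "p w = Inf (J False w)" for w
  define q where "q w = Sup (J False w)" for w
  have pq: "J False w = {p w..q w}" "p w \<le> q w" if "w \<in> F" for w
    using J_interval[OF ne[OF that]] unfolding p_def q_def by (metis cInf_atLeastAtMost cSup_atLeastAtMost)+
  have inside: "A < p w" "q w < B" if "w \<in> F" for w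
  proof -
    have "{p w..q w} \<subseteq> {A..B}" "A \<notin> {p w..q w}" "B \<notin> {p w..q w}"
      using full_subset[of w D k] that D pq[OF that] by (auto simp: F_def)
    then show "A < p w" "q w < B" using pq(2)[OF that] by auto
  qed
  define G where "G = insert (B - A) ((\<lambda>w. p w - A) ` F \<union> (\<lambda>w. B - q w) ` F)"
  have finG: "finite G" using finF by (simp add: G_def)
  \<comment> \<open>one quarter of the smallest margin: one \<open>\<eta>\<close> for shrinking the cylinders, a second one as the slack of the crossing\<close>
  define \<eta> where "\<eta> = Min G / 4"
  have "\<forall>g\<in>G. 0 < g" using inside D by (auto simp: G_def)
  then have \<eta>: "0 < \<eta>" using finG by (simp add: \<eta>_def G_def)
  have "Min G \<le> g" if "g \<in> G" for g using finG that by simp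
  then have \<eta>G: "4 * \<eta> \<le> g" if "g \<in> G" for g using that by (simp add: \<eta>_def)
  have AB: "4 * \<eta> \<le> B - A" by (rule \<eta>G) (simp add: G_def)
  have pA: "4 * \<eta> \<le> p w - A" "4 * \<eta> \<le> B - q w" if "w \<in> F" for w using that by (auto intro!: \<eta>G simp: G_def)
  have "\<exists>\<alpha> \<beta> \<alpha>' \<beta>'. \<alpha> \<in> J False w \<and> \<beta> \<in> J False w \<and> \<alpha>' \<in> J False w \<and> \<beta>' \<in> J False w \<and>
      ?o \<alpha> = A \<and> ?o \<beta> = B \<and> ?o \<alpha>' = A + \<eta> \<and> ?o \<beta>' = B - \<eta>" if w: "w \<in> F" for w
  proof -
    have "{A..B} \<subseteq> ?o ` J False w" using w D by (simp add: F_def full_def)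
    moreover have "A \<in> {A..B}" "B \<in> {A..B}" "A + \<eta> \<in> {A..B}" "B - \<eta> \<in> {A..B}" using AB \<eta> D by auto
    ultimately show ?thesis by (smt (verit) imageE subsetD)
  qed
  then obtain \<alpha> \<beta> \<alpha>' \<beta>' where pts: "\<And>w. w \<in> F \<Longrightarrow> \<alpha> w \<in> J False w \<and> \<beta> w \<in> J False w \<and> \<alpha>' w \<in> J False w \<and> \<beta>' w \<in> J False w \<and>
      ?o (\<alpha> w) = A \<and> ?o (\<beta> w) = B \<and> ?o (\<alpha>' w) = A + \<eta> \<and> ?o (\<beta>' w) = B - \<eta>" by metis
  define l where "l w = min (\<alpha>' w) (\<beta>' w)" for w
  define r where "r w = max (\<alpha>' w) (\<beta>' w)" for w
  have order: "(\<alpha> w < \<alpha>' w \<and> \<alpha>' w < \<beta>' w \<and> \<beta>' w < \<beta> w) \<or> (\<beta> w < \<beta>' w \<and> \<beta>' w < \<alpha>' w \<and> \<alpha>' w < \<alpha> w)" if w: "w \<in> F" for w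
  proof -
    have len: "length w = 2 * k" using w by (simp add: F_def full_def)
    have lt: "x < y" if "x \<in> J False w" "y \<in> J False w" "if reversing w then ?o y < ?o x else ?o x < ?o y" for x y
      using J_orb_strict[of y False w x] that len by (cases x y rule: linorder_cases) (auto split: if_splits)
    show ?thesis using pts[OF w] AB \<eta> lt[of "\<alpha> w" "\<alpha>' w"] lt[of "\<alpha>' w" "\<beta>' w"] lt[of "\<beta>' w" "\<beta> w"]
        lt[of "\<alpha>' w" "\<alpha> w"] lt[of "\<beta>' w" "\<alpha>' w"] lt[of "\<beta> w" "\<beta>' w"]
      by (cases "reversing w") auto
  qed
  have lr: "min (\<alpha> w) (\<beta> w) < l w" "l w < r w" "r w < max (\<alpha> w) (\<beta> w)" if "w \<in> F" for w
    using order[OF that] by (auto simp: l_def r_def)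
  show ?thesis
  proof (rule that[of F "A + 2 * \<eta>" "B - 2 * \<eta>" l r])
    show "finite F" "card (full D k) \<le> card F + 8" by fact+
    have "{A..B} \<subseteq> {0..1}" using D J_unit by metis
    then have "0 \<le> A" "B \<le> 1" using D by auto
    then show "0 \<le> A + 2 * \<eta>" "B - 2 * \<eta> \<le> 1" using \<eta> by auto
    show "A + 2 * \<eta> \<le> B - 2 * \<eta>" using AB by simp
  next
    fix w assume w: "w \<in> F"
    have "\<alpha>' w \<in> {p w..q w}" "\<beta>' w \<in> {p w..q w}" using pts[OF w] pq[OF w] by auto
    then show "A + 2 * \<eta> \<le> l w \<and> l w \<le> r w \<and> r w \<le> B - 2 * \<eta>" using pA[OF w] \<eta> by (auto simp: l_def r_def)
    show "(?o (l w) < A + 2 * \<eta> \<and> B - 2 * \<eta> < ?o (r w)) \<or> (B - 2 * \<eta> < ?o (l w) \<and> ?o (r w) < A + 2 * \<eta>)"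
      using pts[OF w] \<eta> order[OF w] by (auto simp: l_def r_def min_def max_def)
  next
    fix u w assume u: "u \<in> F" and w: "w \<in> F" and "u \<noteq> w"
    show "r u < l w \<or> r w < l u"
    proof (rule ccontr)
      assume "\<not> ?thesis"
      then have le: "l w \<le> r u" "l u \<le> r w" by auto
      let ?x = "max (min (\<alpha> u) (\<beta> u)) (min (\<alpha> w) (\<beta> w))" and ?y = "min (max (\<alpha> u) (\<beta> u)) (max (\<alpha> w) (\<beta> w))"
      have "?x < ?y" using le lr[OF u] lr[OF w] by linarith
      have mem: "z \<in> J False v" if "min (\<alpha> v) (\<beta> v) \<le> z" "z \<le> max (\<alpha> v) (\<beta> v)" "v \<in> F" for z v
        using cyl_between[OF half_lap, of "min (\<alpha> v) (\<beta> v)" False v "max (\<alpha> v) (\<beta> v)" z] that pts[OF that(3)]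
        by (auto simp: min_def max_def split: if_splits)
      have "?x \<in> J False u" "?y \<in> J False u" "?x \<in> J False w" "?y \<in> J False w"
        using \<open>?x < ?y\<close> u w by (intro mem; linarith)+
      then have "?x = ?y" using u w \<open>u \<noteq> w\<close> by (intro J_overlap[of u w _ False]) (auto simp: F_def full_def)
      then show False using \<open>?x < ?y\<close> by simp
    qed
  qed
qed

end

section \<open>The quadratic and the stunted tent family\<close>

definition maps :: "(real \<Rightarrow> real \<Rightarrow> real) \<Rightarrow> real \<times> real \<Rightarrow> bool \<Rightarrow> real \<Rightarrow> real" where
  "maps fam p b = fam (if b then snd p else fst p)"

lemma stunted_tent_min: "v \<le> 1 \<Longrightarrow> stunted_tent v x = min v (min (2 * x) (2 - 2 * x))"
  by (auto simp: stunted_tent_def min_def)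

lemma param_coord: "p \<in> param_space \<Longrightarrow> (if b then snd p else fst p) \<in> {0..1}"
  by (auto simp: param_space_def)

lemma symmetric_pair_stunted:
  assumes "p \<in> param_space"
  shows "symmetric_pair (maps stunted_tent p)"
proof
  fix x y :: real and b
  let ?c = "if b then snd p else fst p"
  have c: "0 \<le> ?c" "?c \<le> 1" using param_coord[OF assms, of b] by auto
  have eq: "maps stunted_tent p b = (\<lambda>x. min ?c (min (2 * x) (2 - 2 * x)))"
    using stunted_tent_min[OF c(2)] by (auto simp: maps_def fun_eq_iff)
  show "x \<in> {0..1} \<Longrightarrow> maps stunted_tent p b x \<in> {0..1}" unfolding eq using c by (auto simp: min_def)
  show "continuous_on {0..1} (maps stunted_tent p b)" unfolding eq by (intro continuous_intros)
  show "maps stunted_tent p b (1 - x) = maps stunted_tent p b x" unfolding eq by (simp add: min.commute algebra_simps)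
  show "0 \<le> x \<Longrightarrow> x \<le> y \<Longrightarrow> y \<le> 1/2 \<Longrightarrow> maps stunted_tent p b x \<le> maps stunted_tent p b y" unfolding eq by (auto simp: min_def)
  show "maps stunted_tent p b 0 = 0" unfolding eq using c by (auto simp: min_def)
qed

lemma symmetric_pair_quadratic:
  assumes "p \<in> param_space"
  shows "symmetric_pair (maps quadratic p)"
proof
  fix x y :: real and b
  let ?c = "if b then snd p else fst p"
  have c: "0 \<le> ?c" "?c \<le> 1" using param_coord[OF assms, of b] by auto
  have eq: "maps quadratic p b = (\<lambda>x. ?c * (4 * (x * (1 - x))))"
    by (auto simp: maps_def quadratic_def fun_eq_iff)
  show "maps quadratic p b x \<in> {0..1}" if "x \<in> {0..1}"
  proof -
    have "1 - 4 * (x * (1 - x)) = (1 - 2 * x)\<^sup>2" by (simp add: power2_eq_square algebra_simps)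
    then have "4 * (x * (1 - x)) \<le> 1" by (metis diff_ge_0_iff_ge zero_le_power2)
    moreover have "0 \<le> 4 * (x * (1 - x))" using that by simp
    ultimately show ?thesis unfolding eq using c mult_mono[of ?c 1 "4 * (x * (1 - x))" 1] by simp
  qed
  show "continuous_on {0..1} (maps quadratic p b)" unfolding eq by (intro continuous_intros)
  show "maps quadratic p b (1 - x) = maps quadratic p b x" unfolding eq by (simp add: algebra_simps)
  show "maps quadratic p b x \<le> maps quadratic p b y" if "0 \<le> x" "x \<le> y" "y \<le> 1/2"
  proof -
    have "y * (1 - y) - x * (1 - x) = (y - x) * (1 - x - y)" by (simp add: algebra_simps)
    moreover have "0 \<le> (y - x) * (1 - x - y)" using that by (intro mult_nonneg_nonneg) auto
    ultimately show ?thesis unfolding eq using c by (intro mult_left_mono) auto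
  qed
  show "maps quadratic p b 0 = 0" unfolding eq by simp
qed

lemma quadratic_lipschitz:
  assumes p: "p \<in> param_space" and "x \<in> {0..1}" "y \<in> {0..1}"
  shows "\<bar>maps quadratic p b x - maps quadratic p b y\<bar> \<le> 4 * (if b then snd p else fst p) * \<bar>x - y\<bar>"
    and "\<bar>x - 1/2\<bar> < r \<Longrightarrow> \<bar>y - 1/2\<bar> < r \<Longrightarrow> \<bar>maps quadratic p b x - maps quadratic p b y\<bar> \<le> 8 * r * \<bar>x - y\<bar>"
proof -
  let ?c = "if b then snd p else fst p"
  have c: "0 \<le> ?c" "?c \<le> 1" using param_coord[OF p, of b] by auto
  have "maps quadratic p b x - maps quadratic p b y = 4 * ?c * ((1 - x - y) * (x - y))"
    by (simp add: maps_def quadratic_def algebra_simps)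
  then have eq: "\<bar>maps quadratic p b x - maps quadratic p b y\<bar> = 4 * ?c * (\<bar>1 - x - y\<bar> * \<bar>x - y\<bar>)"
    using c by (simp add: abs_mult)
  have "\<bar>1 - x - y\<bar> * \<bar>x - y\<bar> \<le> 1 * \<bar>x - y\<bar>" using assms by (intro mult_right_mono) auto
  then show "\<bar>maps quadratic p b x - maps quadratic p b y\<bar> \<le> 4 * ?c * \<bar>x - y\<bar>"
    unfolding eq using c by (intro mult_left_mono) auto
  assume "\<bar>x - 1/2\<bar> < r" "\<bar>y - 1/2\<bar> < r"
  then have "\<bar>1 - x - y\<bar> \<le> 2 * r" by linarith
  then have "4 * ?c * (\<bar>1 - x - y\<bar> * \<bar>x - y\<bar>) \<le> 4 * (2 * r * \<bar>x - y\<bar>)"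
    using c by (intro mult_mono mult_right_mono) auto
  then show "\<bar>maps quadratic p b x - maps quadratic p b y\<bar> \<le> 8 * r * \<bar>x - y\<bar>" unfolding eq by simp
qed

lemma quadratic_lipschitz4:
  assumes "p \<in> param_space" "x \<in> {0..1}" "y \<in> {0..1}"
  shows "\<bar>maps quadratic p b x - maps quadratic p b y\<bar> \<le> 4 * \<bar>x - y\<bar>"
proof -
  have "4 * (if b then snd p else fst p) * \<bar>x - y\<bar> \<le> 4 * \<bar>x - y\<bar>"
    using param_coord[OF assms(1), of b] by (intro mult_right_mono) auto
  then show ?thesis using quadratic_lipschitz(1)[OF assms, of b] by linarith
qed

lemma maps_jointly_continuous:
  assumes "fam = stunted_tent \<or> fam = quadratic"
  shows "continuous_on (param_space \<times> {0..1}) (\<lambda>(p, x). maps fam p b x)"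
  using assms
proof
  assume f: "fam = stunted_tent"
  have c: "continuous_on (param_space \<times> {0..1}) (\<lambda>z. min (if b then snd (fst z) else fst (fst z)) (min (2 * snd z) (2 - 2 * snd z) :: real))"
    by (cases b) (auto intro!: continuous_intros)
  show ?thesis
  proof (rule continuous_on_eq[OF c])
    fix z :: "(real \<times> real) \<times> real" assume "z \<in> param_space \<times> {0..1}"
    then have "(if b then snd (fst z) else fst (fst z)) \<le> 1" using param_coord[of "fst z" b] by auto
    from stunted_tent_min[OF this, of "snd z"]
    show "min (if b then snd (fst z) else fst (fst z)) (min (2 * snd z) (2 - 2 * snd z)) = (case z of (p, x) \<Rightarrow> maps fam p b x)"
      by (simp add: f maps_def case_prod_beta)
  qed
next
  assume "fam = quadratic"
  then show ?thesis unfolding maps_def quadratic_def case_prod_beta by (cases b) (auto intro!: continuous_intros)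
qed

locale pair_family =
  fixes P :: "(real \<times> real) set" and h :: "real \<times> real \<Rightarrow> bool \<Rightarrow> real \<Rightarrow> real"
  assumes sym: "p \<in> P \<Longrightarrow> symmetric_pair (h p)"
    and joint: "continuous_on (P \<times> {0..1}) (\<lambda>(p, x). h p b x)"
begin

lemma orb_joint: "continuous_on (P \<times> {0..1}) (\<lambda>(p, x). orb (h p) b i x)"
proof (induction i arbitrary: b)
  case 0
  then show ?case by (simp add: case_prod_beta continuous_on_snd continuous_on_id)
next
  case (Suc i)
  have c: "continuous_on (P \<times> {0..1}) (\<lambda>z. (fst z, h (fst z) b (snd z)))"
    using joint[of b] by (intro continuous_on_Pair continuous_on_fst continuous_on_id) (simp add: case_prod_beta)
  have "continuous_on (P \<times> {0..1}) (\<lambda>z. orb (h (fst z)) (\<not> b) i (h (fst z) b (snd z)))"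
  proof (rule continuous_on_compose2[OF Suc[of "\<not> b", unfolded case_prod_beta] c, simplified fst_conv snd_conv])
    show "(\<lambda>z. (fst z, h (fst z) b (snd z))) ` (P \<times> {0..1}) \<subseteq> P \<times> {0..1}"
      using symmetric_pair.h_range[OF sym] by (auto simp del: atLeastAtMost_iff)
  qed
  then show ?case by (simp add: case_prod_beta)
qed

lemma orb_tendsto:
  assumes "p \<in> P" "x \<in> {0..1}" "q \<longlonglongrightarrow> p" "\<xi> \<longlonglongrightarrow> x" "\<And>n. q n \<in> P" "\<And>n. \<xi> n \<in> {0..1}"
  shows "(\<lambda>n. orb (h (q n)) b i (\<xi> n)) \<longlonglongrightarrow> orb (h p) b i x"
  using continuous_on_tendsto_compose[OF orb_joint[of b i] tendsto_Pair[OF assms(3,4)]] assms(1,2,5,6) by simp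

lemma orb_continuous_param:
  assumes "x \<in> {0..1}"
  shows "continuous_on P (\<lambda>q. orb (h q) b i x)"
proof -
  have "continuous_on P (\<lambda>q. (q, x))" by (intro continuous_intros)
  moreover have "(\<lambda>q. (q, x)) ` P \<subseteq> P \<times> {0..1}" using assms by blast
  ultimately have "continuous_on P (\<lambda>q. case (q, x) of (q, x) \<Rightarrow> orb (h q) b i x)"
    by (rule continuous_on_compose2[OF orb_joint[of b i]])
  then show ?thesis by simp
qed

lemma eventually_orb:
  assumes "p \<in> P" "x \<in> {0..1}" "open T" "orb (h p) b i x \<in> T"
  shows "\<forall>\<^sub>F q in nhds p. q \<in> P \<longrightarrow> orb (h q) b i x \<in> T"
proof -
  obtain A where "open A" "A \<inter> P = (\<lambda>q. orb (h q) b i x) -` T \<inter> P"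
    using orb_continuous_param[OF assms(2), of b i] assms(3) unfolding continuous_on_open_invariant by blast
  then show ?thesis unfolding eventually_nhds using assms(1,4) by (intro exI[of _ A]) auto
qed

lemma eventually_orb_less:
  assumes "p \<in> P" "x \<in> {0..1}" "orb (h p) b i x < a"
  shows "\<forall>\<^sub>F q in nhds p. q \<in> P \<longrightarrow> orb (h q) b i x < a"
  using eventually_orb[OF assms(1,2), of "{..<a}" b i] assms(3) by simp

lemma eventually_orb_greater:
  assumes "p \<in> P" "x \<in> {0..1}" "a < orb (h p) b i x"
  shows "\<forall>\<^sub>F q in nhds p. q \<in> P \<longrightarrow> a < orb (h q) b i x"
  using eventually_orb[OF assms(1,2), of "{a<..}" b i] assms(3) by simp

end

lemma pair_family_maps:
  assumes "fam = stunted_tent \<or> fam = quadratic"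
  shows "pair_family param_space (maps fam)"
proof (rule pair_family.intro)
  show "symmetric_pair (maps fam p)" if "p \<in> param_space" for p
    using assms symmetric_pair_stunted[OF that] symmetric_pair_quadratic[OF that] by auto
  show "continuous_on (param_space \<times> {0..1}) (\<lambda>(p, x). maps fam p b x)" for b
    by (rule maps_jointly_continuous[OF assms])
qed

section \<open>Contracted neighbourhoods of periodic critical points\<close>

lemma (in symmetric_pair) orb_lipschitz:
  assumes lip: "\<And>b x y. x \<in> {0..1} \<Longrightarrow> y \<in> {0..1} \<Longrightarrow> \<bar>h b x - h b y\<bar> \<le> 4 * \<bar>x - y\<bar>"
    and "x \<in> {0..1}" "y \<in> {0..1}"
  shows "\<bar>orb h b i x - orb h b i y\<bar> \<le> 4 ^ i * \<bar>x - y\<bar>"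
  using assms(2,3)
proof (induction i arbitrary: b x y)
  case (Suc i)
  have "\<bar>orb h (\<not> b) i (h b x) - orb h (\<not> b) i (h b y)\<bar> \<le> 4 ^ i * \<bar>h b x - h b y\<bar>"
    using Suc by (intro Suc.IH h_range)
  also have "\<dots> \<le> 4 ^ i * (4 * \<bar>x - y\<bar>)" using lip Suc.prems by (intro mult_left_mono) auto
  finally show ?case by simp
qed simp

text \<open>
  It suffices that one iterate maps a set into itself and contracts it.
\<close>

lemma (in symmetric_pair) contracts_of_iterate:
  assumes lip: "\<And>b x y. x \<in> {0..1} \<Longrightarrow> y \<in> {0..1} \<Longrightarrow> \<bar>h b x - h b y\<bar> \<le> 4 * \<bar>x - y\<bar>"
    and S: "{x \<in> {0..1}. \<bar>x - 1/2\<bar> < r} \<subseteq> S" "S \<subseteq> {0..1}" "\<And>x. x \<in> S \<Longrightarrow> orb h b N x \<in> S"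
    and N: "0 < N" "even N"
    and contr: "\<And>x y. x \<in> S \<Longrightarrow> y \<in> S \<Longrightarrow> \<bar>orb h b N x - orb h b N y\<bar> \<le> c * \<bar>x - y\<bar>" and c: "0 \<le> c" "c < 1"
  shows "contracts h b r"
proof -
  have iter: "(orb h b N ^^ i) x \<in> S \<and> (orb h b N ^^ i) y \<in> S \<and>
      \<bar>(orb h b N ^^ i) x - (orb h b N ^^ i) y\<bar> \<le> c ^ i * \<bar>x - y\<bar>" if "x \<in> S" "y \<in> S" for i x y
  proof (induction i)
    case (Suc i)
    have "\<bar>(orb h b N ^^ Suc i) x - (orb h b N ^^ Suc i) y\<bar> \<le> c * \<bar>(orb h b N ^^ i) x - (orb h b N ^^ i) y\<bar>"
      using contr Suc by simp
    also have "\<dots> \<le> c * (c ^ i * \<bar>x - y\<bar>)" using Suc c by (intro mult_left_mono) auto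
    finally show ?case using Suc S(3) by simp
  qed (use that in simp)
  have main: "\<bar>orb h b j x - orb h b j y\<bar> \<le> 4 ^ N * c ^ (j div N) * \<bar>x - y\<bar>" if "x \<in> S" "y \<in> S" for j x y
  proof -
    have j: "orb h b j z = orb h b (j mod N) ((orb h b N ^^ (j div N)) z)" for z
    proof -
      have "orb h b (N * (j div N) + j mod N) z = orb h b (j mod N) (orb h b (N * (j div N)) z)"
        using N by (intro orb_even_add) simp
      then show ?thesis using orb_mult[OF N(2)] by simp
    qed
    have "\<bar>orb h b j x - orb h b j y\<bar> \<le> 4 ^ (j mod N) * \<bar>(orb h b N ^^ (j div N)) x - (orb h b N ^^ (j div N)) y\<bar>"
      unfolding j using iter[OF that, of "j div N"] S(2) by (intro orb_lipschitz[OF lip]) blast+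
    also have "\<dots> \<le> 4 ^ N * (c ^ (j div N) * \<bar>x - y\<bar>)"
      using iter[OF that, of "j div N"] N by (intro mult_mono power_increasing) (auto intro: less_imp_le)
    finally show ?thesis by simp
  qed
  have le: "\<bar>orb h b j x - orb h b j y\<bar> \<le> 4 ^ N * \<bar>x - y\<bar>" if "x \<in> S" "y \<in> S" for j x y
  proof -
    have "4 ^ N * c ^ (j div N) * \<bar>x - y\<bar> \<le> 4 ^ N * 1 * \<bar>x - y\<bar>"
      using c by (intro mult_right_mono mult_left_mono power_le_one) auto
    then show ?thesis using main[OF that, of j] unfolding mult_1_right by (rule order_trans[rotated])
  qed
  have lim: "(\<lambda>j. orb h b j x - orb h b j y) \<longlonglongrightarrow> 0" if "x \<in> S" "y \<in> S" for x y
  proof -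
    have "filterlim (\<lambda>j. j div N) sequentially sequentially"
      using N by (intro filterlim_at_top_div_const_nat)
    then have "(\<lambda>j. c ^ (j div N)) \<longlonglongrightarrow> 0"
      using c by (intro filterlim_compose[OF LIMSEQ_power_zero]) auto
    then have "(\<lambda>j. 4 ^ N * c ^ (j div N) * \<bar>x - y\<bar>) \<longlonglongrightarrow> 4 ^ N * 0 * \<bar>x - y\<bar>" by (intro tendsto_intros)
    then have "(\<lambda>j. 4 ^ N * c ^ (j div N) * \<bar>x - y\<bar>) \<longlonglongrightarrow> 0" by simp
    then show ?thesis by (rule Lim_null_comparison[rotated]) (use main that in auto)
  qed
  have "x \<in> S" if "x \<in> {0..1}" "\<bar>x - 1/2\<bar> < r" for x using S(1) that by blast
  then show ?thesis unfolding contracts_def using le lim by (intro exI[of _ "4 ^ N"]) simp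
qed

text \<open>
  What the two families must provide at \<open>p\<close>: removed neighbourhoods, of continuously varying size, that are
  contracted for all nearby pairs and contain every turning point that is periodic at \<open>p\<close>.
\<close>

definition local_traps :: "(real \<times> real) set \<Rightarrow> (real \<times> real \<Rightarrow> bool \<Rightarrow> real \<Rightarrow> real) \<Rightarrow> real \<times> real \<Rightarrow>
    (real \<times> real \<Rightarrow> bool \<Rightarrow> real) \<Rightarrow> bool" where
  "local_traps P h p d \<longleftrightarrow> (\<forall>b. continuous_on P (\<lambda>q. d q b)) \<and> aperiodic_pair (h p) (d p) \<and>
     (\<forall>\<^sub>F q in nhds p. q \<in> P \<longrightarrow> trapping_pair (h q) (d q))"

text \<open>
  The plateau is collapsed to a point in one step. It degenerates only for the full tent map, whose
  turning point is sent to the fixed point \<open>0\<close>.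
\<close>

lemma stunted_local_traps:
  assumes p: "p \<in> param_space"
  shows "local_traps param_space (maps stunted_tent) p (\<lambda>q b. (1 - (if b then snd q else fst q)) / 2)"
proof -
  let ?d = "\<lambda>q b. (1 - (if b then snd q else fst q)) / (2::real)"
  have folded: "folded_pair (maps stunted_tent q) (?d q)" if q: "q \<in> param_space" for q
  proof -
    interpret symmetric_pair "maps stunted_tent q" by (rule symmetric_pair_stunted[OF q])
    show ?thesis
    proof
      fix b and x y :: real
      have c: "0 \<le> (if b then snd q else fst q)" "(if b then snd q else fst q) \<le> 1" using param_coord[OF q, of b] by auto
      show "0 \<le> ?d q b" using c by simp
      assume "0 \<le> x" "x < y" "y \<le> 1/2 - ?d q b"
      then have "x \<le> (if b then snd q else fst q) / 2" "y \<le> (if b then snd q else fst q) / 2" by (auto simp: field_simps)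
      then show "maps stunted_tent q b x < maps stunted_tent q b y"
        unfolding maps_def stunted_tent_def using \<open>x < y\<close> by simp
    qed
  qed
  have "trapping_pair (maps stunted_tent q) (?d q)" if q: "q \<in> param_space" for q
  proof -
    interpret folded_pair "maps stunted_tent q" "?d q" by (rule folded[OF q])
    have const: "orb (maps stunted_tent q) b (Suc j) x = orb (maps stunted_tent q) b (Suc j) y"
      if "\<bar>x - 1/2\<bar> < ?d q b" "\<bar>y - 1/2\<bar> < ?d q b" for b j x y
    proof -
      have "maps stunted_tent q b z = (if b then snd q else fst q)" if "\<bar>z - 1/2\<bar> < ?d q b" for z
      proof -
        let ?c = "if b then snd q else fst q"
        have "\<bar>z - 1/2\<bar> < (1 - ?c) / 2" using that .
        moreover have "\<bar>z - 1/2\<bar> < (1 - c) / 2 \<Longrightarrow> \<not> z \<le> c / 2 \<and> z \<le> 1 - c / 2" for c :: real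
          by (auto simp: abs_if field_simps split: if_splits)
        ultimately have "\<not> z \<le> ?c / 2" "z \<le> 1 - ?c / 2" by blast+
        then show ?thesis unfolding maps_def stunted_tent_def by (simp only: if_False if_True)
      qed
      then show ?thesis using that by simp
    qed
    show ?thesis
    proof
      fix b
      show "contracts (maps stunted_tent q) b (?d q b)" unfolding contracts_def
      proof (intro exI[of _ 1] conjI allI ballI impI)
        fix j and x y :: real
        assume xy: "\<bar>x - 1/2\<bar> < ?d q b" "\<bar>y - 1/2\<bar> < ?d q b"
        show "\<bar>orb (maps stunted_tent q) b j x - orb (maps stunted_tent q) b j y\<bar> \<le> 1 * \<bar>x - y\<bar>"
          using const[OF xy] by (cases j) (simp_all del: orb.simps(2))
        have "(\<lambda>j. orb (maps stunted_tent q) b (Suc j) x - orb (maps stunted_tent q) b (Suc j) y) \<longlonglongrightarrow> 0"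
          using const[OF xy] by (simp del: orb.simps)
        then show "(\<lambda>j. orb (maps stunted_tent q) b j x - orb (maps stunted_tent q) b j y) \<longlonglongrightarrow> 0"
          by (rule LIMSEQ_imp_Suc)
      qed
    qed
  qed
  moreover have "aperiodic_pair (maps stunted_tent p) (?d p)"
  proof -
    interpret folded_pair "maps stunted_tent p" "?d p" by (rule folded[OF p])
    have orb0: "orb (maps stunted_tent p) b j 0 = 0" for b j by (induction j arbitrary: b) (auto simp: h_zero)
    show ?thesis
    proof
      fix b i assume "?d p b = 0" "0 < (i::nat)"
      then have "(if b then snd p else fst p) = 1" by simp
      then have "maps stunted_tent p b (1/2) = 1" by (simp add: maps_def stunted_tent_def)
      moreover obtain j where "2 * i = Suc (Suc j)" using \<open>0 < i\<close> by (cases i) auto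
      ultimately have "orb (maps stunted_tent p) b (2 * i) (1/2) = 0" using h_one orb0 by simp
      then show "orb (maps stunted_tent p) b (2 * i) (1/2) \<noteq> 1/2" by simp
    qed
  qed
  moreover have "continuous_on param_space (\<lambda>q. ?d q b)" for b by (cases b) (auto intro!: continuous_intros)
  ultimately show ?thesis unfolding local_traps_def by (auto intro!: always_eventually)
qed

text \<open>
  For small \<open>v * w\<close> the whole interval is contracted. Otherwise both maps have positive parameter, and a
  periodic critical point is superattracting: near it, the small derivative of the first step outweighs
  the factor \<open>4\<close> of each of the remaining ones, uniformly in the parameter.
\<close>

lemma quadratic_local_traps:
  assumes p: "p \<in> param_space"
  shows "\<exists>d. local_traps param_space (maps quadratic) p d"
proof (cases "fst p * snd p < 1/16")
  case True
  let ?d = "\<lambda>q b. 1 :: real"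
  have folded: "folded_pair (maps quadratic q) (?d q)" if q: "q \<in> param_space" for q
  proof -
    interpret symmetric_pair "maps quadratic q" by (rule symmetric_pair_quadratic[OF q])
    show ?thesis by unfold_locales auto
  qed
  have trap: "trapping_pair (maps quadratic q) (?d q)" if q: "q \<in> param_space" "fst q * snd q < 1/16" for q
  proof -
    interpret folded_pair "maps quadratic q" "?d q" by (rule folded[OF q(1)])
    have c: "0 \<le> fst q" "fst q \<le> 1" "0 \<le> snd q" "snd q \<le> 1" using q by (auto simp: param_space_def)
    note lip = quadratic_lipschitz(1)[OF q(1)]
    have lip4: "\<bar>maps quadratic q b x - maps quadratic q b y\<bar> \<le> 4 * \<bar>x - y\<bar>" if xy: "x \<in> {0..1}" "y \<in> {0..1}" for b x y
      by (rule quadratic_lipschitz4[OF q(1) xy])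
    have two: "\<bar>orb (maps quadratic q) b 2 x - orb (maps quadratic q) b 2 y\<bar> \<le> 16 * (fst q * snd q) * \<bar>x - y\<bar>"
      if xy: "x \<in> {0..1}" "y \<in> {0..1}" for b x y
    proof -
      have "\<bar>maps quadratic q (\<not> b) (maps quadratic q b x) - maps quadratic q (\<not> b) (maps quadratic q b y)\<bar>
        \<le> 4 * (if \<not> b then snd q else fst q) * \<bar>maps quadratic q b x - maps quadratic q b y\<bar>"
        using xy by (intro lip h_range)
      also have "\<dots> \<le> 4 * (if \<not> b then snd q else fst q) * (4 * (if b then snd q else fst q) * \<bar>x - y\<bar>)"
        using c lip[OF xy, of b] by (intro mult_left_mono) auto
      also have "\<dots> = 16 * (fst q * snd q) * \<bar>x - y\<bar>" by simp
      finally show ?thesis by (simp add: orb_two)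
    qed
    show ?thesis
    proof
      fix b
      show "contracts (maps quadratic q) b 1"
        by (rule contracts_of_iterate[where S = "{0..1}" and N = 2 and c = "16 * (fst q * snd q)", OF lip4])
          (use orb_range two c q in \<open>auto simp del: atLeastAtMost_iff\<close>)
    qed
  qed
  have "aperiodic_pair (maps quadratic p) (?d p)"
  proof -
    interpret folded_pair "maps quadratic p" "?d p" by (rule folded[OF p])
    show ?thesis by unfold_locales simp
  qed
  moreover have "open {q :: real \<times> real. fst q * snd q < 1/16}" by (intro open_Collect_less continuous_intros)
  then have "\<forall>\<^sub>F q in nhds p. fst q * snd q < 1/16" using True eventually_nhds_in_open[of "{q. fst q * snd q < 1/16}" p] by simp
  then have "\<forall>\<^sub>F q in nhds p. q \<in> param_space \<longrightarrow> trapping_pair (maps quadratic q) (?d q)"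
    by (rule eventually_mono) (use trap in auto)
  ultimately show ?thesis unfolding local_traps_def by (intro exI[of _ ?d]) auto
next
  case False
  interpret F: pair_family param_space "maps quadratic" by (rule pair_family_maps) simp
  define m where "m b = (SOME i. 0 < i \<and> orb (maps quadratic p) b (2 * i) (1/2) = 1/2)" for b
  define per where "per b \<longleftrightarrow> (\<exists>i>0. orb (maps quadratic p) b (2 * i) (1/2) = 1/2)" for b
  have m: "0 < m b" "orb (maps quadratic p) b (2 * m b) (1/2) = 1/2" if "per b" for b
    using someI_ex[of "\<lambda>i. 0 < i \<and> orb (maps quadratic p) b (2 * i) (1/2) = 1/2"] that unfolding per_def m_def by auto
  \<comment> \<open>the first step contributes the factor \<open>8 * r b\<close> and the other \<open>2 * m b - 1\<close> steps at most \<open>4\<close> each, in total \<open>1/2\<close>\<close>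
  define r where "r b = (if per b then 1 / (4 * 4 ^ (2 * m b)) else (0::real))" for b
  have r0: "0 \<le> r b" for b by (simp add: r_def)
  have rpos: "0 < r b" if "per b" for b using that by (simp add: r_def)
  have pos: "0 < fst p" "0 < snd p"
  proof -
    have "0 \<le> fst p" "0 \<le> snd p" using p by (auto simp: param_space_def)
    moreover have "fst p \<noteq> 0" "snd p \<noteq> 0" using False by auto
    ultimately show "0 < fst p" "0 < snd p" by auto
  qed
  have folded: "folded_pair (maps quadratic q) r" if q: "q \<in> param_space" "0 < fst q" "0 < snd q" for q
  proof -
    interpret symmetric_pair "maps quadratic q" by (rule symmetric_pair_quadratic[OF q(1)])
    show ?thesis
    proof
      fix b and x y :: real
      show "0 \<le> r b" by (rule r0)
      assume xy: "0 \<le> x" "x < y" "y \<le> 1/2 - r b"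
      have "y * (1 - y) - x * (1 - x) = (y - x) * (1 - x - y)" by (simp add: algebra_simps)
      moreover have "0 < (y - x) * (1 - x - y)" using xy r0[of b] by (intro mult_pos_pos) auto
      ultimately have "x * (1 - x) < y * (1 - y)" by linarith
      then show "maps quadratic q b x < maps quadratic q b y"
        using q mult_strict_left_mono[of "x * (1 - x)" "y * (1 - y)" "4 * (if b then snd q else fst q)"]
        by (simp add: maps_def quadratic_def mult.assoc split: if_splits)
    qed
  qed
  have trap: "trapping_pair (maps quadratic q) r"
    if q: "q \<in> param_space" "0 < fst q" "0 < snd q" and near: "\<And>b. per b \<Longrightarrow> \<bar>orb (maps quadratic q) b (2 * m b) (1/2) - 1/2\<bar> < r b / 2" for q
  proof -
    interpret folded_pair "maps quadratic q" r by (rule folded[OF q])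
    have lip4: "\<bar>maps quadratic q b x - maps quadratic q b y\<bar> \<le> 4 * \<bar>x - y\<bar>" if xy: "x \<in> {0..1}" "y \<in> {0..1}" for b x y
      by (rule quadratic_lipschitz4[OF q(1) xy])
    show ?thesis
    proof
      fix b
      show "contracts (maps quadratic q) b (r b)"
      proof (cases "per b")
        case True
        let ?S = "{x \<in> {0..1}. \<bar>x - 1/2\<bar> < r b}" and ?o = "orb (maps quadratic q) b (2 * m b)"
        obtain k where k: "2 * m b = Suc k" using m(1)[OF True] by (cases "m b") auto
        have half: "\<bar>?o x - ?o y\<bar> \<le> 1/2 * \<bar>x - y\<bar>" if xy: "x \<in> ?S" "y \<in> ?S" for x y
        proof -
          have "\<bar>?o x - ?o y\<bar> \<le> 4 ^ k * \<bar>maps quadratic q b x - maps quadratic q b y\<bar>"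
            unfolding k orb.simps using xy by (intro orb_lipschitz[OF lip4] h_range) auto
          also have "\<dots> \<le> 4 ^ k * (8 * r b * \<bar>x - y\<bar>)"
            using xy quadratic_lipschitz(2)[OF q(1), of x y "r b" b] by (intro mult_left_mono) auto
          also have "\<dots> = 1/2 * \<bar>x - y\<bar>" using True unfolding r_def k by (simp add: field_simps)
          finally show ?thesis .
        qed
        have "1/2 \<in> ?S" using rpos[OF True] by simp
        have inS: "?o x \<in> ?S" if x: "x \<in> ?S" for x
        proof -
          have "\<bar>?o x - ?o (1/2)\<bar> \<le> 1/2 * \<bar>x - 1/2\<bar>" by (rule half[OF x \<open>1/2 \<in> ?S\<close>])
          moreover have "\<bar>x - 1/2\<bar> < r b" using x by simp
          moreover have "\<bar>?o x - 1/2\<bar> \<le> \<bar>?o x - ?o (1/2)\<bar> + \<bar>?o (1/2) - 1/2\<bar>" by simp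
          ultimately have "\<bar>?o x - 1/2\<bar> < r b" using near[OF True] by (simp only: mult.commute[of "1/2"]) argo
          then show ?thesis using orb_range[of x b "2 * m b"] x by auto
        qed
        show ?thesis
          by (rule contracts_of_iterate[where S = ?S and N = "2 * m b" and c = "1/2", OF lip4 _ _ inS _ _ half])
            (use m(1)[OF True] in auto)
      qed (simp add: r_def contracts_def)
    qed
  qed
  have "aperiodic_pair (maps quadratic p) r"
  proof -
    interpret folded_pair "maps quadratic p" r by (rule folded[OF p pos])
    show ?thesis
    proof
      fix b i assume "r b = 0" "0 < (i::nat)"
      then have "\<not> per b" using rpos[of b] by auto
      then show "orb (maps quadratic p) b (2 * i) (1/2) \<noteq> 1/2" using \<open>0 < i\<close> unfolding per_def by blast
    qed
  qed
  moreover have "\<forall>\<^sub>F q in nhds p. q \<in> param_space \<longrightarrow> trapping_pair (maps quadratic q) r"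
  proof -
    have e1: "\<forall>\<^sub>F q in nhds p. 0 < fst q" "\<forall>\<^sub>F q in nhds p. 0 < snd q"
      using order_tendstoD(1)[OF tendsto_fst[OF filterlim_ident] pos(1)]
        order_tendstoD(1)[OF tendsto_snd[OF filterlim_ident] pos(2)] by simp_all
    have e2: "\<forall>\<^sub>F q in nhds p. q \<in> param_space \<longrightarrow> per b \<longrightarrow> \<bar>orb (maps quadratic q) b (2 * m b) (1/2) - 1/2\<bar> < r b / 2" for b
    proof (cases "per b")
      case True
      have "\<forall>\<^sub>F q in nhds p. q \<in> param_space \<longrightarrow> orb (maps quadratic q) b (2 * m b) (1/2) \<in> ball (1/2) (r b / 2)"
        by (intro F.eventually_orb p) (use rpos[OF True] in \<open>simp_all only: m(2)[OF True] open_ball centre_in_ball half_gt_zero\<close>, simp)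
      then show ?thesis by (rule eventually_mono) (auto simp: dist_real_def abs_minus_commute)
    qed simp
    show ?thesis
      using e1 e2[of False] e2[of True]
    proof eventually_elim
      case (elim q)
      show ?case
      proof
        assume "q \<in> param_space"
        then show "trapping_pair (maps quadratic q) r"
        proof (rule trap)
          fix b assume "per b"
          then show "\<bar>orb (maps quadratic q) b (2 * m b) (1/2) - 1/2\<bar> < r b / 2"
            using elim(3,4) \<open>q \<in> param_space\<close> by (cases b) auto
        qed (use elim in auto)
      qed
    qed
  qed
  ultimately show ?thesis unfolding local_traps_def by (intro exI[of _ "\<lambda>q. r"]) auto
qed

section \<open>Behaviour near a parameter\<close>

lemma eventually_by_sequences:
  fixes p :: "'a::metric_space"
  assumes "\<And>q. (\<And>n. q n \<in> P) \<Longrightarrow> q \<longlonglongrightarrow> p \<Longrightarrow> \<exists>n. Q (q n)"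
  shows "\<forall>\<^sub>F q in nhds p. q \<in> P \<longrightarrow> Q q"
proof (rule ccontr)
  assume "\<not> ?thesis"
  then have "\<forall>n. \<exists>q. dist q p < 1 / real (Suc n) \<and> q \<in> P \<and> \<not> Q q"
    unfolding eventually_nhds_metric by (metis of_nat_0_less_iff zero_less_Suc zero_less_divide_1_iff)
  then obtain q where q: "\<And>n. dist (q n) p < 1 / real (Suc n) \<and> q n \<in> P \<and> \<not> Q (q n)" by metis
  have "(\<lambda>n. dist (q n) p) \<longlonglongrightarrow> 0"
  proof (rule tendsto_sandwich[OF _ _ tendsto_const LIMSEQ_inverse_real_of_nat])
    show "\<forall>\<^sub>F n in sequentially. dist (q n) p \<le> inverse (real (Suc n))"
    proof (intro always_eventually allI)
      fix n
      show "dist (q n) p \<le> inverse (real (Suc n))" using q[of n] by (simp add: inverse_eq_divide)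
    qed
  qed simp
  then have "q \<longlonglongrightarrow> p" by (rule tendsto_dist_iff[THEN iffD2])
  then show False using assms[of q] q by blast
qed

context folded_pair
begin

text \<open>
  By submultiplicativity the infimum is the exponential growth rate per application of the composed map.
\<close>

definition growth :: real where
  "growth = (INF k\<in>{1..}. ln (max 1 (real (card (words (2 * k))))) / real k)"

lemma growth_bdd: "bdd_below ((\<lambda>k. ln (max 1 (real (card (words (2 * k))))) / real k) ` {1..})"
  by (rule bdd_belowI[of _ 0]) auto

lemma growth_nonneg: "0 \<le> growth"
  unfolding growth_def by (rule cINF_greatest) auto

lemma growth_le: "1 \<le> k \<Longrightarrow> growth \<le> ln (max 1 (real (card (words (2 * k))))) / real k"
  unfolding growth_def by (rule cINF_lower[OF growth_bdd]) auto

lemma growth_approx: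
  assumes "0 < e"
  obtains k where "1 \<le> k" "ln (max 1 (real (card (words (2 * k))))) / real k < growth + e"
proof -
  have "(INF k\<in>{1..}. ln (max 1 (real (card (words (2 * k))))) / real k) < growth + e"
    using assms by (simp add: growth_def)
  then show ?thesis using that by (subst (asm) cINF_less_iff[OF _ growth_bdd]) auto
qed

lemma exp_growth_le:
  assumes "0 < growth"
  shows "exp (growth * real n) \<le> real (card (words (2 * n)))"
proof (cases "n = 0")
  case True
  have "words 0 = {[]}" by (auto simp: words_def)
  then show ?thesis using True by simp
next
  case False
  then have "growth * real n \<le> ln (max 1 (real (card (words (2 * n)))))"
    using growth_le[of n] by (simp add: pos_le_divide_eq)
  then have "exp (growth * real n) \<le> max 1 (real (card (words (2 * n))))"
    by (subst (asm) ln_ge_iff) auto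
  moreover have "1 < exp (growth * real n)" using False assms by simp
  ultimately show ?thesis by linarith
qed

lemma card_words_le_exp:
  assumes "0 < e"
  obtains B where "0 < B" "\<And>k. real (card (words (2 * k))) \<le> B * exp ((growth + e) * real k)"
proof -
  obtain l where l: "1 \<le> l" "ln (max 1 (real (card (words (2 * l))))) / real l < growth + e"
    using growth_approx[OF assms] .
  define M where "M = max 1 (card (words (2 * l)))"
  have "ln (real M) / real l < growth + e" using l(2) by (simp add: M_def of_nat_max)
  then have "ln (real M) < (growth + e) * real l" using l(1) by (simp add: pos_divide_less_eq)
  moreover have M1: "1 \<le> real M" by (simp add: M_def)
  ultimately have M: "real M \<le> exp ((growth + e) * real l)" by (metis exp_ln exp_le_cancel_iff less_eq_real_def less_le_trans zero_less_one)
  have "real (card (words (2 * k))) \<le> 4 ^ l * exp ((growth + e) * real k)" for k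
  proof -
    have "card (words (2 * k)) \<le> 4 ^ l * M ^ ((2 * k) div (2 * l))" by (rule card_words_bound[OF l(1) M_def])
    then have "real (card (words (2 * k))) \<le> real (4 ^ l * M ^ (k div l))" by (simp only: of_nat_le_iff) simp
    also have "\<dots> = 4 ^ l * real M ^ (k div l)" by simp
    also have "\<dots> \<le> 4 ^ l * exp ((growth + e) * real l) ^ (k div l)"
      using M M1 by (intro mult_left_mono power_mono) auto
    also have "\<dots> = 4 ^ l * exp ((growth + e) * real (l * (k div l)))"
      by (simp add: exp_of_nat_mult[symmetric] mult_ac)
    also have "\<dots> \<le> 4 ^ l * exp ((growth + e) * real k)"
      using growth_nonneg assms by (intro mult_left_mono) (auto intro!: mult_left_mono simp del: of_nat_mult)
    finally show ?thesis .
  qed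
  then show ?thesis using that[of "4 ^ l"] by simp
qed

end

context aperiodic_pair
begin

text \<open>
  Concatenations of the full words of one large family have almost the full growth, and for one of any two
  consecutive numbers of factors enough of them reverse order.
\<close>

lemma frequently_many_neg_words:
  assumes \<beta>: "0 < \<beta>" "\<beta> < growth"
  shows "\<exists>k\<ge>K. exp (\<beta> * real k) \<le> real (card (neg_words h k))"
proof -
  define \<beta>' where "\<beta>' = (\<beta> + growth) / 2"
  have \<beta>': "\<beta> < \<beta>'" "\<beta>' < growth" "0 < growth" using \<beta> by (auto simp: \<beta>'_def)
  obtain K1 :: nat where K1: "ln 5 / \<beta>' < real K1" using reals_Archimedean2 by blast
  obtain k D where k: "max 1 K1 \<le> k" "J False D \<noteq> {}" "exp (\<beta>' * real k) \<le> real (card (full D k))"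
    using many_full_words[OF exp_growth_le[OF \<beta>'(3)] \<beta>'(3,2), of "max 1 K1"] by blast
  have "ln 5 < \<beta>' * real k" 
  proof -
    have "ln 5 < \<beta>' * real K1" using K1 \<beta>' \<beta> by (simp add: pos_divide_less_eq mult.commute)
    also have "\<dots> \<le> \<beta>' * real k" using k \<beta>' \<beta> by (intro mult_left_mono) auto
    finally show ?thesis .
  qed
  then have "5 < exp (\<beta>' * real k)" by (metis exp_less_mono exp_ln zero_less_numeral)
  then have five: "5 \<le> card (full D k)" using k(3) by linarith
  obtain a b where ab: "J False D = {a..b}" "a < b" using full_nondegenerate[OF k(2) five] .
  have "filterlim (\<lambda>n. (\<beta>' - \<beta>) * real k * real n) at_top sequentially"
    using \<beta>' k by (intro filterlim_tendsto_pos_mult_at_top[OF tendsto_const] filterlim_real_sequentially) auto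
  then have "\<forall>\<^sub>F n in sequentially. \<beta> * real k + ln 2 \<le> (\<beta>' - \<beta>) * real k * real n"
    by (simp add: filterlim_at_top)
  then obtain n0 where n0: "\<And>n. n0 \<le> n \<Longrightarrow> \<beta> * real k + ln 2 \<le> (\<beta>' - \<beta>) * real k * real n"
    unfolding eventually_sequentially by blast
  define n where "n = max 1 (max n0 K)"
  have n: "1 \<le> n" "K \<le> k * n" 
  proof -
    show "1 \<le> n" by (simp add: n_def)
    have "1 * K \<le> k * n" using k(1) by (intro mult_le_mono) (auto simp: n_def)
    then show "K \<le> k * n" by simp
  qed
  have "2 * exp (\<beta> * real (k * Suc n)) = exp (ln 2 + \<beta> * real (k * Suc n))" by (simp add: exp_add)
  also have "\<dots> \<le> exp (\<beta>' * real k * real n)"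
    using n0[of n] by (simp add: n_def algebra_simps)
  also have "\<dots> = exp (\<beta>' * real k) ^ n" by (simp add: exp_of_nat_mult[symmetric] mult_ac)
  also have "\<dots> \<le> real (card (full D k)) ^ n" using k(3) by (intro power_mono) auto
  also have "\<dots> \<le> real (card (neg_words h (k * n)) + card (neg_words h (k * Suc n)))"
    using of_nat_mono[OF many_neg_words[OF ab _ n(1)], where 'a = real, of k] five by simp
  finally have sum: "2 * exp (\<beta> * real (k * Suc n)) \<le> real (card (neg_words h (k * n))) + real (card (neg_words h (k * Suc n)))" by simp
  have "exp (\<beta> * real (k * n)) \<le> exp (\<beta> * real (k * Suc n))" using \<beta> by simp
  then consider "exp (\<beta> * real (k * n)) \<le> real (card (neg_words h (k * n)))"
    | "exp (\<beta> * real (k * Suc n)) \<le> real (card (neg_words h (k * Suc n)))" using sum by linarith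
  then show ?thesis
  proof cases
    case 1
    then show ?thesis using n(2) by blast
  next
    case 2
    moreover have "K \<le> k * Suc n" using n(2) by simp
    ultimately show ?thesis by blast
  qed
qed

end

lemma reversing_all_left: "(\<And>a. a \<in> set w \<Longrightarrow> \<not> a) \<Longrightarrow> \<not> reversing w"
  by (induction w) auto

context symmetric_pair
begin

lemma orb_zero: "orb h b i 0 = 0"
  by (induction i arbitrary: b) (auto simp: h_zero)

lemma neg_word_point_interior:
  assumes "reversing w" "length w = 2 * k" "x \<in> cyl h side False w" "orb h False (2 * k) x = x"
  shows "0 < x" "x < 1"
proof -
  have x01: "x \<in> {0..1}" using assms(3) cyl_subset[OF half_laps_side] by blast
  have "w \<noteq> []" using assms(1) by auto
  have "x \<noteq> 0"
  proof
    assume "x = 0"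
    have "\<not> w ! i" if "i < length w" for i
      using cyl_nth[OF half_laps_side assms(3) that] orb_zero[of False i] \<open>x = 0\<close> by (auto simp: side_def split: if_splits)
    then have "\<not> reversing w" by (intro reversing_all_left) (metis in_set_conv_nth)
    then show False using assms(1) by simp
  qed
  moreover have "x \<noteq> 1"
  proof
    assume "x = 1"
    obtain j where "2 * k = Suc j" using \<open>w \<noteq> []\<close> assms(2) by (cases "2 * k") auto
    then have "orb h False (2 * k) 1 = 0" using h_one orb_zero by simp
    then show False using assms(4) \<open>x = 1\<close> by simp
  qed
  ultimately show "0 < x" "x < 1" using x01 by auto
qed

lemma neg_wordI:
  assumes w: "reversing w" "length w = 2 * k" and ab: "a \<le> b" "a \<in> cyl h side False w" "b \<in> cyl h side False w"
    and cross: "a \<le> orb h False (2 * k) a" "orb h False (2 * k) b \<le> b"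
  shows "w \<in> neg_words h k"
proof -
  have "{a..b} \<subseteq> {0..1}" using ab cyl_subset[OF half_laps_side, of h False w] by auto
  then have "continuous_on {a..b} (\<lambda>x. orb h False (2 * k) x - x)"
    by (intro continuous_intros continuous_on_subset[OF orb_cont])
  then obtain x where x: "a \<le> x" "x \<le> b" "orb h False (2 * k) x = x"
    using IVT2'[of "\<lambda>x. orb h False (2 * k) x - x" b 0 a] cross ab by auto
  then show ?thesis using w cyl_between[OF half_laps_side ab(2,3), of x] by (auto simp: neg_words_def)
qed

end

lemma in_side_cyl_iff:
  assumes "symmetric_pair h" "x \<in> {0..1}"
  shows "x \<in> cyl h side False w \<longleftrightarrow> (\<forall>i<length w. if w ! i then 1/2 < orb h False i x else orb h False i x < 1/2)"
  using symmetric_pair.orb_range[OF assms, of False] assms(2)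
  unfolding cyl_iff[OF half_laps_side] by (auto simp: side_def)

context trapping_pair
begin

text \<open>
  Orbits of trapped points approach each other, which is impossible for two different periodic points.
\<close>

lemma trapped_periodic_unique:
  assumes "x \<in> {0..1}" "y \<in> {0..1}" "\<bar>x - 1/2\<bar> < d b" "\<bar>y - 1/2\<bar> < d b"
    and "0 < i" "orb h b (2 * i) x = x" "0 < j" "orb h b (2 * j) y = y"
  shows "x = y"
proof -
  define N where "N = 2 * i * j"
  have per: "orb h b (N * n) x = x" "orb h b (N * n) y = y" for n
    using orb_fixed_mult[of "2 * i" h b x "j * n"] orb_fixed_mult[of "2 * j" h b y "i * n"] assms(6,8)
    by (simp_all add: N_def mult_ac)
  have "0 < N" using assms by (simp add: N_def)
  then have "strict_mono (\<lambda>n. N * n)" by (simp add: strict_mono_def)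
  from LIMSEQ_subseq_LIMSEQ[OF trap_contracts[OF assms(1-4)] this]
  have "(\<lambda>n. x - y) \<longlonglongrightarrow> 0" unfolding o_def per .
  then show ?thesis by (simp add: LIMSEQ_const_iff)
qed

text \<open>
  A periodic orbit that is never trapped follows one of the itineraries that are counted anyway. Each of the two neighbourhoods
  contains at most one periodic point \<open>z c\<close>, so the other orbits run through \<open>z False\<close> or \<open>z True\<close> and
  contribute at most \<open>2 * k\<close> starting points each.
\<close>

lemma card_neg_words_le: "card (neg_words h k) \<le> card (words (2 * k)) + 4 * k"
proof -
  define z where "z c = (SOME z. z \<in> {0..1} \<and> \<bar>z - 1/2\<bar> < d c \<and> (\<exists>i>0. orb h c (2 * i) z = z))" for c
  have zeq: "y = z c" if "y \<in> {0..1}" "\<bar>y - 1/2\<bar> < d c" "0 < i" "orb h c (2 * i) y = y" for y c i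
  proof -
    have "\<exists>y. y \<in> {0..1} \<and> \<bar>y - 1/2\<bar> < d c \<and> (\<exists>i>0. orb h c (2 * i) y = y)" using that by blast
    from someI_ex[OF this] obtain j where "z c \<in> {0..1}" "\<bar>z c - 1/2\<bar> < d c" "0 < j" "orb h c (2 * j) (z c) = z c"
      unfolding z_def by blast
    then show ?thesis using trapped_periodic_unique[OF that(1) _ that(2) _ that(3,4)] by blast
  qed
  define X where "X = (\<lambda>(c, j). orb h c j (z c)) ` ((UNIV :: bool set) \<times> {1..2 * k})"
  define itin where "itin x = map (\<lambda>i. 1/2 < orb h False i x) [0..<2 * k]" for x
  have "neg_words h k \<subseteq> words (2 * k) \<union> itin ` X"
  proof
    fix w assume w: "w \<in> neg_words h k"
    then obtain x where x: "length w = 2 * k" "x \<in> cyl h side False w" "orb h False (2 * k) x = x"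
      by (auto simp: neg_words_def)
    have x01: "x \<in> {0..1}" using x(2) cyl_subset[OF half_laps_side] by blast
    have sides: "w ! i = (1/2 < orb h False i x)" "orb h False i x \<in> side (odd i) (w ! i)" if "i < 2 * k" for i
      using cyl_nth[OF half_laps_side x(2), of i] that x(1) by (auto simp: side_def split: if_splits)
    have weq: "w = itin x" unfolding itin_def using x(1) sides(1) by (intro nth_equalityI) auto
    show "w \<in> words (2 * k) \<union> itin ` X"
    proof (cases "\<exists>i<2 * k. trapped x i")
      case False
      have "x \<in> J False w" unfolding cyl_iff[OF half_lap]
        using False untrapped_lap[OF _ x01] sides(1) x01 orb_range[OF x01, of False] x(1) by auto
      then show ?thesis using x(1) by (auto simp: words_def)
    next
      case True
      then obtain i where i: "i < 2 * k" "trapped x i" by blast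
      let ?y = "orb h False i x"
      have returns: "orb h (odd i) (2 * k - i) ?y = x" using orb_add[of h False i "2 * k - i" x] i x(3) by simp
      have "orb h (odd i) (2 * k) ?y = orb h (odd i) ((2 * k - i) + i) ?y" using i by simp
      also have "\<dots> = orb h (odd i \<noteq> odd (2 * k - i)) i x" unfolding orb_add returns ..
      also have "(odd i \<noteq> odd (2 * k - i)) = False" using i by auto
      finally have "orb h (odd i) (2 * k) ?y = ?y" .
      then have "?y = z (odd i)"
        using i orb_range[OF x01, of False i] by (intro zeq[of _ _ k]) (auto simp: trapped_def)
      then have "x = (\<lambda>(c, j). orb h c j (z c)) (odd i, 2 * k - i)" using returns by simp
      moreover have "(odd i, 2 * k - i) \<in> UNIV \<times> {1..2 * k}" using i by auto
      ultimately have "x \<in> X" unfolding X_def by (rule image_eqI)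
      then show ?thesis using weq by blast
    qed
  qed
  then have "card (neg_words h k) \<le> card (words (2 * k) \<union> itin ` X)"
    by (intro card_mono) (auto simp: X_def)
  also have "\<dots> \<le> card (words (2 * k)) + card (itin ` X)" by (rule card_Un_le)
  also have "card (itin ` X) \<le> card X" by (intro card_image_le) (simp add: X_def)
  also have "card X \<le> card ((UNIV :: bool set) \<times> {1..2 * k})" unfolding X_def by (intro card_image_le) simp
  also have "\<dots> = 4 * k" by (simp add: card_cartesian_product)
  finally show ?thesis by simp
qed

end

text \<open>
  Near a periodic turning point there is no second periodic point, uniformly in nearby parameters.
\<close>

definition isolates :: "(bool \<Rightarrow> real \<Rightarrow> real) \<Rightarrow> bool \<Rightarrow> real \<Rightarrow> bool" where
  "isolates h b r \<longleftrightarrow> (\<forall>x\<in>{0..1}. \<forall>y\<in>{0..1}. \<bar>x - 1/2\<bar> < r \<longrightarrow> \<bar>y - 1/2\<bar> < r \<longrightarrow>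
     (\<exists>i>0. orb h b (2 * i) x = x) \<longrightarrow> (\<exists>j>0. orb h b (2 * j) y = y) \<longrightarrow> x = y)"

lemma isolatesD:
  assumes "isolates h b r" "x \<in> {0..1}" "\<bar>x - 1/2\<bar> < r" "0 < r"
    and "0 < i" "orb h b (2 * i) x = x" "0 < j" "orb h b (2 * j) (1/2) = 1/2"
  shows "x = 1/2"
proof -
  have "(1/2::real) \<in> {0..1}" "\<bar>1/2 - 1/2 :: real\<bar> < r" using assms(4) by simp_all
  then show ?thesis using assms unfolding isolates_def by blast
qed

context pair_family
begin

abbreviation fam_entropy :: "real \<times> real \<Rightarrow> ereal" where
  "fam_entropy q \<equiv> topological_entropy (h q True \<circ> h q False) {0..1}"

text \<open>
  Between two points on either side of the periodic point the return map minus the identity changes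
  sign, and finitely many strict inequalities express this.
\<close>

lemma neg_words_open:
  assumes p: "p \<in> P" and w: "w \<in> neg_words (h p) k"
  shows "\<forall>\<^sub>F q in nhds p. q \<in> P \<longrightarrow> w \<in> neg_words (h q) k"
proof -
  interpret symmetric_pair "h p" by (rule sym[OF p])
  obtain x where x: "length w = 2 * k" "reversing w" "x \<in> cyl (h p) side False w" "orb (h p) False (2 * k) x = x"
    using w by (auto simp: neg_words_def)
  have x01: "0 < x" "x < 1" using neg_word_point_interior[OF x(2,1,3,4)] .
  define T where "T i = (if w ! i then {1/2<..} else {..<1/2::real})" for i
  have oT: "open (T i)" for i by (simp add: T_def)
  have cylT: "y \<in> cyl (h q) side False w \<longleftrightarrow> (\<forall>i<2 * k. orb (h q) False i y \<in> T i)" if "q \<in> P" "y \<in> {0..1}" for q y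
    unfolding in_side_cyl_iff[OF sym[OF that(1)] that(2)] x(1) by (auto simp: T_def)
  have "\<forall>\<^sub>F y in nhds x. orb (h p) False i y \<in> T i" if "i < 2 * k" for i
  proof -
    have "continuous_on {0<..<1} (orb (h p) False i)" by (rule continuous_on_subset[OF orb_cont]) auto
    then have "isCont (orb (h p) False i) x" using x01 by (simp add: continuous_on_eq_continuous_at)
    moreover have "orb (h p) False i x \<in> T i" using cylT[OF p, of x] x01 x(3) that by simp
    ultimately have "\<forall>\<^sub>F y in at x. orb (h p) False i y \<in> T i"
      using oT topological_tendstoD unfolding isCont_def by blast
    then have "\<forall>\<^sub>F y in nhds x. y \<noteq> x \<longrightarrow> orb (h p) False i y \<in> T i" by (simp add: eventually_at_filter)
    then show ?thesis by (rule eventually_mono) (use \<open>orb (h p) False i x \<in> T i\<close> in blast)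
  qed
  then have "\<forall>\<^sub>F y in nhds x. \<forall>i\<in>{..<2 * k}. orb (h p) False i y \<in> T i" by (intro eventually_ball_finite) auto
  then obtain e where e: "0 < e" "\<And>y i. dist y x < e \<Longrightarrow> i < 2 * k \<Longrightarrow> orb (h p) False i y \<in> T i"
    unfolding eventually_nhds_metric by auto
  define r where "r = min (e / 2) (min (x / 2) ((1 - x) / 2))"
  have r: "0 < r" "r < e" "r < x" "r < 1 - x" using e(1) x01 by (auto simp: r_def min_less_iff_disj)
  define a where "a = x - r"
  define b where "b = x + r"
  have ab: "a \<in> {0..1}" "b \<in> {0..1}" "a < x" "x < b" using r by (auto simp: a_def b_def)
  have inT: "orb (h p) False i a \<in> T i" "orb (h p) False i b \<in> T i" if "i < 2 * k" for i
    using e(2)[of a i] e(2)[of b i] that r by (auto simp: a_def b_def dist_real_def)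
  then have cyl: "a \<in> cyl (h p) side False w" "b \<in> cyl (h p) side False w" using cylT[OF p] ab by auto
  have "orb (h p) False (2 * k) x \<le> orb (h p) False (2 * k) a" "orb (h p) False (2 * k) b \<le> orb (h p) False (2 * k) x"
    using cyl_orb_mono[OF half_laps_side cyl(1) x(3)] cyl_orb_mono[OF half_laps_side x(3) cyl(2)] ab x(1,2) by auto
  then have lt: "a < orb (h p) False (2 * k) a" "orb (h p) False (2 * k) b < b" using x(4) ab by auto
  have "\<forall>\<^sub>F q in nhds p. \<forall>i\<in>{..<2 * k}. q \<in> P \<longrightarrow> orb (h q) False i a \<in> T i"
    "\<forall>\<^sub>F q in nhds p. \<forall>i\<in>{..<2 * k}. q \<in> P \<longrightarrow> orb (h q) False i b \<in> T i"
    using inT by (intro eventually_ball_finite ballI eventually_orb p ab oT; simp)+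
  then show ?thesis
    using eventually_orb_greater[OF p ab(1) lt(1)] eventually_orb_less[OF p ab(2) lt(2)]
  proof eventually_elim
    case (elim q)
    show ?case
    proof
      assume q: "q \<in> P"
      interpret Q: symmetric_pair "h q" by (rule sym[OF q])
      show "w \<in> neg_words (h q) k"
        using Q.neg_wordI[OF x(2,1), of a b] cylT[OF q ab(1)] cylT[OF q ab(2)] elim q ab by auto
    qed
  qed
qed

lemma eventually_neg_words_subset:
  assumes "p \<in> P"
  shows "\<forall>\<^sub>F q in nhds p. q \<in> P \<longrightarrow> neg_words (h p) k \<subseteq> neg_words (h q) k"
proof -
  have "\<forall>\<^sub>F q in nhds p. \<forall>w\<in>neg_words (h p) k. q \<in> P \<longrightarrow> w \<in> neg_words (h q) k"
    by (intro eventually_ball_finite ballI neg_words_open[OF assms]) auto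
  then show ?thesis by (rule eventually_mono) auto
qed

context
  fixes p :: "real \<times> real" and d :: "real \<times> real \<Rightarrow> bool \<Rightarrow> real"
  assumes p: "p \<in> P" and traps: "local_traps P h p d"
begin

interpretation A: aperiodic_pair "h p" "d p"
  using traps by (simp add: local_traps_def)

lemma d_cont: "continuous_on P (\<lambda>q. d q b)"
  using traps by (simp add: local_traps_def)

lemma near_trapping: "\<forall>\<^sub>F q in nhds p. q \<in> P \<longrightarrow> trapping_pair (h q) (d q)"
  using traps by (simp add: local_traps_def)

text \<open>
  Closed laps make cylinders upper semicontinuous in the parameter.
\<close>

lemma cyl_limit:
  assumes "q \<longlonglongrightarrow> p" "\<xi> \<longlonglongrightarrow> x" "\<And>n. q n \<in> P" "x \<in> {0..1}" "\<And>n. \<xi> n \<in> {0..1}"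
    and "\<And>n. \<xi> n \<in> cyl (h (q n)) (lap (d (q n))) b w"
  shows "x \<in> cyl (h p) (lap (d p)) b w"
  using assms(2,4-)
proof (induction w arbitrary: b \<xi> x)
  case (Cons a w)
  have hx: "(\<lambda>n. h (q n) b (\<xi> n)) \<longlonglongrightarrow> h p b x"
    using orb_tendsto[OF p Cons.prems(2) assms(1) Cons.prems(1) assms(3) Cons.prems(3), of b 1] by simp
  have dq: "(\<lambda>n. d (q n) b) \<longlonglongrightarrow> d p b"
    by (rule continuous_on_tendsto_compose[OF d_cont assms(1) p]) (simp add: assms(3))
  have in_lap: "\<xi> n \<in> lap (d (q n)) b a" for n using Cons.prems(4)[of n] by simp
  have "x \<in> lap (d p) b a"
  proof (cases a)
    case True
    have "1/2 + d p b \<le> x"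
      by (rule LIMSEQ_le[OF tendsto_add[OF tendsto_const dq] Cons.prems(1)]) (use in_lap True in \<open>auto simp: lap_def\<close>)
    then show ?thesis using True Cons.prems(2) by (simp add: lap_def)
  next
    case False
    have "x \<le> 1/2 - d p b"
      by (rule LIMSEQ_le[OF Cons.prems(1) tendsto_diff[OF tendsto_const dq]]) (use in_lap False in \<open>auto simp: lap_def\<close>)
    then show ?thesis using False Cons.prems(2) by (simp add: lap_def)
  qed
  moreover have "h p b x \<in> cyl (h p) (lap (d p)) (\<not> b) w"
    using Cons.prems symmetric_pair.h_range[OF sym[OF p]] symmetric_pair.h_range[OF sym[OF assms(3)]]
    by (intro Cons.IH[OF hx]) auto
  ultimately show ?case by simp
qed simp

lemma near_words_subset:
  "\<forall>\<^sub>F q in nhds p. q \<in> P \<longrightarrow> (trapping_pair (h q) (d q) \<longrightarrow> folded_pair.words (h q) (d q) n \<subseteq> A.words n)"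
proof -
  have one: "\<forall>\<^sub>F q in nhds p. q \<in> P \<longrightarrow> cyl (h q) (lap (d q)) False w = {} \<or> cyl (h p) (lap (d p)) False w \<noteq> {} \<or> \<not> trapping_pair (h q) (d q)" for w
  proof (rule eventually_by_sequences, rule ccontr)
    fix q assume q: "\<And>n. q n \<in> P" "q \<longlonglongrightarrow> p"
      and "\<nexists>n. cyl (h (q n)) (lap (d (q n))) False w = {} \<or> cyl (h p) (lap (d p)) False w \<noteq> {} \<or> \<not> trapping_pair (h (q n)) (d (q n))"
    then have ne: "\<And>n. cyl (h (q n)) (lap (d (q n))) False w \<noteq> {}" and empty: "cyl (h p) (lap (d p)) False w = {}"
      and tr: "\<And>n. trapping_pair (h (q n)) (d (q n))" by blast+
    have "\<forall>n. \<exists>x. x \<in> cyl (h (q n)) (lap (d (q n))) False w" using ne by blast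
    from choice[OF this] obtain \<xi> where \<xi>: "\<And>n. \<xi> n \<in> cyl (h (q n)) (lap (d (q n))) False w" by blast
    have \<xi>01: "\<xi> n \<in> {0..1}" for n
    proof -
      interpret trapping_pair "h (q n)" "d (q n)" by (rule tr)
      show ?thesis using \<xi>[of n] J_unit by blast
    qed
    obtain x r where r: "x \<in> {0..1}" "strict_mono r" "(\<xi> \<circ> r) \<longlonglongrightarrow> x"
      using seq_compactE[OF compact_imp_seq_compact[OF compact_Icc[of "0::real" 1]]] \<xi>01 by blast
    have "x \<in> cyl (h p) (lap (d p)) False w"
      by (rule cyl_limit[OF LIMSEQ_subseq_LIMSEQ[OF q(2) r(2)] r(3)]) (use q \<xi>01 \<xi> r in \<open>auto simp del: atLeastAtMost_iff\<close>)
    then show False using empty by blast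
  qed
  have "\<forall>\<^sub>F q in nhds p. \<forall>w\<in>{w. length w = n}. q \<in> P \<longrightarrow> cyl (h q) (lap (d q)) False w = {} \<or> cyl (h p) (lap (d p)) False w \<noteq> {} \<or> \<not> trapping_pair (h q) (d q)"
    by (intro eventually_ball_finite ballI one A.finite_words_length)
  then show ?thesis
  proof (rule eventually_mono, intro impI)
    fix q assume all: "\<forall>w\<in>{w. length w = n}. q \<in> P \<longrightarrow> cyl (h q) (lap (d q)) False w = {} \<or> cyl (h p) (lap (d p)) False w \<noteq> {} \<or> \<not> trapping_pair (h q) (d q)"
      and q: "q \<in> P" "trapping_pair (h q) (d q)"
    interpret Q: trapping_pair "h q" "d q" by (rule q(2))
    show "Q.words n \<subseteq> A.words n" using all q unfolding Q.words_def A.words_def by blast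
  qed
qed

lemma near_neg_words_bound:
  "\<forall>\<^sub>F q in nhds p. q \<in> P \<longrightarrow> card (neg_words (h q) k) \<le> card (A.words (2 * k)) + 4 * k"
  using near_trapping near_words_subset[of "2 * k"]
proof eventually_elim
  case (elim q)
  show ?case
  proof
    assume q: "q \<in> P"
    interpret Q: trapping_pair "h q" "d q" using elim q by blast
    have "card (Q.words (2 * k)) \<le> card (A.words (2 * k))" using elim q Q.trapping_pair_axioms by (intro card_mono) auto
    then show "card (neg_words (h q) k) \<le> card (A.words (2 * k)) + 4 * k" using Q.card_neg_words_le[of k] by linarith
  qed
qed

text \<open>
  Words of a fixed length cannot become more numerous under small perturbations.
\<close>

lemma near_entropy_upper:
  assumes e: "0 < e"
  shows "\<forall>\<^sub>F q in nhds p. q \<in> P \<longrightarrow> fam_entropy q \<le> ereal (A.growth + e)"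
proof -
  obtain k where k: "1 \<le> k" "ln (max 1 (real (card (A.words (2 * k))))) / real k < A.growth + e"
    using A.growth_approx[OF e] .
  show ?thesis using near_trapping near_words_subset[of "2 * k"]
  proof eventually_elim
    case (elim q)
    show ?case
    proof
      assume q: "q \<in> P"
      interpret Q: trapping_pair "h q" "d q" using elim q by blast
      have "card (Q.words (2 * k)) \<le> card (A.words (2 * k))" using elim q Q.trapping_pair_axioms by (intro card_mono) auto
      then have "ln (max 1 (real (card (Q.words (2 * k))))) / real k \<le> ln (max 1 (real (card (A.words (2 * k))))) / real k"
        by (intro divide_right_mono ln_mono) auto
      then have "ln (max 1 (real (card (Q.words (2 * k))))) / real k \<le> A.growth + e" using k(2) by linarith
      then show "fam_entropy q \<le> ereal (A.growth + e)" using Q.entropy_le_words[OF k(1)] by (meson ereal_less_eq(3) order_trans)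
    qed
  qed
qed

text \<open>
  The horseshoe found at \<open>p\<close> persists.
\<close>

lemma near_entropy_lower:
  assumes e: "0 < e"
  shows "\<forall>\<^sub>F q in nhds p. q \<in> P \<longrightarrow> ereal (A.growth - e) \<le> fam_entropy q"
proof (cases "A.growth \<le> e")
  case True
  have "ereal (A.growth - e) \<le> fam_entropy q" for q
  proof (rule order_trans)
    show "ereal (A.growth - e) \<le> 0" using True by simp
    show "0 \<le> fam_entropy q" by (rule topological_entropy_nonneg) simp
  qed
  then show ?thesis by simp
next
  case False
  define \<beta> where "\<beta> = A.growth - e"
  define \<beta>' where "\<beta>' = A.growth - e / 2"
  have \<beta>: "0 < \<beta>" "\<beta> < \<beta>'" "\<beta>' < A.growth" "0 < A.growth" "0 < \<beta>'" using False e by (auto simp: \<beta>_def \<beta>'_def)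
  have "\<forall>\<^sub>F k in sequentially. exp (\<beta> * real k) + 9 \<le> exp (\<beta>' * real k)"
    using \<beta> by real_asymp
  then obtain K where K: "\<And>k. K \<le> k \<Longrightarrow> exp (\<beta> * real k) + 9 \<le> exp (\<beta>' * real k)"
    unfolding eventually_sequentially by blast
  obtain k D where k: "max 1 K \<le> k" "A.J False D \<noteq> {}" "exp (\<beta>' * real k) \<le> real (card (A.full D k))"
    using A.many_full_words[OF A.exp_growth_le[OF \<beta>(4)] \<beta>(4,3), of "max 1 K"] by blast
  have big: "exp (\<beta> * real k) + 9 \<le> real (card (A.full D k))" using K[of k] k by simp
  then have "5 \<le> card (A.full D k)" using exp_ge_zero[of "\<beta> * real k"] by linarith
  then obtain u v where uv: "A.J False D = {u..v}" "u < v" using A.full_nondegenerate[OF k(2)] by blast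
  obtain F l r a b where F: "finite F" "card (A.full D k) \<le> card F + 8"
    "0 \<le> a" "a \<le> b" "b \<le> 1" "\<And>w. w \<in> F \<Longrightarrow> a \<le> l w \<and> l w \<le> r w \<and> r w \<le> b"
    "\<And>u w. u \<in> F \<Longrightarrow> w \<in> F \<Longrightarrow> u \<noteq> w \<Longrightarrow> r u < l w \<or> r w < (l u :: real)"
    "\<And>w. w \<in> (F :: bool list set) \<Longrightarrow> (orb (h p) False (2 * k) (l w) < a \<and> b < orb (h p) False (2 * k) (r w)) \<or>
        (b < orb (h p) False (2 * k) (l w) \<and> orb (h p) False (2 * k) (r w) < a)"
    using A.robust_horseshoe[OF uv, of k] by metis
  have cardF: "exp (\<beta> * real k) \<le> real (card F)" using big F(2) by linarith
  then have Fne: "F \<noteq> {}" using exp_gt_zero[of "\<beta> * real k"] by (metis card.empty not_le of_nat_0)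
  define crosses where "crosses q w \<longleftrightarrow> (orb (h q) False (2 * k) (l w) < a \<and> b < orb (h q) False (2 * k) (r w)) \<or>
      (b < orb (h q) False (2 * k) (l w) \<and> orb (h q) False (2 * k) (r w) < a)" for q w
  have "\<forall>\<^sub>F q in nhds p. q \<in> P \<longrightarrow> crosses q w" if w: "w \<in> F" for w
  proof -
    have lr: "l w \<in> {0..1}" "r w \<in> {0..1}" using F(6)[OF w] F(3,5) by auto
    from F(8)[OF w] show ?thesis
    proof
      assume *: "orb (h p) False (2 * k) (l w) < a \<and> b < orb (h p) False (2 * k) (r w)"
      show ?thesis using eventually_orb_less[OF p lr(1) conjunct1[OF *]] eventually_orb_greater[OF p lr(2) conjunct2[OF *]]
        by eventually_elim (simp add: crosses_def)
    next
      assume *: "b < orb (h p) False (2 * k) (l w) \<and> orb (h p) False (2 * k) (r w) < a"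
      show ?thesis using eventually_orb_less[OF p lr(2) conjunct2[OF *]] eventually_orb_greater[OF p lr(1) conjunct1[OF *]]
        by eventually_elim (simp add: crosses_def)
    qed
  qed
  then have "\<forall>\<^sub>F q in nhds p. \<forall>w\<in>F. q \<in> P \<longrightarrow> crosses q w"
    by (intro eventually_ball_finite F(1)) blast
  then show ?thesis
  proof (rule eventually_mono, intro impI)
    fix q assume cross: "\<forall>w\<in>F. q \<in> P \<longrightarrow> crosses q w" and q: "q \<in> P"
    interpret Q: symmetric_pair "h q" by (rule sym[OF q])
    have f: "((h q True \<circ> h q False) ^^ k) x = orb (h q) False (2 * k) x" for x by (simp add: orb_funpow)
    have "ereal (ln (real (card F)) / real k) \<le> fam_entropy q"
    proof (rule entropy_ge_of_horseshoe[of _ k F a b l r])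
      show "continuous_on {0..1} (h q True \<circ> h q False)"
        using Q.h_range by (intro continuous_on_compose Q.h_cont continuous_on_subset[OF Q.h_cont]) auto
      show "(h q True \<circ> h q False) ` {0..1} \<subseteq> {0..1}" using Q.h_range by auto
      fix w assume "w \<in> F"
      then show "((h q True \<circ> h q False) ^^ k) (l w) \<le> a \<and> b \<le> ((h q True \<circ> h q False) ^^ k) (r w) \<or>
          b \<le> ((h q True \<circ> h q False) ^^ k) (l w) \<and> ((h q True \<circ> h q False) ^^ k) (r w) \<le> a"
        using cross q unfolding f crosses_def by (meson less_imp_le)
    qed (use k F Fne in auto)
    moreover have "\<beta> \<le> ln (real (card F)) / real k"
    proof -
      have "0 < real (card F)" using cardF exp_gt_zero[of "\<beta> * real k"] by linarith
      then have "\<beta> * real k \<le> ln (real (card F))" using cardF by (simp add: ln_ge_iff)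
      then show ?thesis using k by (simp add: pos_le_divide_eq)
    qed
    ultimately show "ereal (A.growth - e) \<le> fam_entropy q" unfolding \<beta>_def by (meson ereal_less_eq(3) order_trans)
  qed
qed

lemma isolated_periodic:
  assumes "0 < i" "orb (h p) b (2 * i) (1/2) = 1/2"
  obtains r where "0 < r" "\<forall>\<^sub>F q in nhds p. q \<in> P \<longrightarrow> isolates (h q) b r"
proof -
  have "d p b \<noteq> 0" using A.aperiodic[of b i] assms by blast
  then have dpos: "0 < d p b" using A.d_nonneg[of b] by simp
  obtain U where "open U" "U \<inter> P = (\<lambda>q. d q b) -` {d p b / 2<..} \<inter> P"
    using d_cont[of b] open_greaterThan unfolding continuous_on_open_invariant by blast
  then have "\<forall>\<^sub>F q in nhds p. q \<in> P \<longrightarrow> d p b / 2 < d q b"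
    unfolding eventually_nhds using p dpos by (intro exI[of _ U]) auto
  then have "\<forall>\<^sub>F q in nhds p. q \<in> P \<longrightarrow> isolates (h q) b (d p b / 2)"
    using near_trapping
  proof eventually_elim
    case (elim q)
    show ?case
      unfolding isolates_def
    proof (intro impI ballI, elim exE conjE)
      fix x y :: real and i j :: nat
      assume q: "q \<in> P" and *: "x \<in> {0..1}" "y \<in> {0..1}" "\<bar>x - 1/2\<bar> < d p b / 2" "\<bar>y - 1/2\<bar> < d p b / 2"
        "0 < i" "orb (h q) b (2 * i) x = x" "0 < j" "orb (h q) b (2 * j) y = y"
      interpret Q: trapping_pair "h q" "d q" using elim q by blast
      have "\<bar>x - 1/2\<bar> < d q b" "\<bar>y - 1/2\<bar> < d q b" using * elim q by auto
      then show "x = y" using Q.trapped_periodic_unique[of x y b i j] * by blast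
    qed
  qed
  then show ?thesis by (rule that[rotated]) (use dpos in simp)
qed

end

end

section \<open>Order data of periodic orbits\<close>

lemma has_period_orbit:
  assumes "has_period f n u"
  shows "inj_on (\<lambda>l. (f ^^ l) u) {..<n}"
    and "forward_orbit f u = (\<lambda>l. (f ^^ l) u) ` {..<n}"
    and "(f ^^ (l mod n)) u = (f ^^ l) u"
proof -
  have n: "0 < n" "(f ^^ n) u = u" "\<And>m. 0 < m \<Longrightarrow> m < n \<Longrightarrow> (f ^^ m) u \<noteq> u"
    using assms by (auto simp: has_period_def)
  show md: "(f ^^ (l mod n)) u = (f ^^ l) u" for l by (rule funpow_mod_eq[OF n(2)])
  show "inj_on (\<lambda>l. (f ^^ l) u) {..<n}"
  proof (rule linorder_inj_onI)
    fix l m assume lm: "l < m" "l \<in> {..<n}" "m \<in> {..<n}"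
    show "(f ^^ l) u \<noteq> (f ^^ m) u"
    proof
      assume eq: "(f ^^ l) u = (f ^^ m) u"
      have "(f ^^ (n - m + l)) u = (f ^^ (n - m)) ((f ^^ m) u)" by (simp add: funpow_add eq)
      also have "\<dots> = (f ^^ (n - m + m)) u" by (simp only: funpow_add o_apply)
      also have "\<dots> = u" using lm n by simp
      finally have "(f ^^ (n - m + l)) u = u" .
      moreover have "0 < n - m + l" "n - m + l < n" using lm by auto
      ultimately show False using n(3)[of "n - m + l"] by simp
    qed
  qed auto
  have "(f ^^ l) u \<in> (\<lambda>l. (f ^^ l) u) ` {..<n}" for l
    using md[of l] n(1) by (intro image_eqI[of _ _ "l mod n"]) auto
  then show "forward_orbit f u = (\<lambda>l. (f ^^ l) u) ` {..<n}"
    unfolding forward_orbit_def by (intro equalityI image_subsetI rangeI)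
qed

lemma has_period_image_inj:
  assumes "has_period (h2 \<circ> h1) n u"
  shows "inj_on (\<lambda>l. h1 (((h2 \<circ> h1) ^^ l) u)) {..<n}"
proof (rule inj_onI)
  fix l m assume lm: "l \<in> {..<n}" "m \<in> {..<n}" "h1 (((h2 \<circ> h1) ^^ l) u) = h1 (((h2 \<circ> h1) ^^ m) u)"
  have "((h2 \<circ> h1) ^^ Suc l) u = ((h2 \<circ> h1) ^^ Suc m) u" using lm(3) by simp
  then have "((h2 \<circ> h1) ^^ (Suc l mod n)) u = ((h2 \<circ> h1) ^^ (Suc m mod n)) u"
    by (simp only: has_period_orbit(3)[OF assms])
  then have "Suc l mod n = Suc m mod n"
    using inj_onD[OF has_period_orbit(1)[OF assms], of "Suc l mod n" "Suc m mod n"] lm(1,2) by simp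
  then show "l = m" using lm(1,2) by (auto simp: mod_Suc split: if_splits)
qed

text \<open>
  Order-data depend only on the relative order of the successive points of the orbit in each copy. The
  indices \<open>a i\<close> and \<open>c j\<close> are the times at which the enumerations visit their points.
\<close>

lemma order_data_transfer:
  fixes h1 h2 k1 k2 :: "real \<Rightarrow> real"
  assumes per: "has_period (h2 \<circ> h1) n u" "has_period (k2 \<circ> k1) n v"
    and ord1: "\<And>l m. l < n \<Longrightarrow> m < n \<Longrightarrow> ((h2 \<circ> h1) ^^ l) u < ((h2 \<circ> h1) ^^ m) u \<Longrightarrow> ((k2 \<circ> k1) ^^ l) v < ((k2 \<circ> k1) ^^ m) v"
    and ord2: "\<And>l m. l < n \<Longrightarrow> m < n \<Longrightarrow> h1 (((h2 \<circ> h1) ^^ l) u) < h1 (((h2 \<circ> h1) ^^ m) u) \<Longrightarrow> k1 (((k2 \<circ> k1) ^^ l) v) < k1 (((k2 \<circ> k1) ^^ m) v)"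
    and od: "order_data h1 h2 (forward_orbit (h2 \<circ> h1) u) (h1 ` forward_orbit (h2 \<circ> h1) u) n \<sigma> \<tau>"
  shows "order_data k1 k2 (forward_orbit (k2 \<circ> k1) v) (k1 ` forward_orbit (k2 \<circ> k1) v) n \<sigma> \<tau>"
proof -
  define z where "z l = ((h2 \<circ> h1) ^^ l) u" for l
  define z' where "z' l = ((k2 \<circ> k1) ^^ l) v" for l
  have zS: "z (Suc l) = h2 (h1 (z l))" "z' (Suc l) = k2 (k1 (z' l))" for l by (simp_all add: z_def z'_def)
  have zmod: "z (l mod n) = z l" "z' (l mod n) = z' l" for l
    using has_period_orbit(3)[OF per(1)] has_period_orbit(3)[OF per(2)] by (simp_all add: z_def z'_def)
  have zinj: "inj_on z {..<n}" using has_period_orbit(1)[OF per(1)] by (simp add: z_def[abs_def])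
  have winj: "inj_on (\<lambda>l. h1 (z l)) {..<n}" using has_period_image_inj[OF per(1)] by (simp add: z_def)
  have X: "forward_orbit (h2 \<circ> h1) u = z ` {..<n}" "forward_orbit (k2 \<circ> k1) v = z' ` {..<n}"
    using has_period_orbit(2)[OF per(1)] has_period_orbit(2)[OF per(2)] by (simp_all add: z_def z'_def)
  have \<sigma>\<tau>: "\<sigma> permutes {1..n}" "\<tau> permutes {1..n}" using od by (simp_all add: order_data_def)
  obtain x y where xy: "strict_mono_on {1..n} x \<and> x ` {1..n} = z ` {..<n} \<and> strict_mono_on {1..n} y \<and> y ` {1..n} = h1 ` z ` {..<n} \<and>
      (\<forall>i\<in>{1..n}. h1 (x i) = y (\<sigma> i)) \<and> (\<forall>j\<in>{1..n}. h2 (y j) = x (\<tau> j))"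
    using od unfolding order_data_def X by (elim conjE exE) (rule that, intro conjI)
  then have x: "strict_mono_on {1..n} x" "x ` {1..n} = z ` {..<n}"
    and y: "strict_mono_on {1..n} y" "y ` {1..n} = h1 ` z ` {..<n}"
    and h1: "\<And>i. i \<in> {1..n} \<Longrightarrow> h1 (x i) = y (\<sigma> i)" and h2: "\<And>j. j \<in> {1..n} \<Longrightarrow> h2 (y j) = x (\<tau> j)"
    by simp_all
  have "\<forall>i\<in>{1..n}. \<exists>l. l < n \<and> z l = x i"
  proof
    fix i assume "i \<in> {1..n}"
    then have "x i \<in> z ` {..<n}" using x(2) by blast
    then show "\<exists>l. l < n \<and> z l = x i" by auto
  qed
  then obtain a where a: "\<And>i. i \<in> {1..n} \<Longrightarrow> a i < n \<and> z (a i) = x i" by (elim bchoice[THEN exE]) blast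
  have "\<forall>j\<in>{1..n}. \<exists>l. l < n \<and> h1 (z l) = y j"
  proof
    fix j assume "j \<in> {1..n}"
    then have "y j \<in> h1 ` z ` {..<n}" using y(2) by blast
    then show "\<exists>l. l < n \<and> h1 (z l) = y j" by auto
  qed
  then obtain c where c: "\<And>j. j \<in> {1..n} \<Longrightarrow> c j < n \<and> h1 (z (c j)) = y j" by (elim bchoice[THEN exE]) blast
  have a_im: "a ` {1..n} = {..<n}"
  proof (intro equalityI subsetI)
    fix l assume l: "l \<in> {..<n}"
    then have "z l \<in> x ` {1..n}" using x(2) by blast
    then obtain i where i: "i \<in> {1..n}" "z l = x i" by blast
    then have "a i = l" using a[OF i(1)] inj_onD[OF zinj, of "a i" l] l by auto
    then show "l \<in> a ` {1..n}" using i by blast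
  qed (use a in auto)
  have c_im: "c ` {1..n} = {..<n}"
  proof (intro equalityI subsetI)
    fix l assume l: "l \<in> {..<n}"
    then have "h1 (z l) \<in> y ` {1..n}" using y(2) by blast
    then obtain j where j: "j \<in> {1..n}" "h1 (z l) = y j" by blast
    then have "c j = l" using c[OF j(1)] inj_onD[OF winj, of "c j" l] l by auto
    then show "l \<in> c ` {1..n}" using j by blast
  qed (use c in auto)
  have \<sigma>in: "\<sigma> i \<in> {1..n}" "\<tau> i \<in> {1..n}" if "i \<in> {1..n}" for i
    using \<sigma>\<tau> that by (simp_all only: permutes_in_image)
  show ?thesis unfolding order_data_def X
  proof (rule conjI[OF \<sigma>\<tau>(1) conjI[OF \<sigma>\<tau>(2)]], rule exI[of _ "\<lambda>i. z' (a i)"], rule exI[of _ "\<lambda>j. k1 (z' (c j))"], intro conjI ballI)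
    show "strict_mono_on {1..n} (\<lambda>i. z' (a i))"
    proof (rule strict_mono_onI)
      fix i j assume "i \<in> {1..n}" "j \<in> {1..n}" "i < j"
      then show "z' (a i) < z' (a j)"
        using strict_mono_onD[OF x(1), of i j] a[of i] a[of j] ord1[of "a i" "a j"] by (simp add: z_def z'_def)
    qed
    show "strict_mono_on {1..n} (\<lambda>j. k1 (z' (c j)))"
    proof (rule strict_mono_onI)
      fix i j assume "i \<in> {1..n}" "j \<in> {1..n}" "i < j"
      then show "k1 (z' (c i)) < k1 (z' (c j))"
        using strict_mono_onD[OF y(1), of i j] c[of i] c[of j] ord2[of "c i" "c j"] by (simp add: z_def z'_def)
    qed
    have "(\<lambda>i. z' (a i)) ` {1..n} = z' ` a ` {1..n}" by (simp only: image_image)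
    then show "(\<lambda>i. z' (a i)) ` {1..n} = z' ` {..<n}" unfolding a_im .
    have "(\<lambda>j. k1 (z' (c j))) ` {1..n} = k1 ` z' ` c ` {1..n}" by (simp only: image_image)
    then show "(\<lambda>j. k1 (z' (c j))) ` {1..n} = k1 ` z' ` {..<n}" unfolding c_im .
  next
    fix i assume i: "i \<in> {1..n}"
    have "h1 (z (a i)) = h1 (z (c (\<sigma> i)))" using a[OF i] c[OF \<sigma>in(1)[OF i]] h1[OF i] by simp
    then have "a i = c (\<sigma> i)" using inj_onD[OF winj, of "a i" "c (\<sigma> i)"] a[OF i] c[OF \<sigma>in(1)[OF i]] by simp
    then show "k1 (z' (a i)) = k1 (z' (c (\<sigma> i)))" by simp
  next
    fix j assume j: "j \<in> {1..n}"
    have "z (Suc (c j) mod n) = z (a (\<tau> j))"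
      unfolding zmod zS using a[OF \<sigma>in(2)[OF j]] c[OF j] h2[OF j] by simp
    then have "Suc (c j) mod n = a (\<tau> j)"
      using inj_onD[OF zinj, of "Suc (c j) mod n" "a (\<tau> j)"] a[OF \<sigma>in(2)[OF j]] c[OF j] by simp
    then show "k2 (k1 (z' (c j))) = z' (a (\<tau> j))" using zmod(2)[of "Suc (c j)"] zS(2) by simp
  qed
qed

lemma finite_strict_enumeration:
  fixes X :: "real set"
  assumes "finite X" "card X = n"
  obtains x where "strict_mono_on {1..n} x" "bij_betw x {1..n} X"
proof -
  let ?xs = "sorted_list_of_set X"
  define x where "x i = ?xs ! (i - 1)" for i :: nat
  have len: "length ?xs = n" "set ?xs = X" "sorted_wrt (<) ?xs" using assms by simp_all
  have mono: "strict_mono_on {1..n} x"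
    by (rule strict_mono_onI) (use len sorted_wrt_nth_less[OF len(3)] in \<open>auto simp: x_def\<close>)
  moreover have "x ` {1..n} = X"
  proof (intro equalityI subsetI)
    fix t assume "t \<in> X"
    then obtain l where "l < n" "?xs ! l = t" using len by (metis in_set_conv_nth)
    then show "t \<in> x ` {1..n}" by (intro image_eqI[of _ _ "Suc l"]) (auto simp: x_def)
  next
    fix t assume "t \<in> x ` {1..n}"
    then obtain i where i: "i \<in> {1..n}" "t = ?xs ! (i - 1)" unfolding x_def by blast
    then have "i - 1 < length ?xs" unfolding len(1) by auto
    from nth_mem[OF this] show "t \<in> X" unfolding i(2) len(2) .
  qed
  ultimately show ?thesis using that strict_mono_on_imp_inj_on by (metis bij_betw_def)
qed

lemma exists_order_data:
  fixes h1 h2 :: "real \<Rightarrow> real"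
  assumes per: "has_period (h2 \<circ> h1) n u"
  shows "\<exists>\<sigma> \<tau>. order_data h1 h2 (forward_orbit (h2 \<circ> h1) u) (h1 ` forward_orbit (h2 \<circ> h1) u) n \<sigma> \<tau>"
proof -
  let ?z = "\<lambda>l. ((h2 \<circ> h1) ^^ l) u"
  let ?X = "forward_orbit (h2 \<circ> h1) u"
  have X: "?X = ?z ` {..<n}" by (rule has_period_orbit(2)[OF per])
  have Y: "h1 ` ?X = (\<lambda>l. h1 (?z l)) ` {..<n}" unfolding X by (simp only: image_image)
  have card: "card ?X = n" "card (h1 ` ?X) = n"
    unfolding Y unfolding X using card_image[OF has_period_orbit(1)[OF per]] card_image[OF has_period_image_inj[OF per]] by simp_all
  have fin: "finite ?X" unfolding X by simp
  have bij1: "bij_betw h1 ?X (h1 ` ?X)" using fin card by (intro bij_betw_imageI eq_card_imp_inj_on) auto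
  have im2: "h2 ` h1 ` ?X = ?X"
  proof (intro equalityI subsetI)
    fix t assume "t \<in> h2 ` h1 ` ?X"
    then obtain l where "t = h2 (h1 (?z l))" by (auto simp: forward_orbit_def)
    then have "t = ?z (Suc l)" by simp
    then show "t \<in> ?X" unfolding forward_orbit_def by blast
  next
    fix t assume "t \<in> ?X"
    then obtain l where "t = ?z l" by (auto simp: forward_orbit_def)
    moreover have "?z (l + n) = ?z l"
      using has_period_orbit(3)[OF per, of "l + n"] has_period_orbit(3)[OF per, of l] by simp
    moreover obtain m where "l + n = Suc m" using per by (cases "l + n") (auto simp: has_period_def)
    ultimately have "t = h2 (h1 (?z m))" by simp
    then show "t \<in> h2 ` h1 ` ?X" unfolding forward_orbit_def by blast
  qed
  have bij2: "bij_betw h2 (h1 ` ?X) ?X"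
    using fin card im2 by (intro bij_betw_imageI eq_card_imp_inj_on) auto
  obtain x where x: "strict_mono_on {1..n} x" "bij_betw x {1..n} ?X" using finite_strict_enumeration[OF fin card(1)] .
  obtain y where y: "strict_mono_on {1..n} y" "bij_betw y {1..n} (h1 ` ?X)"
    using finite_strict_enumeration[OF finite_imageI[OF fin] card(2)] .
  define \<sigma> where "\<sigma> i = (if i \<in> {1..n} then inv_into {1..n} y (h1 (x i)) else i)" for i
  define \<tau> where "\<tau> j = (if j \<in> {1..n} then inv_into {1..n} x (h2 (y j)) else j)" for j
  have "bij_betw (inv_into {1..n} y \<circ> (h1 \<circ> x)) {1..n} {1..n}"
    by (rule bij_betw_trans[OF bij_betw_trans[OF x(2) bij1] bij_betw_inv_into[OF y(2)]])
  then have "bij_betw \<sigma> {1..n} {1..n}" by (subst bij_betw_cong[where g = "inv_into {1..n} y \<circ> (h1 \<circ> x)"]) (auto simp: \<sigma>_def)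
  then have s: "\<sigma> permutes {1..n}" by (rule bij_imp_permutes) (auto simp: \<sigma>_def)
  have "bij_betw (inv_into {1..n} x \<circ> (h2 \<circ> y)) {1..n} {1..n}"
    by (rule bij_betw_trans[OF bij_betw_trans[OF y(2) bij2] bij_betw_inv_into[OF x(2)]])
  then have "bij_betw \<tau> {1..n} {1..n}" by (subst bij_betw_cong[where g = "inv_into {1..n} x \<circ> (h2 \<circ> y)"]) (auto simp: \<tau>_def)
  then have t: "\<tau> permutes {1..n}" by (rule bij_imp_permutes) (auto simp: \<tau>_def)
  have "h1 (x i) = y (\<sigma> i)" if "i \<in> {1..n}" for i
  proof -
    have "x i \<in> ?X" by (rule bij_betw_apply[OF x(2) that])
    then have "h1 (x i) \<in> y ` {1..n}" using bij_betw_imp_surj_on[OF y(2)] by blast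
    then show ?thesis using that by (simp add: \<sigma>_def f_inv_into_f)
  qed
  moreover have "h2 (y j) = x (\<tau> j)" if "j \<in> {1..n}" for j
  proof -
    have "y j \<in> h1 ` ?X" by (rule bij_betw_apply[OF y(2) that])
    then have "h2 (y j) \<in> x ` {1..n}" using bij_betw_imp_surj_on[OF x(2)] im2 by blast
    then show ?thesis using that by (simp add: \<tau>_def f_inv_into_f)
  qed
  moreover have "x ` {1..n} = ?X" "y ` {1..n} = h1 ` ?X" using x(2) y(2) by (simp_all add: bij_betw_imp_surj_on)
  ultimately have "order_data h1 h2 ?X (h1 ` ?X) n \<sigma> \<tau>"
    unfolding order_data_def by (intro conjI exI[of _ x] exI[of _ y] ballI s t x(1) y(1))
  then show ?thesis by blast
qed

lemma order_data_swap: "order_data h1 h2 X Y n \<sigma> \<tau> \<longleftrightarrow> order_data h2 h1 Y X n \<tau> \<sigma>"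
  unfolding order_data_def by blast

lemma periodic_right_swap: "periodic_right h1 h2 n \<sigma> \<tau> y \<longleftrightarrow> periodic_left h2 h1 n \<tau> \<sigma> y"
  unfolding periodic_right_def periodic_left_def by (subst order_data_swap) simp

lemma funpow_alternate: "((h2 \<circ> h1) ^^ l) (h2 y) = h2 (((h1 \<circ> h2) ^^ l) y)"
  by (induction l) auto

lemma funpow_alternate_Suc: "h1 (((h2 \<circ> h1) ^^ l) (h2 y)) = ((h1 \<circ> h2) ^^ Suc l) y"
  by (simp only: funpow_alternate) simp

text \<open>
  Shifting the starting point from \<open>I\<^sub>2\<close> to its image in \<open>I\<^sub>1\<close> keeps the orbit and hence the order-data.
\<close>

lemma periodic_right_imp_left:
  assumes "periodic_right h1 h2 n \<sigma> \<tau> y"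
  shows "periodic_left h1 h2 n \<sigma> \<tau> (h2 y)"
proof -
  have per: "has_period (h1 \<circ> h2) n y" using assms by (simp add: periodic_right_def)
  then have n: "0 < n" "((h1 \<circ> h2) ^^ n) y = y" "\<And>m. 0 < m \<Longrightarrow> m < n \<Longrightarrow> ((h1 \<circ> h2) ^^ m) y \<noteq> y"
    by (auto simp: has_period_def)
  have "((h2 \<circ> h1) ^^ m) (h2 y) \<noteq> h2 y" if m: "0 < m" "m < n" for m
  proof
    assume eq: "((h2 \<circ> h1) ^^ m) (h2 y) = h2 y"
    then have "((h1 \<circ> h2) ^^ Suc m) y = (h1 \<circ> h2) y" using funpow_alternate_Suc[where ?h1.0 = h1 and ?h2.0 = h2 and l = m and y = y] by simp
    then have eq': "((h1 \<circ> h2) ^^ (n - 1)) (((h1 \<circ> h2) ^^ Suc m) y) = ((h1 \<circ> h2) ^^ (n - 1)) ((h1 \<circ> h2) y)" by simp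
    have "((h1 \<circ> h2) ^^ (n - 1 + Suc m)) y = ((h1 \<circ> h2) ^^ (n - 1)) (((h1 \<circ> h2) ^^ Suc m) y)"
      by (simp only: funpow_add o_apply)
    also note eq'
    also have "((h1 \<circ> h2) ^^ (n - 1)) ((h1 \<circ> h2) y) = ((h1 \<circ> h2) ^^ Suc (n - 1)) y"
      by (simp only: funpow_Suc_right o_apply)
    also have "\<dots> = y" using n by simp
    finally have "((h1 \<circ> h2) ^^ (m + n)) y = y" using n by (simp add: add.commute)
    then show False using n m by (simp add: funpow_add)
  qed
  then have "has_period (h2 \<circ> h1) n (h2 y)" using n by (simp add: has_period_def funpow_alternate)
  moreover have orb: "forward_orbit (h2 \<circ> h1) (h2 y) = h2 ` forward_orbit (h1 \<circ> h2) y"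
    unfolding forward_orbit_def image_image funpow_alternate ..
  moreover have "h1 ` h2 ` forward_orbit (h1 \<circ> h2) y = forward_orbit (h1 \<circ> h2) y"
  proof (intro equalityI subsetI)
    fix t assume "t \<in> h1 ` h2 ` forward_orbit (h1 \<circ> h2) y"
    then obtain l where "t = ((h1 \<circ> h2) ^^ Suc l) y" by (auto simp: forward_orbit_def)
    then show "t \<in> forward_orbit (h1 \<circ> h2) y" unfolding forward_orbit_def by blast
  next
    fix t assume "t \<in> forward_orbit (h1 \<circ> h2) y"
    then obtain l where "t = ((h1 \<circ> h2) ^^ l) y" by (auto simp: forward_orbit_def)
    then have t: "t = ((h1 \<circ> h2) ^^ (l + n)) y" using n by (simp add: funpow_add)
    obtain m where "l + n = Suc m" using n by (cases "l + n") auto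
    then have "t = h1 (h2 (((h1 \<circ> h2) ^^ m) y))" using t by simp
    then show "t \<in> h1 ` h2 ` forward_orbit (h1 \<circ> h2) y" unfolding forward_orbit_def by blast
  qed
  ultimately show ?thesis using assms by (simp add: periodic_left_def periodic_right_def)
qed

lemma periodic_left_cong:
  assumes pl: "periodic_left h1 h2 n \<sigma> \<tau> u"
    and k1: "\<And>t. t \<in> forward_orbit (h2 \<circ> h1) u \<Longrightarrow> k1 t = h1 t"
    and k2: "\<And>t. t \<in> h1 ` forward_orbit (h2 \<circ> h1) u \<Longrightarrow> k2 t = h2 t"
  shows "periodic_left k1 k2 n \<sigma> \<tau> u"
proof -
  have eq: "((k2 \<circ> k1) ^^ l) u = ((h2 \<circ> h1) ^^ l) u" for l
  proof (induction l)
    case (Suc l)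
    have t: "((h2 \<circ> h1) ^^ l) u \<in> forward_orbit (h2 \<circ> h1) u" by (auto simp: forward_orbit_def)
    have "((k2 \<circ> k1) ^^ Suc l) u = k2 (k1 (((h2 \<circ> h1) ^^ l) u))" unfolding Suc[symmetric] by (simp only: funpow.simps o_apply)
    also have "\<dots> = ((h2 \<circ> h1) ^^ Suc l) u" unfolding k1[OF t] k2[OF imageI[OF t]] by (simp only: funpow.simps o_apply)
    finally show ?case .
  qed simp
  have per: "has_period (k2 \<circ> k1) n u" using pl by (simp add: periodic_left_def has_period_def eq)
  have k1': "k1 (((h2 \<circ> h1) ^^ l) u) = h1 (((h2 \<circ> h1) ^^ l) u)" for l using k1 by (auto simp: forward_orbit_def)
  have "order_data k1 k2 (forward_orbit (k2 \<circ> k1) u) (k1 ` forward_orbit (k2 \<circ> k1) u) n \<sigma> \<tau>"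
    by (rule order_data_transfer[where ?h1.0 = h1 and ?h2.0 = h2 and u = u]) (use pl per in \<open>auto simp: periodic_left_def eq k1' simp del: comp_apply\<close>)
  then show ?thesis using per by (simp add: periodic_left_def)
qed

section \<open>Periodic critical points lie on bones\<close>

lemma unimodal_quadratic:
  assumes "0 < v" "v \<le> 1"
  shows "unimodal (quadratic v)"
proof -
  have p: "(v, v) \<in> param_space" using assms by (simp add: param_space_def)
  interpret symmetric_pair "maps quadratic (v, v)" by (rule symmetric_pair_quadratic[OF p])
  have q: "maps quadratic (v, v) b = quadratic v" for b by (simp add: maps_def fun_eq_iff)
  have diff: "quadratic v y - quadratic v x = 4 * v * ((y - x) * (1 - x - y))" for x y
    by (simp add: quadratic_def algebra_simps)
  have "strict_mono_on {0<..<1/2} (quadratic v)"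
  proof (rule strict_mono_onI)
    fix x y :: real assume "x \<in> {0<..<1/2}" "y \<in> {0<..<1/2}" "x < y"
    then have "0 < 4 * v * ((y - x) * (1 - x - y))" using assms by (intro mult_pos_pos) auto
    then show "quadratic v x < quadratic v y" using diff[of y x] by linarith
  qed
  moreover have "strict_antimono_on {1/2<..<1} (quadratic v)"
  proof (rule monotone_onI)
    fix x y :: real assume "x \<in> {1/2<..<1}" "y \<in> {1/2<..<1}" "x < y"
    then have "0 < 4 * v * ((y - x) * (x + y - 1))" using assms by (intro mult_pos_pos) auto
    moreover have "4 * v * ((y - x) * (x + y - 1)) = - (quadratic v y - quadratic v x)" unfolding diff by (simp add: algebra_simps)
    ultimately show "quadratic v y < quadratic v x" by linarith
  qed
  ultimately show ?thesis unfolding unimodal_def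
    using h_cont[of False] h_range[of _ False] h_zero[of False] h_one[of False] unfolding q
    by (intro conjI exI[of _ "1/2"]) (auto simp del: atLeastAtMost_iff)
qed

text \<open>
  A stunted tent map has a plateau and is not unimodal in the strict sense. Replacing the plateau by
  a shallow roof of slope \<open>s\<close> with ridge at \<open>a\<close> changes only values above \<open>v - s\<close>.
\<close>

lemma unimodal_min_tent:
  assumes "0 < v" "v \<le> 1" "v / 2 \<le> a" "a \<le> 1 - v / 2" "0 < s" "s \<le> v"
  shows "unimodal (\<lambda>x. min (min (2 * x) (2 - 2 * x)) (v - s * \<bar>x - a\<bar>))"
proof -
  have a: "0 < a" "a < 1" using assms by auto
  have sa: "s * \<bar>x - a\<bar> \<le> v" if "x \<in> {0..1}" for x
  proof -
    have "s * \<bar>x - a\<bar> \<le> v * 1" using that a assms by (intro mult_mono) auto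
    then show ?thesis by simp
  qed
  have incr: "min (min (2 * x) (2 - 2 * x)) (v - s * \<bar>x - a\<bar>) < min (min (2 * y) (2 - 2 * y)) (v - s * \<bar>y - a\<bar>)"
    if xy: "0 < x" "x < y" "y < a" for x y
  proof -
    have "s * \<bar>y - a\<bar> < s * \<bar>x - a\<bar>" using xy assms by (intro mult_strict_left_mono) auto
    moreover have "v < 2 - 2 * y" using xy assms by linarith
    moreover have "0 \<le> s * \<bar>y - a\<bar>" using assms by simp
    ultimately show ?thesis using xy by (auto simp: min_def)
  qed
  have decr: "min (min (2 * y) (2 - 2 * y)) (v - s * \<bar>y - a\<bar>) < min (min (2 * x) (2 - 2 * x)) (v - s * \<bar>x - a\<bar>)"
    if xy: "a < x" "x < y" "y < 1" for x y
  proof -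
    have "s * \<bar>x - a\<bar> < s * \<bar>y - a\<bar>" using xy assms by (intro mult_strict_left_mono) auto
    moreover have "v < 2 * x" using xy assms by linarith
    moreover have "0 \<le> s * \<bar>x - a\<bar>" using assms by simp
    ultimately show ?thesis using xy by (auto simp: min_def)
  qed
  show ?thesis unfolding unimodal_def
  proof (intro conjI exI[of _ a] a)
    show "continuous_on {0..1} (\<lambda>x. min (min (2 * x) (2 - 2 * x)) (v - s * \<bar>x - a\<bar>))" by (intro continuous_intros)
    show "(\<lambda>x. min (min (2 * x) (2 - 2 * x)) (v - s * \<bar>x - a\<bar>)) ` {0..1} \<subseteq> {0..1}"
    proof
      fix t assume "t \<in> (\<lambda>x. min (min (2 * x) (2 - 2 * x)) (v - s * \<bar>x - a\<bar>)) ` {0..1}"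
      then obtain x where x: "x \<in> {0..1}" "t = min (min (2 * x) (2 - 2 * x)) (v - s * \<bar>x - a\<bar>)" by blast
      have "0 \<le> s * \<bar>x - a\<bar>" using assms by simp
      then show "t \<in> {0..1}" using sa[OF x(1)] x assms by (auto simp: min_def)
    qed
    show "min (min (2 * 0) (2 - 2 * 0)) (v - s * \<bar>0 - a\<bar>) = 0" using sa[of 0] by (auto simp: min_def)
    show "min (min (2 * 1) (2 - 2 * 1)) (v - s * \<bar>1 - a\<bar>) = 0" using sa[of 1] by (auto simp: min_def)
    show "strict_mono_on {0<..<a} (\<lambda>x. min (min (2 * x) (2 - 2 * x)) (v - s * \<bar>x - a\<bar>))"
      using incr by (intro strict_mono_onI) auto
    show "strict_antimono_on {a<..<1} (\<lambda>x. min (min (2 * x) (2 - 2 * x)) (v - s * \<bar>x - a\<bar>))"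
      using decr by (intro monotone_onI) auto
  qed
qed

text \<open>
  A periodic orbit visits the plateau at most once, because the map is injective on it. The ridge of the
  roof is placed at that visit, with slope small enough to leave the other points below the roof.
\<close>

lemma unimodal_through_stunted:
  assumes v: "0 < v" "v \<le> 1" and X: "finite X" "X \<subseteq> {0..1}" "inj_on (stunted_tent v) X"
  obtains u where "unimodal u" "\<And>x. x \<in> X \<Longrightarrow> u x = stunted_tent v x"
proof (cases "\<exists>a\<in>X. v / 2 \<le> a \<and> a \<le> 1 - v / 2")
  case True
  then obtain a where a: "a \<in> X" "v / 2 \<le> a" "a \<le> 1 - v / 2" by blast
  have sa: "stunted_tent v a = v" using a v by (auto simp: stunted_tent_min min_def)
  define G where "G = insert v ((\<lambda>x. v - min (2 * x) (2 - 2 * x)) ` (X - {a}))"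
  have G: "finite G" "G \<noteq> {}" using X by (auto simp: G_def)
  have low: "min (2 * x) (2 - 2 * x) < v" if "x \<in> X - {a}" for x
  proof (rule ccontr)
    assume "\<not> ?thesis"
    then have "stunted_tent v x = v" using v by (auto simp: stunted_tent_min min_def)
    then show False using inj_onD[OF X(3), of x a] sa that a by auto
  qed
  have Gpos: "\<forall>g\<in>G. 0 < g" using low v by (auto simp: G_def)
  define s where "s = Min G"
  have s: "0 < s" "s \<le> v" using G Gpos by (auto simp: s_def) (simp add: G_def)
  show ?thesis
  proof (rule that[OF unimodal_min_tent[OF v a(2,3) s]])
    fix x assume x: "x \<in> X"
    show "min (min (2 * x) (2 - 2 * x)) (v - s * \<bar>x - a\<bar>) = stunted_tent v x"
    proof (cases "x = a")
      case True
      then show ?thesis using a v by (auto simp: stunted_tent_min min_def)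
    next
      case False
      then have xa: "x \<in> X - {a}" using x by simp
      then have "v - min (2 * x) (2 - 2 * x) \<in> G" by (auto simp: G_def)
      then have "s \<le> v - min (2 * x) (2 - 2 * x)" unfolding s_def by (rule Min_le[OF G(1)])
      moreover have "x \<in> {0..1}" "a \<in> {0..1}" using X(2) a(1) x by blast+
      then have "s * \<bar>x - a\<bar> \<le> s * 1" using s by (intro mult_left_mono) auto
      ultimately have "min (2 * x) (2 - 2 * x) \<le> v - s * \<bar>x - a\<bar>" by linarith
      moreover have "stunted_tent v x = min (2 * x) (2 - 2 * x)" using low[OF xa] v by (simp add: stunted_tent_min)
      ultimately show ?thesis by simp
    qed
  qed
next
  case False
  have "unimodal (\<lambda>x. min (min (2 * x) (2 - 2 * x)) (1 - 1 * \<bar>x - 1/2\<bar>))" by (rule unimodal_min_tent) auto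
  then show ?thesis
  proof (rule that)
    fix x assume "x \<in> X"
    then have "\<not> (v / 2 \<le> x \<and> x \<le> 1 - v / 2)" "x \<in> {0..1}" using False X by auto
    then show "min (min (2 * x) (2 - 2 * x)) (1 - 1 * \<bar>x - 1/2\<bar>) = stunted_tent v x"
      using v by (auto simp: stunted_tent_min min_def abs_if)
  qed
qed

lemma unimodal_through:
  assumes fam: "fam = stunted_tent \<or> fam = quadratic" and v: "0 < v" "v \<le> 1"
    and X: "finite X" "X \<subseteq> {0..1}" "inj_on (fam v) X"
  obtains u where "unimodal u" "\<And>x. x \<in> X \<Longrightarrow> u x = fam v x"
  using fam
proof
  assume "fam = stunted_tent"
  then show ?thesis using unimodal_through_stunted[OF v X(1,2)] X(3) that by blast
next
  assume "fam = quadratic"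
  then show ?thesis using unimodal_quadratic[OF v] that by blast
qed

lemma admissible_of_periodic:
  assumes fam: "fam = stunted_tent \<or> fam = quadratic" and p: "p \<in> param_space" "0 < fst p" "0 < snd p"
    and x: "x \<in> {0..1}" and pl: "periodic_left (fam (fst p)) (fam (snd p)) n \<sigma> \<tau> x"
  shows "admissible n \<sigma> \<tau>"
proof -
  interpret F: pair_family param_space "maps fam" by (rule pair_family_maps[OF fam])
  interpret symmetric_pair "maps fam p" by (rule F.sym[OF p(1)])
  have m: "fam (fst p) = maps fam p False" "fam (snd p) = maps fam p True" by (simp_all add: maps_def)
  let ?h1 = "fam (fst p)" and ?h2 = "fam (snd p)"
  let ?X = "forward_orbit (?h2 \<circ> ?h1) x"
  have per: "has_period (?h2 \<circ> ?h1) n x" using pl by (simp add: periodic_left_def)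
  have le1: "fst p \<le> 1" "snd p \<le> 1" using p by (auto simp: param_space_def)
  have "((?h2 \<circ> ?h1) ^^ l) x \<in> {0..1}" for l
    using orb_range[OF x, of False "2 * l"] unfolding orb_funpow m by simp
  then have X01: "?X \<subseteq> {0..1}" by (auto simp: forward_orbit_def)
  then have Y01: "?h1 ` ?X \<subseteq> {0..1}" unfolding m using h_range by blast
  have Xeq: "?X = (\<lambda>l. ((?h2 \<circ> ?h1) ^^ l) x) ` {..<n}" by (rule has_period_orbit(2)[OF per])
  have fin: "finite ?X" unfolding Xeq by simp
  have card: "card ?X = n" unfolding Xeq using card_image[OF has_period_orbit(1)[OF per]] by simp
  have "card (?h1 ` ?X) = n"
    unfolding Xeq image_image using card_image[OF has_period_image_inj[OF per]] by simp
  then have inj1: "inj_on ?h1 ?X" using fin card by (intro eq_card_imp_inj_on) auto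
  have inj2: "inj_on ?h2 (?h1 ` ?X)"
  proof (rule inj_on_imageI)
    show "inj_on (?h2 \<circ> ?h1) ?X"
    proof (rule inj_onI)
      fix s t assume "s \<in> ?X" "t \<in> ?X" "(?h2 \<circ> ?h1) s = (?h2 \<circ> ?h1) t"
      then obtain l k where lk: "l < n" "k < n" "s = ((?h2 \<circ> ?h1) ^^ l) x" "t = ((?h2 \<circ> ?h1) ^^ k) x"
        "((?h2 \<circ> ?h1) ^^ Suc l) x = ((?h2 \<circ> ?h1) ^^ Suc k) x" unfolding Xeq by auto
      have "((?h2 \<circ> ?h1) ^^ (Suc l mod n)) x = ((?h2 \<circ> ?h1) ^^ (Suc k mod n)) x"
        using lk(5) by (simp only: has_period_orbit(3)[OF per])
      then have "Suc l mod n = Suc k mod n"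
        using inj_onD[OF has_period_orbit(1)[OF per], of "Suc l mod n" "Suc k mod n"] lk(1,2) by simp
      then show "s = t" using lk by (auto simp: mod_Suc split: if_splits)
    qed
  qed
  obtain u1 where u1: "unimodal u1" "\<And>t. t \<in> ?X \<Longrightarrow> u1 t = ?h1 t"
    by (rule unimodal_through[OF fam p(2) le1(1) fin X01 inj1]) (rule that, assumption, blast)
  obtain u2 where u2: "unimodal u2" "\<And>t. t \<in> ?h1 ` ?X \<Longrightarrow> u2 t = ?h2 t"
    by (rule unimodal_through[OF fam p(3) le1(2) finite_imageI[OF fin] Y01 inj2]) (rule that, assumption, blast)
  have "periodic_left u1 u2 n \<sigma> \<tau> x" by (rule periodic_left_cong[OF pl u1(2) u2(2)])
  then show ?thesis unfolding admissible_def using u1(1) u2(1) x by blast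
qed

text \<open>
  Both parameters are positive, since otherwise the orbit would end in the fixed point \<open>0\<close>; the order-data are
  then realised by strictly unimodal maps.
\<close>

lemma periodic_imp_bone:
  assumes fam: "fam = stunted_tent \<or> fam = quadratic" and p: "p \<in> param_space"
    and per: "0 < k" "orb (maps fam p) b (2 * k) (1/2) = 1/2" and k: "k \<le> n"
  obtains B m where "B \<in> bones fam n" "p \<in> B" "0 < m" "\<And>q. q \<in> B \<Longrightarrow> orb (maps fam q) b (2 * m) (1/2) = 1/2"
proof -
  interpret F: pair_family param_space "maps fam" by (rule pair_family_maps[OF fam])
  interpret symmetric_pair "maps fam p" by (rule F.sym[OF p])
  define m where "m = (LEAST m. 0 < m \<and> orb (maps fam p) b (2 * m) (1/2) = 1/2)"
  have m: "0 < m" "orb (maps fam p) b (2 * m) (1/2) = 1/2"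
    using LeastI[of "\<lambda>m. 0 < m \<and> orb (maps fam p) b (2 * m) (1/2) = 1/2" k] per unfolding m_def by auto
  have mk: "m \<le> k" unfolding m_def by (rule Least_le) (use per in simp)
  have least: "orb (maps fam p) b (2 * j) (1/2) \<noteq> 1/2" if "0 < j" "j < m" for j
    using not_less_Least[of j "\<lambda>m. 0 < m \<and> orb (maps fam p) b (2 * m) (1/2) = 1/2"] that unfolding m_def by auto
  have hp: "has_period (maps fam p (\<not> b) \<circ> maps fam p b) m (1/2)"
    unfolding has_period_def orb_funpow[symmetric] using m least by blast
  have pos: "0 < (if c then snd p else fst p)" for c
  proof (rule ccontr)
    assume "\<not> ?thesis"
    then have c0: "(if c then snd p else fst p) = 0" using param_coord[OF p, of c] by auto
    have zero: "maps fam p c x = 0" if "x \<in> {0..1}" for x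
      using fam that unfolding maps_def c0 by (auto simp: stunted_tent_min quadratic_def min_def)
    have j: "2 * m = 2 * (m - 1) + 2" "even (2 * (m - 1))" using m(1) by auto
    let ?y = "orb (maps fam p) b (2 * (m - 1)) (1/2)"
    have y: "?y \<in> {0..1}" by (rule orb_range) simp
    have "orb (maps fam p) b (2 * m) (1/2) = maps fam p (\<not> b) (maps fam p b ?y)"
      by (subst j(1), subst orb_even_add[OF j(2)]) (simp add: orb_two)
    also have "\<dots> = 0"
    proof (cases "c = b")
      case True
      then show ?thesis using zero[OF y] h_zero by simp
    next
      case False
      then have "c = (\<not> b)" by auto
      then show ?thesis using zero[OF h_range[OF y]] by simp
    qed
    finally show False using m(2) by simp
  qed
  have pos': "0 < fst p" "0 < snd p" using pos[of False] pos[of True] by auto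
  obtain \<sigma> \<tau> where od: "order_data (maps fam p b) (maps fam p (\<not> b)) (forward_orbit (maps fam p (\<not> b) \<circ> maps fam p b) (1/2))
      (maps fam p b ` forward_orbit (maps fam p (\<not> b) \<circ> maps fam p b) (1/2)) m \<sigma> \<tau>"
    using exists_order_data[OF hp] by blast
  have pl: "periodic_left (maps fam p b) (maps fam p (\<not> b)) m \<sigma> \<tau> (1/2)" using hp od by (simp add: periodic_left_def)
  show ?thesis
  proof (cases b)
    case False
    have adm: "admissible m \<sigma> \<tau>"
      by (rule admissible_of_periodic[OF fam p pos', of "1/2"]) (use pl False in \<open>simp_all add: maps_def\<close>)
    show ?thesis
    proof (rule that[of "left_bone fam m \<sigma> \<tau>" m])
      show "left_bone fam m \<sigma> \<tau> \<in> bones fam n" unfolding bones_def using adm m mk k by fastforce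
      show "p \<in> left_bone fam m \<sigma> \<tau>" using pl False p by (simp add: left_bone_def maps_def)
      fix q assume "q \<in> left_bone fam m \<sigma> \<tau>"
      then have "((maps fam q True \<circ> maps fam q False) ^^ m) (1/2) = 1/2"
        by (simp add: left_bone_def periodic_left_def has_period_def maps_def)
      then show "orb (maps fam q) b (2 * m) (1/2) = 1/2" using False by (simp add: orb_funpow)
    qed (rule m)
  next
    case True
    have pr: "periodic_right (fam (fst p)) (fam (snd p)) m \<tau> \<sigma> (1/2)"
      using pl True by (simp add: periodic_right_swap maps_def)
    have "fam (snd p) (1/2) \<in> {0..1}" using h_range[of "1/2" True] by (simp add: maps_def)
    then have adm: "admissible m \<tau> \<sigma>"
      by (rule admissible_of_periodic[OF fam p pos' _ periodic_right_imp_left[OF pr]])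
    show ?thesis
    proof (rule that[of "right_bone fam m \<tau> \<sigma>" m])
      show "right_bone fam m \<tau> \<sigma> \<in> bones fam n" unfolding bones_def using adm m mk k by fastforce
      show "p \<in> right_bone fam m \<tau> \<sigma>" using pr p by (simp add: right_bone_def)
      fix q assume "q \<in> right_bone fam m \<tau> \<sigma>"
      then have "((maps fam q False \<circ> maps fam q True) ^^ m) (1/2) = 1/2"
        by (simp add: right_bone_def periodic_right_def has_period_def maps_def)
      then show "orb (maps fam q) b (2 * m) (1/2) = 1/2" using True by (simp add: orb_funpow)
    qed (rule m)
  qed
qed

section \<open>Bones and cells\<close>

lemma exists_local_traps:
  assumes "fam = stunted_tent \<or> fam = quadratic" "p \<in> param_space"
  shows "\<exists>d. local_traps param_space (maps fam) p d"
  using assms stunted_local_traps quadratic_local_traps by blast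

lemma closed_param_space: "closed param_space"
  unfolding param_space_def by (intro closed_Times) auto

lemma compact_param_space: "compact param_space"
  unfolding param_space_def by (intro compact_Times) auto

text \<open>
  The limit could only have a smaller period, but then the iterates of the turning point at nearby
  parameters would give a second periodic point close to it. With \<open>n\<close> distinct points in the limit,
  their order is the one at nearby parameters.
\<close>

lemma periodic_left_limit:
  assumes fam: "fam = stunted_tent \<or> fam = quadratic" and p: "p \<in> param_space"
    and q: "\<And>j. q j \<in> param_space" "q \<longlonglongrightarrow> p"
    and pl: "\<And>j. periodic_left (maps fam (q j) b) (maps fam (q j) (\<not> b)) n \<sigma> \<tau> (1/2)"
  shows "periodic_left (maps fam p b) (maps fam p (\<not> b)) n \<sigma> \<tau> (1/2)"
proof -
  interpret F: pair_family param_space "maps fam" by (rule pair_family_maps[OF fam])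
  obtain d where d: "local_traps param_space (maps fam) p d" using exists_local_traps[OF fam p] by blast
  let ?o = "\<lambda>p i. orb (maps fam p) b i (1/2)"
  let ?f = "\<lambda>p. maps fam p (\<not> b) \<circ> maps fam p b"
  have lim: "(\<lambda>j. ?o (q j) i) \<longlonglongrightarrow> ?o p i" for i
    by (rule F.orb_tendsto[OF p _ q(2) tendsto_const q(1)]) auto
  have z: "(?f p ^^ l) (1/2) = ?o p (2 * l)" and w: "maps fam p b ((?f p ^^ l) (1/2)) = ?o p (Suc (2 * l))" for p l
    by (simp_all add: orb_funpow orb_Suc_right del: orb.simps(2))
  have perq: "0 < n" "?o (q j) (2 * n) = 1/2" "\<And>m. 0 < m \<Longrightarrow> m < n \<Longrightarrow> ?o (q j) (2 * m) \<noteq> 1/2" for j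
    using pl[of j] unfolding periodic_left_def has_period_def z by auto
  have fixed: "?o p (2 * n) = 1/2"
  proof (rule LIMSEQ_unique[OF lim])
    show "(\<lambda>j. ?o (q j) (2 * n)) \<longlonglongrightarrow> 1/2" unfolding perq(2) by (rule tendsto_const)
  qed
  have minimal: "?o p (2 * m) \<noteq> 1/2" if m: "0 < m" "m < n" for m
  proof
    assume eq: "?o p (2 * m) = 1/2"
    obtain r where r: "0 < r" "\<forall>\<^sub>F q in nhds p. q \<in> param_space \<longrightarrow> isolates (maps fam q) b r"
      using F.isolated_periodic[OF p d m(1) eq] by blast
    have "\<forall>\<^sub>F j in sequentially. dist (?o (q j) (2 * m)) (1/2) < r"
      using tendstoD[OF lim[of "2 * m"] r(1)] eq by simp
    with eventually_compose_filterlim[OF r(2) q(2)]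
    have "\<forall>\<^sub>F j in sequentially. False"
    proof eventually_elim
      case (elim j)
      interpret S: symmetric_pair "maps fam (q j)" by (rule F.sym[OF q(1)])
      have "?o (q j) (2 * m) \<in> {0..1}" by (rule S.orb_range) simp
      moreover have "orb (maps fam (q j)) b (2 * n) (?o (q j) (2 * m)) = ?o (q j) (2 * m)"
        using orb_even_add[of "2 * m" "maps fam (q j)" b "2 * n" "1/2"] orb_even_add[of "2 * n" "maps fam (q j)" b "2 * m" "1/2"]
          perq(2)[of j] by (simp add: add.commute)
      moreover have "\<bar>?o (q j) (2 * m) - 1/2\<bar> < r" using elim(2) by (simp add: dist_real_def)
      ultimately have "?o (q j) (2 * m) = 1/2"
        using isolatesD[OF _ _ _ r(1) perq(1) _ perq(1) perq(2)[of j]] elim(1) q(1)[of j] by blast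
      then show False using perq(3)[OF m] by blast
    qed
    then show False by simp
  qed
  have per: "has_period (?f p) n (1/2)" unfolding has_period_def z using perq(1) fixed minimal by blast
  have inj1: "inj_on (\<lambda>l. ?o p (2 * l)) {..<n}" using has_period_orbit(1)[OF per] unfolding z .
  have inj2: "inj_on (\<lambda>l. ?o p (Suc (2 * l))) {..<n}" using has_period_image_inj[OF per] unfolding w .
  have ev: "\<forall>\<^sub>F j in sequentially. \<forall>(i, i')\<in>{..2 * n} \<times> {..2 * n}. ?o p i < ?o p i' \<longrightarrow> ?o (q j) i < ?o (q j) i'"
  proof (intro eventually_ball_finite ballI, simp, clarify)
    fix i i'
    show "\<forall>\<^sub>F j in sequentially. ?o p i < ?o p i' \<longrightarrow> ?o (q j) i < ?o (q j) i'"
    proof (cases "?o p i < ?o p i'")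
      case True
      have "(\<lambda>j. ?o (q j) i' - ?o (q j) i) \<longlonglongrightarrow> ?o p i' - ?o p i" by (intro tendsto_diff lim)
      then have "\<forall>\<^sub>F j in sequentially. 0 < ?o (q j) i' - ?o (q j) i" by (rule order_tendstoD(1)) (use True in simp)
      then show ?thesis by (rule eventually_mono) simp
    qed simp
  qed
  then obtain j where j: "\<And>i i'. i \<le> 2 * n \<Longrightarrow> i' \<le> 2 * n \<Longrightarrow> ?o p i < ?o p i' \<Longrightarrow> ?o (q j) i < ?o (q j) i'"
    unfolding eventually_sequentially by fastforce
  have "order_data (maps fam p b) (maps fam p (\<not> b)) (forward_orbit (?f p) (1/2)) (maps fam p b ` forward_orbit (?f p) (1/2)) n \<sigma> \<tau>"
  proof (rule order_data_transfer[OF _ per])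
    show "has_period (?f (q j)) n (1/2)" using pl[of j] by (simp add: periodic_left_def)
    show "order_data (maps fam (q j) b) (maps fam (q j) (\<not> b)) (forward_orbit (?f (q j)) (1/2)) (maps fam (q j) b ` forward_orbit (?f (q j)) (1/2)) n \<sigma> \<tau>"
      using pl[of j] by (simp add: periodic_left_def)
    show "(?f p ^^ l) (1/2) < (?f p ^^ m) (1/2)" if "l < n" "m < n" "(?f (q j) ^^ l) (1/2) < (?f (q j) ^^ m) (1/2)" for l m
    proof -
      have lt: "?o (q j) (2 * l) < ?o (q j) (2 * m)" using that(3) unfolding z .
      then have "l \<noteq> m" by auto
      then have "?o p (2 * l) \<noteq> ?o p (2 * m)" using inj_onD[OF inj1, of l m] that by auto
      then show ?thesis unfolding z using j[of "2 * m" "2 * l"] lt that by linarith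
    qed
    show "maps fam p b ((?f p ^^ l) (1/2)) < maps fam p b ((?f p ^^ m) (1/2))"
      if "l < n" "m < n" "maps fam (q j) b ((?f (q j) ^^ l) (1/2)) < maps fam (q j) b ((?f (q j) ^^ m) (1/2))" for l m
    proof -
      have lt: "?o (q j) (Suc (2 * l)) < ?o (q j) (Suc (2 * m))" using that(3) unfolding w .
      then have "l \<noteq> m" by auto
      then have "?o p (Suc (2 * l)) \<noteq> ?o p (Suc (2 * m))" using inj_onD[OF inj2, of l m] that by auto
      then show ?thesis unfolding w using j[of "Suc (2 * m)" "Suc (2 * l)"] lt that by linarith
    qed
  qed
  then show ?thesis using per by (simp add: periodic_left_def)
qed

lemma closed_bone:
  assumes fam: "fam = stunted_tent \<or> fam = quadratic" and B: "B \<in> bones fam n"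
  shows "closed B"
proof -
  have *: "closed {p \<in> param_space. periodic_left (maps fam p b) (maps fam p (\<not> b)) k \<sigma> \<tau> (1/2)}" for b k \<sigma> \<tau>
    unfolding closed_sequential_limits
  proof (intro allI impI, elim conjE)
    fix q p assume q: "\<forall>j. q j \<in> {p \<in> param_space. periodic_left (maps fam p b) (maps fam p (\<not> b)) k \<sigma> \<tau> (1/2)}" "q \<longlonglongrightarrow> p"
    have p: "p \<in> param_space" using closed_sequentially[OF closed_param_space _ q(2)] q(1) by blast
    then show "p \<in> {p \<in> param_space. periodic_left (maps fam p b) (maps fam p (\<not> b)) k \<sigma> \<tau> (1/2)}"
      using periodic_left_limit[OF fam p _ q(2), of b k \<sigma> \<tau>] q(1) by blast
  qed
  have "left_bone fam k \<sigma> \<tau> = {p \<in> param_space. periodic_left (maps fam p False) (maps fam p (\<not> False)) k \<sigma> \<tau> (1/2)}" for k \<sigma> \<tau>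
    by (simp add: left_bone_def maps_def)
  moreover have "right_bone fam k \<sigma> \<tau> = {p \<in> param_space. periodic_left (maps fam p True) (maps fam p (\<not> True)) k \<tau> \<sigma> (1/2)}" for k \<sigma> \<tau>
    by (simp add: right_bone_def maps_def periodic_right_swap)
  ultimately have "closed (left_bone fam k \<sigma> \<tau>)" "closed (right_bone fam k \<sigma> \<tau>)" for k \<sigma> \<tau>
    using * by (simp_all only:)
  then show ?thesis using B unfolding bones_def by blast
qed

lemma finite_bones: "finite (bones fam n)"
proof -
  let ?I = "Sigma {1..n} (\<lambda>k. {\<sigma>. \<sigma> permutes {1..k}} \<times> {\<tau>. \<tau> permutes {1..k}})"
  have fin: "finite ?I" by (intro finite_SigmaI finite_cartesian_product finite_permutations) auto
  have adm: "(k, \<sigma>, \<tau>) \<in> ?I" if "1 \<le> k" "k \<le> n" "admissible k \<sigma> \<tau>" for k \<sigma> \<tau>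
    using that unfolding admissible_def periodic_left_def order_data_def by auto
  have "bones fam n \<subseteq> (\<lambda>(k, \<sigma>, \<tau>). left_bone fam k \<sigma> \<tau>) ` ?I \<union> (\<lambda>(k, \<sigma>, \<tau>). right_bone fam k \<sigma> \<tau>) ` ?I"
  proof
    fix B assume "B \<in> bones fam n"
    then consider k \<sigma> \<tau> where "B = left_bone fam k \<sigma> \<tau>" "1 \<le> k" "k \<le> n" "admissible k \<sigma> \<tau>"
      | k \<sigma> \<tau> where "B = right_bone fam k \<sigma> \<tau>" "1 \<le> k" "k \<le> n" "admissible k \<sigma> \<tau>"
      unfolding bones_def by blast
    then show "B \<in> (\<lambda>(k, \<sigma>, \<tau>). left_bone fam k \<sigma> \<tau>) ` ?I \<union> (\<lambda>(k, \<sigma>, \<tau>). right_bone fam k \<sigma> \<tau>) ` ?I"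
    proof cases
      case (1 k \<sigma> \<tau>)
      then show ?thesis using adm[OF 1(2-4)] by (intro UnI1 image_eqI[of _ _ "(k, \<sigma>, \<tau>)"]) auto
    next
      case (2 k \<sigma> \<tau>)
      then show ?thesis using adm[OF 2(2-4)] by (intro UnI2 image_eqI[of _ _ "(k, \<sigma>, \<tau>)"]) auto
    qed
  qed
  then show ?thesis by (rule finite_subset[OF _ finite_UnI[OF finite_imageI[OF fin] finite_imageI[OF fin]]])
qed

lemma bone_subset: "B \<in> bones fam n \<Longrightarrow> B \<subseteq> param_space"
  unfolding bones_def left_bone_def right_bone_def by blast

lemma frontier_subset: "frontier param_space \<subseteq> param_space"
  by (rule frontier_subset_closed[OF closed_param_space])

text \<open>
  A point of a 1-cell that lies on a bone lies neither on a second bone nor on the boundary, as it would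
  be a vertex. The finitely many closed bones therefore cut the connected cell into relatively closed
  pieces, only one of which can be non-empty.
\<close>

lemma cell_and_bones:
  assumes fam: "fam = stunted_tent \<or> fam = quadratic" and c: "c \<in> cells fam n"
  shows "connected c" "c \<subseteq> param_space" "B \<in> bones fam n \<Longrightarrow> c \<subseteq> B \<or> c \<inter> B = {}"
proof -
  have "connected c \<and> c \<subseteq> param_space \<and> (\<forall>B\<in>bones fam n. c \<subseteq> B \<or> c \<inter> B = {})"
    using c unfolding cells_def
  proof (elim UnE)
    assume "c \<in> cells0 fam n"
    then obtain p where p: "c = {p}" "p \<in> vertices fam n" by (auto simp: cells0_def)
    then have "p \<in> param_space" using bone_subset unfolding vertices_def by blast
    then show ?thesis using p by auto
  next
    assume "c \<in> cells1 fam n"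
    then have comp: "c \<in> components (skeleton fam n - vertices fam n)" by (simp add: cells1_def)
    have conn: "connected c" by (rule in_components_connected[OF comp])
    have sub: "c \<subseteq> skeleton fam n - vertices fam n" by (rule in_components_subset[OF comp])
    have "skeleton fam n \<subseteq> param_space" using bone_subset frontier_subset unfolding skeleton_def by blast
    moreover have "c \<subseteq> B" if B: "B \<in> bones fam n" "c \<inter> B \<noteq> {}" for B
    proof -
      let ?R = "\<Union> (bones fam n - {B}) \<union> frontier param_space"
      have clR: "closed ?R" using closed_bone[OF fam] finite_bones[of fam n] by (intro closed_Un closed_Union frontier_closed) auto
      have clB: "closed B" by (rule closed_bone[OF fam B(1)])
      have cov: "c \<subseteq> B \<union> ?R" using sub unfolding skeleton_def by blast
      have disj: "B \<inter> ?R \<inter> c = {}"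
      proof (rule ccontr)
        assume "B \<inter> ?R \<inter> c \<noteq> {}"
        then obtain t where t: "t \<in> c" "t \<in> B" "t \<in> ?R" by blast
        have "t \<in> vertices fam n"
        proof (cases "t \<in> frontier param_space")
          case True
          then have "t \<in> \<Union> (bones fam n) \<inter> frontier param_space" using B(1) t(2) by blast
          then show ?thesis unfolding vertices_def by (rule UnI1)
        next
          case False
          then obtain B' where "B' \<in> bones fam n" "B' \<noteq> B" "t \<in> B'" using t(3) by blast
          then have "\<exists>B\<in>bones fam n. \<exists>B'\<in>bones fam n. B \<noteq> B' \<and> t \<in> B \<inter> B'" using B(1) t(2) by blast
          then show ?thesis unfolding vertices_def by (intro UnI2 CollectI)
        qed
        then show False using sub t(1) by blast
      qed
      have "B \<inter> c = {} \<or> ?R \<inter> c = {}" by (rule connected_closedD[OF conn disj cov clB clR])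
      moreover have "B \<inter> c \<noteq> {}" using B(2) by (simp only: Int_commute not_False_eq_True)
      ultimately have "?R \<inter> c = {}" by argo
      then show ?thesis using cov by blast
    qed
    ultimately show ?thesis using conn sub by blast
  next
    assume "c \<in> cells2 fam n"
    then have comp: "c \<in> components (param_space - skeleton fam n)" by (simp add: cells2_def)
    have "c \<subseteq> param_space - skeleton fam n" by (rule in_components_subset[OF comp])
    then show ?thesis using in_components_connected[OF comp] unfolding skeleton_def by blast
  qed
  then show "connected c" "c \<subseteq> param_space" "B \<in> bones fam n \<Longrightarrow> c \<subseteq> B \<or> c \<inter> B = {}" by auto
qed

text \<open>
  A limit of negative periodic points can fail to be one only by hitting a turning point, which then is
  periodic at \<open>p\<close>. So \<open>p\<close> lies on a bone of period at most \<open>2 * k\<close>, the whole cell lies on this bone, and the turning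
  point is periodic along the cell. Being isolated, it would coincide with a point of the approximating
  orbits, which however avoid it.
\<close>

lemma neg_words_closed_in_cell:
  assumes fam: "fam = stunted_tent \<or> fam = quadratic" and c: "c \<in> cells fam n" and k: "k \<le> n"
    and q: "\<And>j. q j \<in> c" "q \<longlonglongrightarrow> p" and p: "p \<in> c" and w: "\<And>j. w \<in> neg_words (maps fam (q j)) k"
  shows "w \<in> neg_words (maps fam p) k"
proof -
  interpret F: pair_family param_space "maps fam" by (rule pair_family_maps[OF fam])
  have cP: "c \<subseteq> param_space" by (rule cell_and_bones(2)[OF fam c])
  have pP: "p \<in> param_space" and qP: "\<And>j. q j \<in> param_space" using cP p q(1) by auto
  obtain d where d: "local_traps param_space (maps fam) p d" using exists_local_traps[OF fam pP] by blast
  interpret S: symmetric_pair "maps fam p" by (rule F.sym[OF pP])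
  have len: "length w = 2 * k" "reversing w" using w[of 0] by (auto simp: neg_words_def)
  then have k0: "0 < k" by (cases k) auto
  have "\<forall>j. \<exists>x. x \<in> cyl (maps fam (q j)) side False w \<and> orb (maps fam (q j)) False (2 * k) x = x"
    using w by (auto simp: neg_words_def)
  from choice[OF this] obtain \<xi>0 where \<xi>0: "\<And>j. \<xi>0 j \<in> cyl (maps fam (q j)) side False w" "\<And>j. orb (maps fam (q j)) False (2 * k) (\<xi>0 j) = \<xi>0 j"
    by blast
  have \<xi>0I: "\<xi>0 j \<in> {0..1}" for j using \<xi>0(1)[of j] cyl_subset[OF half_laps_side] by blast
  obtain x s where s: "x \<in> {0..1}" "strict_mono s" "(\<xi>0 \<circ> s) \<longlonglongrightarrow> x"
    using seq_compactE[OF compact_imp_seq_compact[OF compact_Icc[of "0::real" 1]]] \<xi>0I by blast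
  define \<xi> where "\<xi> = \<xi>0 \<circ> s"
  define r where "r = q \<circ> s"
  have r: "r \<longlonglongrightarrow> p" "\<And>j. r j \<in> c" "\<And>j. r j \<in> param_space"
    using LIMSEQ_subseq_LIMSEQ[OF q(2) s(2)] q(1) qP by (simp_all add: r_def)
  have \<xi>: "\<xi> \<longlonglongrightarrow> x" "\<And>j. \<xi> j \<in> {0..1}" "\<And>j. \<xi> j \<in> cyl (maps fam (r j)) side False w"
      "\<And>j. orb (maps fam (r j)) False (2 * k) (\<xi> j) = \<xi> j"
    using s(3) \<xi>0I \<xi>0 by (simp_all add: \<xi>_def r_def del: atLeastAtMost_iff)
  have lim: "(\<lambda>j. orb (maps fam (r j)) False i (\<xi> j)) \<longlonglongrightarrow> orb (maps fam p) False i x" for i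
    by (rule F.orb_tendsto[OF pP s(1) r(1) \<xi>(1) r(3) \<xi>(2)])
  have fixed: "orb (maps fam p) False (2 * k) x = x"
    using LIMSEQ_unique[OF lim[of "2 * k"]] \<xi>(1,4) by simp
  have sides: "if w ! i then 1/2 < orb (maps fam (r j)) False i (\<xi> j) else orb (maps fam (r j)) False i (\<xi> j) < 1/2" if "i < 2 * k" for i j
  proof -
    have "\<forall>i<2 * k. if w ! i then 1/2 < orb (maps fam (r j)) False i (\<xi> j) else orb (maps fam (r j)) False i (\<xi> j) < 1/2"
      using \<xi>(3)[of j] unfolding in_side_cyl_iff[OF F.sym[OF r(3)] \<xi>(2)] len(1) .
    then show ?thesis using that by blast
  qed
  have half: "orb (maps fam p) False i x \<noteq> 1/2" if i: "i < 2 * k" for i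
  proof
    assume eq: "orb (maps fam p) False i x = 1/2"
    let ?b = "odd i"
    have cyc: "orb h ?b (2 * k) (orb h False i y) = orb h False i y" if "orb h False (2 * k) y = y" for h y
    proof -
      have "orb h ?b (2 * k) (orb h False i y) = orb h False (i + 2 * k) y" by (simp add: orb_add)
      also have "\<dots> = orb h False (2 * k + i) y" by (simp add: add.commute)
      also have "\<dots> = orb h False i y" using orb_even_add[of "2 * k" h False i y] that by simp
      finally show ?thesis .
    qed
    have per: "orb (maps fam p) ?b (2 * k) (1/2) = 1/2" using cyc[OF fixed] eq by simp
    obtain B m where B: "B \<in> bones fam n" "p \<in> B" "0 < m" "\<And>q. q \<in> B \<Longrightarrow> orb (maps fam q) ?b (2 * m) (1/2) = 1/2"
      using periodic_imp_bone[OF fam pP k0 per k] by blast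
    have "c \<subseteq> B" using cell_and_bones(3)[OF fam c B(1)] p B(2) by blast
    then have perr: "orb (maps fam (r j)) ?b (2 * m) (1/2) = 1/2" for j using B(4) r(2) by blast
    obtain e where e: "0 < e" "\<forall>\<^sub>F q in nhds p. q \<in> param_space \<longrightarrow> isolates (maps fam q) ?b e"
      using F.isolated_periodic[OF pP d k0 per] by blast
    have "\<forall>\<^sub>F j in sequentially. dist (orb (maps fam (r j)) False i (\<xi> j)) (1/2) < e"
      using tendstoD[OF lim[of i] e(1)] eq by simp
    with eventually_compose_filterlim[OF e(2) r(1)]
    have "\<forall>\<^sub>F j in sequentially. False"
    proof eventually_elim
      case (elim j)
      interpret R: symmetric_pair "maps fam (r j)" by (rule F.sym[OF r(3)])
      let ?y = "orb (maps fam (r j)) False i (\<xi> j)"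
      have "?y \<in> {0..1}" by (rule R.orb_range[OF \<xi>(2)])
      moreover have "orb (maps fam (r j)) ?b (2 * k) ?y = ?y" by (rule cyc[OF \<xi>(4)])
      moreover have "\<bar>?y - 1/2\<bar> < e" using elim(2) by (simp add: dist_real_def)
      ultimately have "?y = 1/2" using isolatesD[OF _ _ _ e(1) k0 _ B(3) perr[of j]] elim(1) r(3)[of j] by blast
      then show False using sides[OF i, of j] by (simp split: if_splits)
    qed
    then show False by simp
  qed
  have "if w ! i then 1/2 < orb (maps fam p) False i x else orb (maps fam p) False i x < 1/2" if i: "i < 2 * k" for i
  proof (cases "w ! i")
    case True
    have "1/2 \<le> orb (maps fam p) False i x"
      by (rule LIMSEQ_le_const[OF lim]) (use sides[OF i] True in \<open>auto intro: less_imp_le\<close>)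
    then show ?thesis using True half[OF i] by simp
  next
    case False
    have "orb (maps fam p) False i x \<le> 1/2"
      by (rule LIMSEQ_le_const2[OF lim]) (use sides[OF i] False in \<open>auto intro: less_imp_le\<close>)
    then show ?thesis using False half[OF i] by simp
  qed
  then have "x \<in> cyl (maps fam p) side False w"
    unfolding in_side_cyl_iff[OF F.sym[OF pP] s(1)] len(1) by blast
  then show ?thesis using len fixed by (auto simp: neg_words_def)
qed

lemma neg_words_constant_on_cell:
  assumes fam: "fam = stunted_tent \<or> fam = quadratic" and c: "c \<in> cells fam n" and k: "k \<le> n"
    and pq: "p \<in> c" "q \<in> c"
  shows "neg_words (maps fam p) k = neg_words (maps fam q) k"
proof -
  interpret F: pair_family param_space "maps fam" by (rule pair_family_maps[OF fam])
  have cP: "c \<subseteq> param_space" by (rule cell_and_bones(2)[OF fam c])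
  have "(\<lambda>p. neg_words (maps fam p) k) constant_on c"
  proof (rule locally_constant_imp_constant[OF cell_and_bones(1)[OF fam c]])
    fix a assume a: "a \<in> c"
    then have aP: "a \<in> param_space" using cP by blast
    have "\<forall>\<^sub>F q in nhds a. q \<in> c \<longrightarrow> w \<in> neg_words (maps fam q) k \<longrightarrow> w \<in> neg_words (maps fam a) k" for w
    proof (rule eventually_by_sequences, rule ccontr)
      fix q assume q: "\<And>j. q j \<in> c" "q \<longlonglongrightarrow> a"
        and no: "\<nexists>j. w \<in> neg_words (maps fam (q j)) k \<longrightarrow> w \<in> neg_words (maps fam a) k"
      have "w \<in> neg_words (maps fam (q j)) k" for j using no by simp
      then have "w \<in> neg_words (maps fam a) k" by (rule neg_words_closed_in_cell[OF fam c k q a])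
      then show False using no by simp
    qed
    then have "\<forall>\<^sub>F q in nhds a. \<forall>w\<in>{w. length w = 2 * k}. q \<in> c \<longrightarrow> w \<in> neg_words (maps fam q) k \<longrightarrow> w \<in> neg_words (maps fam a) k"
      using finite_lists_length_eq[of "UNIV :: bool set" "2 * k"] by (intro eventually_ball_finite) auto
    with F.eventually_neg_words_subset[OF aP, of k]
    have "\<forall>\<^sub>F q in nhds a. q \<in> c \<longrightarrow> neg_words (maps fam q) k = neg_words (maps fam a) k"
    proof eventually_elim
      case (elim q)
      show ?case
      proof
        assume q: "q \<in> c"
        then have "neg_words (maps fam a) k \<subseteq> neg_words (maps fam q) k" using elim(1) cP by blast
        moreover have "neg_words (maps fam q) k \<subseteq> neg_words (maps fam a) k"
          using elim(2) q neg_words_length by blast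
        ultimately show "neg_words (maps fam q) k = neg_words (maps fam a) k" by blast
      qed
    qed
    then obtain U where U: "open U" "a \<in> U" "\<And>q. q \<in> U \<Longrightarrow> q \<in> c \<Longrightarrow> neg_words (maps fam q) k = neg_words (maps fam a) k"
      unfolding eventually_nhds by blast
    show "\<exists>T. openin (top_of_set c) T \<and> a \<in> T \<and> (\<forall>x\<in>T. neg_words (maps fam x) k = neg_words (maps fam a) k)"
    proof (intro exI[of _ "c \<inter> U"] conjI ballI)
      show "openin (top_of_set c) (c \<inter> U)" by (rule openin_open_Int[OF U(1)])
      show "a \<in> c \<inter> U" using U(2) a by blast
      show "neg_words (maps fam x) k = neg_words (maps fam a) k" if "x \<in> c \<inter> U" for x using U(3) that by blast
    qed
  qed
  then show ?thesis using pq unfolding constant_on_def by auto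
qed

section \<open>Comparing entropies\<close>

text \<open>
  Infinitely many counts of negative words at \<open>p\<close> exceed \<open>exp (\<beta> * real k)\<close> and persist nearby, whereas those near
  \<open>p'\<close> are bounded by the number of itineraries at \<open>p'\<close> up to the linear term \<open>4 * real k\<close>.
\<close>

lemma growth_le_of_neg_words:
  assumes fam: "fam = stunted_tent \<or> fam = quadratic"
    and p: "p \<in> param_space" "local_traps param_space (maps fam) p d"
    and p': "p' \<in> param_space" "local_traps param_space (maps fam) p' d'"
    and q: "q \<longlonglongrightarrow> p" "\<And>n. q n \<in> param_space" and q': "q' \<longlonglongrightarrow> p'" "\<And>n. q' n \<in> param_space"
    and eq: "\<And>k. \<forall>\<^sub>F n in sequentially. neg_words (maps fam (q n)) k = neg_words (maps fam (q' n)) k"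
  shows "folded_pair.growth (maps fam p) (d p) \<le> folded_pair.growth (maps fam p') (d' p')"
proof (rule ccontr)
  interpret F: pair_family param_space "maps fam" by (rule pair_family_maps[OF fam])
  interpret A: aperiodic_pair "maps fam p" "d p" using p(2) by (simp add: local_traps_def)
  interpret A': aperiodic_pair "maps fam p'" "d' p'" using p'(2) by (simp add: local_traps_def)
  assume "\<not> A.growth \<le> A'.growth"
  define e where "e = (A.growth - A'.growth) / 3"
  define \<beta> where "\<beta> = A'.growth + 2 * e"
  have e: "0 < e" using \<open>\<not> A.growth \<le> A'.growth\<close> by (simp add: e_def)
  have "A.growth = A'.growth + 3 * e" by (simp add: e_def field_simps)
  then have \<beta>: "0 < \<beta>" "\<beta> < A.growth" using e A'.growth_nonneg by (auto simp: \<beta>_def)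
  obtain B where B: "0 < B" "\<And>k. real (card (A'.words (2 * k))) \<le> B * exp ((A'.growth + e) * real k)"
    using A'.card_words_le_exp[OF e] by blast
  define g where "g = A'.growth + e"
  have g: "0 < g" "g < \<beta>" using e A'.growth_nonneg by (auto simp: g_def \<beta>_def)
  have "\<forall>\<^sub>F k in sequentially. B * exp (g * real k) + 4 * real k < exp (\<beta> * real k)"
    using B(1) g by real_asymp
  then obtain K where K: "\<And>k. K \<le> k \<Longrightarrow> B * exp (g * real k) + 4 * real k < exp (\<beta> * real k)"
    unfolding eventually_sequentially by blast
  obtain k where k: "K \<le> k" "exp (\<beta> * real k) \<le> real (card (neg_words (maps fam p) k))"
    using A.frequently_many_neg_words[OF \<beta>] by blast
  have "\<forall>\<^sub>F n in sequentially. False"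
    using eventually_compose_filterlim[OF F.eventually_neg_words_subset[OF p(1), of k] q(1)]
      eventually_compose_filterlim[OF F.near_neg_words_bound[OF p', of k] q'(1)] eq[of k]
  proof eventually_elim
    case (elim n)
    have "card (neg_words (maps fam p) k) \<le> card (neg_words (maps fam (q n)) k)"
      using elim(1) q(2) by (intro card_mono) auto
    also have "\<dots> \<le> card (A'.words (2 * k)) + 4 * k" using elim(2,3) q'(2) by simp
    finally have "real (card (neg_words (maps fam p) k)) \<le> real (card (A'.words (2 * k))) + 4 * real k" by linarith
    then show False using K[OF k(1)] k(2) B(2)[of k] unfolding g_def by linarith
  qed
  then show False by simp
qed

lemma ereal_close:
  assumes "ereal (g - e) \<le> a" "a \<le> ereal (g + e)" "ereal (g - e) \<le> b" "b \<le> ereal (g + e)" "3 * e = \<epsilon>" "0 < e"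
  shows "\<bar>a - b\<bar> < ereal \<epsilon>"
  using assms by (cases a; cases b) auto

theorem lemma5p5:
  fixes fam :: "real \<Rightarrow> real \<Rightarrow> real" and \<epsilon> :: real
  assumes "fam = stunted_tent \<or> fam = quadratic"
    and "\<epsilon> > 0"
  shows "\<exists>n\<ge>1. \<forall>c\<in>cells fam n. \<forall>p\<in>closure c. \<forall>p'\<in>closure c.
           \<bar>pair_entropy fam p - pair_entropy fam p'\<bar> < ereal \<epsilon>"
proof (rule ccontr)
  note fam = assms(1)
  interpret F: pair_family param_space "maps fam" by (rule pair_family_maps[OF fam])
  assume neg: "\<not> ?thesis"
  \<comment> \<open>cells of finer and finer complexes, each containing two parameters whose entropies are not close\<close>
  have "\<forall>n. \<exists>z. case z of (c, p, p') \<Rightarrow> c \<in> cells fam (Suc n) \<and> p \<in> closure c \<and> p' \<in> closure c \<and>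
      \<not> \<bar>pair_entropy fam p - pair_entropy fam p'\<bar> < ereal \<epsilon>"
  proof
    fix n
    have "1 \<le> Suc n" by simp
    then obtain c p p' where "c \<in> cells fam (Suc n)" "p \<in> closure c" "p' \<in> closure c"
        "\<not> \<bar>pair_entropy fam p - pair_entropy fam p'\<bar> < ereal \<epsilon>"
      using neg by blast
    then show "\<exists>z. case z of (c, p, p') \<Rightarrow> c \<in> cells fam (Suc n) \<and> p \<in> closure c \<and> p' \<in> closure c \<and>
        \<not> \<bar>pair_entropy fam p - pair_entropy fam p'\<bar> < ereal \<epsilon>"
      by (intro exI[of _ "(c, p, p')"]) simp
  qed
  from choice[OF this] obtain Z where Z: "\<And>n. case Z n of (c, p, p') \<Rightarrow> c \<in> cells fam (Suc n) \<and> p \<in> closure c \<and> p' \<in> closure c \<and>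
      \<not> \<bar>pair_entropy fam p - pair_entropy fam p'\<bar> < ereal \<epsilon>" by blast
  define c where "c n = fst (Z n)" for n
  define P where "P n = fst (snd (Z n))" for n
  define P' where "P' n = snd (snd (Z n))" for n
  have c: "c n \<in> cells fam (Suc n)" "P n \<in> closure (c n)" "P' n \<in> closure (c n)"
    "\<not> \<bar>pair_entropy fam (P n) - pair_entropy fam (P' n)\<bar> < ereal \<epsilon>" for n
    using Z[of n] by (simp_all add: c_def P_def P'_def case_prod_beta)
  have cP: "c n \<subseteq> param_space" for n by (rule cell_and_bones(2)[OF fam c(1)])
  then have clP: "closure (c n) \<subseteq> param_space" for n by (rule closure_minimal[OF _ closed_param_space])
  have PP: "P n \<in> param_space" "P' n \<in> param_space" for n using c(2,3) clP by blast+
  \<comment> \<open>the words are constant on cells only, not on their closures\<close>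
  have "\<forall>n. \<exists>t. t \<in> c n \<and> dist t (P n) < inverse (real (Suc n))"
    using c(2) unfolding closure_approachable by (meson inverse_positive_iff_positive of_nat_0_less_iff zero_less_Suc)
  from choice[OF this] obtain Q where Q: "\<And>n. Q n \<in> c n" "\<And>n. dist (Q n) (P n) < inverse (real (Suc n))" by blast
  have "\<forall>n. \<exists>t. t \<in> c n \<and> dist t (P' n) < inverse (real (Suc n))"
    using c(3) unfolding closure_approachable by (meson inverse_positive_iff_positive of_nat_0_less_iff zero_less_Suc)
  from choice[OF this] obtain Q' where Q': "\<And>n. Q' n \<in> c n" "\<And>n. dist (Q' n) (P' n) < inverse (real (Suc n))" by blast
  obtain z s where s: "z \<in> param_space \<times> param_space" "strict_mono s" "((\<lambda>n. (P n, P' n)) \<circ> s) \<longlonglongrightarrow> z"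
    using seq_compactE[OF compact_imp_seq_compact[OF compact_Times[OF compact_param_space compact_param_space]], of "\<lambda>n. (P n, P' n)"] PP by blast
  define p where "p = fst z"
  define p' where "p' = snd z"
  have p: "p \<in> param_space" "p' \<in> param_space" using s(1) by (auto simp: p_def p'_def)
  have limP: "(\<lambda>n. P (s n)) \<longlonglongrightarrow> p" "(\<lambda>n. P' (s n)) \<longlonglongrightarrow> p'"
    using tendsto_fst[OF s(3)] tendsto_snd[OF s(3)] by (simp_all add: p_def p'_def o_def)
  have dist0: "(\<lambda>n. dist (Q (s n)) (P (s n))) \<longlonglongrightarrow> 0" "(\<lambda>n. dist (Q' (s n)) (P' (s n))) \<longlonglongrightarrow> 0"
  proof -
    have inv: "(\<lambda>n. inverse (real (Suc (s n)))) \<longlonglongrightarrow> 0"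
      using LIMSEQ_subseq_LIMSEQ[OF LIMSEQ_inverse_real_of_nat s(2)] by (simp add: o_def)
    show "(\<lambda>n. dist (Q (s n)) (P (s n))) \<longlonglongrightarrow> 0"
      by (rule tendsto_sandwich[OF _ _ tendsto_const inv]) (use Q(2) in \<open>auto intro!: always_eventually less_imp_le\<close>)
    show "(\<lambda>n. dist (Q' (s n)) (P' (s n))) \<longlonglongrightarrow> 0"
      by (rule tendsto_sandwich[OF _ _ tendsto_const inv]) (use Q'(2) in \<open>auto intro!: always_eventually less_imp_le\<close>)
  qed
  have limQ: "(\<lambda>n. Q (s n)) \<longlonglongrightarrow> p" "(\<lambda>n. Q' (s n)) \<longlonglongrightarrow> p'"
  proof -
    have diff0: "(\<lambda>n. Q (s n) - P (s n)) \<longlonglongrightarrow> 0" "(\<lambda>n. Q' (s n) - P' (s n)) \<longlonglongrightarrow> 0"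
      using tendsto_norm_zero_cancel[OF dist0(1)[unfolded dist_norm]] tendsto_norm_zero_cancel[OF dist0(2)[unfolded dist_norm]] by blast+
    show "(\<lambda>n. Q (s n)) \<longlonglongrightarrow> p" by (rule Lim_transform[OF limP(1) diff0(1)])
    show "(\<lambda>n. Q' (s n)) \<longlonglongrightarrow> p'" by (rule Lim_transform[OF limP(2) diff0(2)])
  qed
  have QP: "Q (s n) \<in> param_space" "Q' (s n) \<in> param_space" for n using Q(1) Q'(1) cP by blast+
  have eq: "\<forall>\<^sub>F n in sequentially. neg_words (maps fam (Q (s n))) k = neg_words (maps fam (Q' (s n))) k" for k
  proof (rule eventually_sequentiallyI[of k])
    fix n assume "k \<le> n"
    then have "k \<le> Suc (s n)" using seq_suble[OF s(2), of n] by linarith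
    then show "neg_words (maps fam (Q (s n))) k = neg_words (maps fam (Q' (s n))) k"
      by (rule neg_words_constant_on_cell[OF fam c(1) _ Q(1) Q'(1)])
  qed
  have eq': "\<forall>\<^sub>F n in sequentially. neg_words (maps fam (Q' (s n))) k = neg_words (maps fam (Q (s n))) k" for k
    using eq[of k] by (rule eventually_mono) simp
  obtain d where d: "local_traps param_space (maps fam) p d" using exists_local_traps[OF fam p(1)] by blast
  obtain d' where d': "local_traps param_space (maps fam) p' d'" using exists_local_traps[OF fam p(2)] by blast
  define g where "g = folded_pair.growth (maps fam p) (d p)"
  have g': "folded_pair.growth (maps fam p') (d' p') = g" unfolding g_def
    by (rule antisym[OF growth_le_of_neg_words[OF fam p(2) d' p(1) d limQ(2) QP(2) limQ(1) QP(1) eq']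
          growth_le_of_neg_words[OF fam p(1) d p(2) d' limQ(1) QP(1) limQ(2) QP(2) eq]])
  define e where "e = \<epsilon> / 3"
  have e: "0 < e" "3 * e = \<epsilon>" using assms(2) by (simp_all add: e_def)
  have ent: "pair_entropy fam t = F.fam_entropy t" for t by (simp add: pair_entropy_def maps_def)
  have "\<forall>\<^sub>F n in sequentially. False"
    using eventually_compose_filterlim[OF F.near_entropy_lower[OF p(1) d e(1)] limP(1)]
      eventually_compose_filterlim[OF F.near_entropy_upper[OF p(1) d e(1)] limP(1)]
      eventually_compose_filterlim[OF F.near_entropy_lower[OF p(2) d' e(1)] limP(2)]
      eventually_compose_filterlim[OF F.near_entropy_upper[OF p(2) d' e(1)] limP(2)]
  proof eventually_elim
    case (elim n)
    have "\<bar>F.fam_entropy (P (s n)) - F.fam_entropy (P' (s n))\<bar> < ereal \<epsilon>"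
      using elim PP unfolding g' g_def[symmetric] by (intro ereal_close[OF _ _ _ _ e(2,1)]) blast+
    then show False using c(4)[of "s n"] unfolding ent by blast
  qed
  then show False by simp
qed

end
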